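(* Let $0<T\le+\infty$ (the case $T=+\infty$ being the global one). Let $p(\cdot)\in\mathcal{P}^{\log}(\mathbb{R}^3)$ be a variable exponent such that both $p(\cdot)$ and $p(\cdot)/2$ satisfy the standing bound on exponents, i.e. $2<p^-\le p^+<+\infty$. Then there exists a constant $\eta>0$, depending only on $p(\cdot)$ (in particular not on $T$), such that the following holds. Let $\vec{u}_0\in\mathcal{L}^{p(\cdot)}_{3}(\mathbb{R}^3)$ be a vector field $\mathbb{R}^3\to\mathbb{R}^3$ with $\mathrm{div}(\vec{u}_0)=0$, and let $\vec{f}$ be an external force with $\mathrm{div}(\vec{f})=0$ of the form $\vec{f}=\mathrm{div}(\mathbb{F})$, where $\mathbb{F}$ is a ($3\times3$) tensor field with $\mathbb{F}\in\mathcal{L}^{p(\cdot)/2}_{3/2}\big(\mathbb{R}^3,L^\infty([0,T[)\big)$. If $$\|\vec{u}_0\|_{\mathcal{L}^{p(\cdot)}_{3}}+\|\mathbb{F}\|_{\mathcal{L}^{p(\cdot)/2}_{3/2}(\mathbb{R}^3,L^\infty([0,T[))}\le\eta,$$ then the Navier-Stokes equations $$\partial_t\vec{u}=\Delta\vec{u}-(\vec{u}\cdot\vec{\nabla})\vec{u}-\vec{\nabla}P+\vec{f},\qquad \mathrm{div}(\vec{u})=0,\qquad \vec{u}(0,\cdot)=\vec{u}_0,$$ admit a unique mild solution $\vec{u}$ in the space $\mathcal{L}^{p(\cdot)}_{3}\big(\mathbb{R}^3,L^\infty([0,T[)\big)$.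
   Context: **Variable exponents.** $\mathcal{P}(\mathbb{R}^n)$ is the set of measurable functions $p(\cdot):\mathbb{R}^n\to[1,+\infty[$, with $p^-=\operatorname{ess\,inf}_{x}p(x)$ and $p^+=\operatorname{ess\,sup}_{x}p(x)$. Throughout, all variable exponents used are assumed to satisfy $1<p^-\le p^+<+\infty$. One says $p(\cdot)\in\mathcal{P}^{\log}(\mathbb{R}^n)$ if $p(\cdot)\in\mathcal{P}(\mathbb{R}^n)$ and there is a constant $C$ such that $$\left|\tfrac{1}{p(x)}-\tfrac{1}{p(y)}\right|\le\frac{C}{\log(e+1/|x-y|)}\ \text{ for all }x,y\in\mathbb{R}^n,\qquad \left|\tfrac{1}{p(x)}-\tfrac{1}{p_\infty}\right|\le\frac{C}{\log(e+|x|)}\ \text{ for all }x\in\mathbb{R}^n,$$ where $\frac1{p_\infty}=\lim_{|x|\to+\infty}\frac1{p(x)}$. **Spaces.** For measurable $f$ (scalar, vector or tensor valued) on $\mathbb{R}^n$, the Luxemburg norm is $$\|f\|_{L^{p(\cdot)}}=\inf\Big\{\lambda>0:\ \int_{\mathbb{R}^n}|f(x)/\lambda|^{p(x)}dx\le1\Big\},$$ and $L^{p(\cdot)}(\mathbb{R}^n)$ is the space of measurable functions for which it is finite. For a constant $1<\mathfrak{p}<+\infty$, $\mathcal{L}^{p(\cdot)}_{\mathfrak{p}}(\mathbb{R}^n)=L^{p(\cdot)}(\mathbb{R}^n)\cap L^{\mathfrak{p}}(\mathbb{R}^n)$, normed by $\|\cdot\|_{\mathcal{L}^{p(\cdot)}_{\mathfrak{p}}}=\max\{\|\cdot\|_{L^{p(\cdot)}},\|\cdot\|_{L^{\mathfrak{p}}}\}$.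 The space $\mathcal{L}^{p(\cdot)}_{\mathfrak{p}}(\mathbb{R}^3,L^\infty([0,T[))$ consists of measurable functions $g$ on $[0,T[\times\mathbb{R}^3$ such that $x\mapsto\|g(\cdot,x)\|_{L^\infty([0,T[)}$ belongs to $\mathcal{L}^{p(\cdot)}_{\mathfrak{p}}(\mathbb{R}^3)$, with norm the $\mathcal{L}^{p(\cdot)}_{\mathfrak{p}}$-norm of that function of $x$ (the time norm is taken first, then the space norm). **Mild solutions.** Let $\mathfrak{g}_t$ be the heat kernel on $\mathbb{R}^3$ and $\mathbb{P}(\vec\varphi)=\vec\varphi+\vec\nabla\frac{1}{(-\Delta)}(\vec\nabla\cdot\vec\varphi)$ the Leray projector onto divergence free fields (equivalently $\mathbb{P}=\mathrm{Id}_{3\times3}-\vec R\otimes\vec R$, with $\vec R=(R_1,R_2,R_3)$ the Riesz transforms, up to the usual sign convention). A mild solution on $[0,T[$ is a solution of the integral equation $$\vec u(t,x)=\mathfrak{g}_t\ast\vec u_0(x)+\int_0^t\mathfrak{g}_{t-s}\ast\vec f(s,x)\,ds-\int_0^t\mathfrak{g}_{t-s}\ast\mathbb{P}(\mathrm{div}(\vec u\otimes\vec u))(s,x)\,ds,$$ where derivatives in $\vec f=\mathrm{div}(\mathbb{F})$ and $\mathrm{div}(\vec u\otimes\vec u)$ are understood in the sense of distributions and are transferred to the kernel $\mathfrak{g}_{t-s}$ in the convolutions. *)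

theory Defs
  imports "HOL-Probability.Essential_Supremum"
begin

definition exponent_inf :: "('a::euclidean_space \<Rightarrow> real) \<Rightarrow> ereal" where
  "exponent_inf p = - esssup lebesgue (\<lambda>x. - ereal (p x))"

definition exponent_sup :: "('a::euclidean_space \<Rightarrow> real) \<Rightarrow> ereal" where
  "exponent_sup p = esssup lebesgue (\<lambda>x. ereal (p x))"

definition variable_exponents :: "('a::euclidean_space \<Rightarrow> real) set" where
  "variable_exponents = {p \<in> borel_measurable lebesgue. \<forall>x. 1 \<le> p x}"

text \<open>The number \<open>L\<close> below is \<open>1 / p\<^sub>\<infinity>\<close>. For \<open>x = y\<close> the first inequality only says \<open>0 \<le> C\<close>.\<close>

definition log_variable_exponents :: "('a::euclidean_space \<Rightarrow> real) set" where
  "log_variable_exponents = {p \<in> variable_exponents. \<exists>C L.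
     ((\<lambda>x. 1 / p x) \<longlongrightarrow> L) at_infinity \<and>
     (\<forall>x y. \<bar>1 / p x - 1 / p y\<bar> \<le> C / ln (exp 1 + 1 / norm (x - y))) \<and>
     (\<forall>x. \<bar>1 / p x - L\<bar> \<le> C / ln (exp 1 + norm x))}"

text \<open>Norms take the value \<open>\<infinity>\<close> on functions outside the space; in particular the infimum of
  the empty set is \<open>\<infinity>\<close> in \<^typ>\<open>ennreal\<close>.\<close>

definition luxemburg_norm ::
    "('a::euclidean_space \<Rightarrow> real) \<Rightarrow> ('a \<Rightarrow> 'b::real_normed_vector) \<Rightarrow> ennreal" where
  "luxemburg_norm p f =
     (INF l \<in> {l::real. 0 < l \<and> (\<integral>\<^sup>+x. ennreal (norm (f x /\<^sub>R l) powr p x) \<partial>lebesgue) \<le> 1}.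
        ennreal l)"

definition Lq_norm :: "real \<Rightarrow> ('a::euclidean_space \<Rightarrow> 'b::real_normed_vector) \<Rightarrow> ennreal" where
  "Lq_norm q f =
     (let I = (\<integral>\<^sup>+x. ennreal (norm (f x) powr q) \<partial>lebesgue)
      in if I = \<infinity> then \<infinity> else ennreal (enn2real I powr (1 / q)))"

definition mixed_norm ::
    "('a::euclidean_space \<Rightarrow> real) \<Rightarrow> real \<Rightarrow> ('a \<Rightarrow> 'b::real_normed_vector) \<Rightarrow> ennreal" where
  "mixed_norm p q f = max (luxemburg_norm p f) (Lq_norm q f)"

definition mixed_space ::
    "('a::euclidean_space \<Rightarrow> real) \<Rightarrow> real \<Rightarrow> ('a \<Rightarrow> 'b::real_normed_vector) set" where
  "mixed_space p q =
     {f \<in> borel_measurable lebesgue. luxemburg_norm p f < \<infinity> \<and> Lq_norm q f < \<infinity>}"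

definition time_interval :: "ereal \<Rightarrow> real set" where
  "time_interval T = {t. 0 \<le> t \<and> ereal t < T}"

abbreviation space_time :: "ereal \<Rightarrow> (real \<times> 'a::euclidean_space) measure" where
  "space_time T \<equiv> lebesgue_on (time_interval T \<times> UNIV)"

definition time_sup_norm ::
    "ereal \<Rightarrow> (real \<Rightarrow> 'a::euclidean_space \<Rightarrow> 'b::real_normed_vector) \<Rightarrow> 'a \<Rightarrow> ereal" where
  "time_sup_norm T g x = esssup (lebesgue_on (time_interval T)) (\<lambda>t. ereal (norm (g t x)))"

text \<open>Passing to \<^const>\<open>real_of_ereal\<close> loses nothing in \<open>mixed_time_norm\<close> on the
  functions of \<open>mixed_time_space\<close>, as the time norm is finite almost everywhere there.\<close>

definition mixed_time_norm ::
    "('a::euclidean_space \<Rightarrow> real) \<Rightarrow> real \<Rightarrow> ereal \<Rightarrow>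
     (real \<Rightarrow> 'a \<Rightarrow> 'b::real_normed_vector) \<Rightarrow> ennreal" where
  "mixed_time_norm p q T g = mixed_norm p q (\<lambda>x. real_of_ereal (time_sup_norm T g x))"

definition mixed_time_space ::
    "('a::euclidean_space \<Rightarrow> real) \<Rightarrow> real \<Rightarrow> ereal \<Rightarrow>
     (real \<Rightarrow> 'a \<Rightarrow> 'b::real_normed_vector) set" where
  "mixed_time_space p q T =
     {g. (\<lambda>(t, x). g t x) \<in> borel_measurable (space_time T) \<and>
         (AE x in lebesgue. time_sup_norm T g x < \<infinity>) \<and>
         (\<lambda>x. real_of_ereal (time_sup_norm T g x)) \<in> mixed_space p q}"

definition partial_deriv :: "'n::finite \<Rightarrow> (real^'n \<Rightarrow> real) \<Rightarrow> real^'n \<Rightarrow> real" where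
  "partial_deriv k f x = frechet_derivative f (at x) (axis k 1)"

definition gradient :: "(real^'n::finite \<Rightarrow> real) \<Rightarrow> real^'n \<Rightarrow> real^'n" where
  "gradient f x = (\<chi> k. partial_deriv k f x)"

definition divergence :: "(real^'n::finite \<Rightarrow> real^'n) \<Rightarrow> real^'n \<Rightarrow> real" where
  "divergence v x = (\<Sum>k\<in>UNIV. partial_deriv k (\<lambda>y. v y $ k) x)"

primrec iterated_deriv ::
    "'a list \<Rightarrow> ('a::real_normed_vector \<Rightarrow> real) \<Rightarrow> 'a \<Rightarrow> real" where
  "iterated_deriv [] f = f"
| "iterated_deriv (v # vs) f = (\<lambda>x. frechet_derivative (iterated_deriv vs f) (at x) v)"

definition test_functions :: "'a set \<Rightarrow> ('a::real_normed_vector \<Rightarrow> real) set" where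
  "test_functions U = {f. (\<forall>vs x. iterated_deriv vs f differentiable (at x)) \<and>
     compact (closure (support_on UNIV f)) \<and> closure (support_on UNIV f) \<subseteq> U}"

definition div_free :: "(real^'n::finite \<Rightarrow> real^'n) \<Rightarrow> bool" where
  "div_free v \<longleftrightarrow> (\<forall>\<phi> \<in> test_functions UNIV. (LINT x|lebesgue. v x \<bullet> gradient \<phi> x) = 0)"

text \<open>The value of the distribution \<open>div M\<close>, whose \<open>j\<close>-th component is \<open>\<Sum>k. \<partial>\<^sub>k M\<^sub>j\<^sub>k\<close>, at the
  vector field \<open>\<psi>\<close>.\<close>

definition div_distr ::
    "(real^'n::finite \<Rightarrow> real^'n^'n) \<Rightarrow> (real^'n \<Rightarrow> real^'n) \<Rightarrow> real" where
  "div_distr M \<psi> = - (LINT y|lebesgue.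
     (\<Sum>j\<in>UNIV. \<Sum>k\<in>UNIV. M y $ j $ k * partial_deriv k (\<lambda>z. \<psi> z $ j) y))"

text \<open>\<open>div f = 0\<close> in the sense of distributions on \<open>]0,T[ \<times> \<real>\<^sup>n\<close>, for the distribution
  \<open>f = div F\<close>: it vanishes on gradients of test functions.\<close>

definition force_div_free :: "ereal \<Rightarrow> (real \<Rightarrow> real^'n::finite \<Rightarrow> real^'n^'n) \<Rightarrow> bool" where
  "force_div_free T F \<longleftrightarrow>
     (\<forall>\<phi> \<in> test_functions ({t. 0 < t \<and> ereal t < T} \<times> UNIV).
        (LINT t:time_interval T|lebesgue. div_distr (F t) (gradient (\<lambda>x. \<phi> (t, x)))) = 0)"

definition tensor :: "real^'n::finite \<Rightarrow> real^'n \<Rightarrow> real^'n^'n" where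
  "tensor u v = (\<chi> i j. u $ i * v $ j)"

definition heat_kernel :: "real \<Rightarrow> real^3 \<Rightarrow> real" where
  "heat_kernel t x = (4 * pi * t) powr (- 3 / 2) * exp (- (norm x)\<^sup>2 / (4 * t))"

definition heat_conv :: "real \<Rightarrow> (real^3 \<Rightarrow> real^3) \<Rightarrow> real^3 \<Rightarrow> real^3" where
  "heat_conv t v x = (LINT y|lebesgue. heat_kernel t (x - y) *\<^sub>R v y)"

text \<open>\<open>(-\<Delta>)\<inverse>\<close> on \<open>\<real>\<^sup>3\<close>, as convolution with the Newtonian kernel.\<close>

definition inv_neg_laplacian :: "(real^3 \<Rightarrow> real) \<Rightarrow> real^3 \<Rightarrow> real" where
  "inv_neg_laplacian h x = (LINT y|lebesgue. h y / (4 * pi * norm (x - y)))"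

definition leray :: "(real^3 \<Rightarrow> real^3) \<Rightarrow> real^3 \<Rightarrow> real^3" where
  "leray \<phi> x = \<phi> x + gradient (inv_neg_laplacian (divergence \<phi>)) x"

text \<open>The \<open>i\<close>-th component of \<open>g\<^sub>t * S (x)\<close> is the value of the distribution \<open>S\<close> at the
  vector field \<open>y \<mapsto> g\<^sub>t (x - y) e\<^sub>i\<close>. As \<^const>\<open>leray\<close> is symmetric, \<open>P (div M)\<close> is the
  distribution \<open>\<psi> \<mapsto> div M (P \<psi>)\<close>. In this way all derivatives fall on the heat kernel.\<close>

definition heat_conv_div :: "real \<Rightarrow> (real^3 \<Rightarrow> real^3^3) \<Rightarrow> real^3 \<Rightarrow> real^3" where
  "heat_conv_div t M x =
     (\<chi> i. div_distr M (\<lambda>y. heat_kernel t (x - y) *\<^sub>R axis i 1))"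

definition heat_conv_leray_div :: "real \<Rightarrow> (real^3 \<Rightarrow> real^3^3) \<Rightarrow> real^3 \<Rightarrow> real^3" where
  "heat_conv_leray_div t M x =
     (\<chi> i. div_distr M (leray (\<lambda>y. heat_kernel t (x - y) *\<^sub>R axis i 1)))"

definition mild_solution ::
    "ereal \<Rightarrow> (real^3 \<Rightarrow> real^3) \<Rightarrow> (real \<Rightarrow> real^3 \<Rightarrow> real^3^3) \<Rightarrow>
     (real \<Rightarrow> real^3 \<Rightarrow> real^3) \<Rightarrow> bool" where
  "mild_solution T u0 F u \<longleftrightarrow>
     (AE (t, x) in space_time T.
        u t x = heat_conv t u0 x
          + (LINT s:{0..t}|lebesgue. heat_conv_div (t - s) (F s) x)
          - (LINT s:{0..t}|lebesgue. heat_conv_leray_div (t - s) (\<lambda>y. tensor (u s y) (u s y)) x))"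

end

theory Submission
  imports Defs "HOL-Analysis.Analysis" "HOL-Probability.Probability"
begin

text \<open>
Everything is estimated pointwise in \<open>x\<close> by the supremum in time. The heat kernel is dominated by
the maximal function, and since the kernel of \<open>g\<^sub>t * \<P> div\<close> is of size
\<open>(sqrt t + \<bar>x\<bar>) ^ (- 4)\<close>, its time integral is of size \<open>\<bar>x\<bar> ^ (- 2)\<close>; hence the Duhamel term of
a tensor bounded by \<open>M\<close> uniformly in time is at most a multiple of the Riesz potential \<open>I\<^sub>1 M\<close>.
By Hedberg's inequality \<open>I\<^sub>1 M \<le> C (\<parallel>M\<parallel>\<^bsub>3/2\<^esub> \<M> M)\<^sup>1\<^sup>/\<^sup>2\<close>, so the boundedness of the maximal function on
\<open>L\<^bsup>p/2\<^esup>\<close> and \<open>L\<^bsup>3/2\<^esup>\<close> turns smallness of \<open>M\<close> in \<open>L\<^bsup>p/2\<^esup> \<inter> L\<^bsup>3/2\<^esup>\<close> into smallness of \<open>I\<^sub>1 M\<close> in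
\<open>L\<^bsup>p\<^esup> \<inter> L\<^bsup>3\<^esup>\<close>. This gives small solutions \<open>G\<close> of the scalar equation \<open>G = E + K I\<^sub>1 (G\<^sup>2)\<close>, and the Picard
iterates of the fluid equation converge because they are dominated by those of the scalar one.

Uniqueness holds without smallness of the competing solution. On a short time interval the sum
\<open>S\<close> of the two majorants is split into its part above a high level, which is small in \<open>L\<^bsup>3\<^esup>\<close>, and
a bounded part, on which the short time makes the Duhamel operator small. Both together make the
difference contract in \<open>L\<^bsup>3\<^esup>\<close>, and the length of the interval depends on \<open>S\<close> only, so one can
step through \<open>[0,T[\<close>.
\<close>

text \<open>Smallness is expressed throughout by modulars bounded by 1, never by a Banach space
  structure on fields with values in bounded functions of time. Such bounds survive increasing
  limits by monotone convergence, and the velocity iterates converge at every point where the scalar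
  majorant is finite; the price is lost constants, such as the factor 4 in \<open>small_add\<close>.
  No estimate behind the choice of the smallness constant involves T, because the time integral of
  the Oseen kernel over the whole half line is finite off the origin.

  The hard analytic input is the maximal theorem for variable exponents. A function is cut at height
  1. Where it is large, the smallest exponent on a ball is used, and the local condition bounds the
  loss because a power of order 1 / ln (1 / r) of a ball volume stays bounded. Where it is small,
  the exponent is exchanged for its value at infinity, up to an integrable error. The second
  obstacle is that the Leray projector is given by the Newtonian potential, so the Oseen kernel has
  to be computed explicitly before it can be estimated.\<close>

text \<open>Multiplicative for every exponent, at the price of the junk values \<open>top epowr r = top\<close> for \<open>r \<le> 0\<close> and \<open>0 epowr 0 = 0\<close>.\<close>

definition epowr :: "ennreal \<Rightarrow> real \<Rightarrow> ennreal" (infixr \<open>epowr\<close> 80) where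
  "x epowr r = (if x = top then top else ennreal (enn2real x powr r))"

lemma epowr_top [simp]: "top epowr r = top"
  by (simp add: epowr_def)

lemma epowr_zero [simp]: "0 epowr r = 0"
  by (simp add: epowr_def)

lemma epowr_one [simp]: "1 epowr r = 1"
  by (simp add: epowr_def)

lemma epowr_ennreal: "0 \<le> a \<Longrightarrow> ennreal a epowr r = ennreal (a powr r)"
  by (simp add: epowr_def)

lemma epowr_exponent_one [simp]: "x epowr 1 = x"
  by (cases x) (auto simp: epowr_def)

lemma epowr_mono: "x \<le> y \<Longrightarrow> 0 \<le> r \<Longrightarrow> x epowr r \<le> y epowr r"
  by (cases x; cases y) (auto simp: epowr_ennreal top_unique intro!: ennreal_leI powr_mono2)

lemma epowr_mult: "(x * y) epowr r = x epowr r * y epowr r"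
proof (cases "x = top \<or> y = top")
  case True
  then show ?thesis
    by (cases x; cases y) (auto simp: epowr_ennreal ennreal_mult_top ennreal_top_mult epowr_def)
next
  case False
  then show ?thesis
    by (cases x; cases y) (auto simp: epowr_ennreal powr_mult simp flip: ennreal_mult)
qed

lemma epowr_epowr: "(x epowr r) epowr s = x epowr (r * s)"
  by (cases x) (auto simp: epowr_ennreal powr_powr)

lemma epowr_add: "x epowr (r + s) = x epowr r * x epowr s"
  by (cases x) (auto simp: epowr_ennreal powr_add ennreal_mult_top simp flip: ennreal_mult)

lemma epowr_le_cancel: "x epowr r \<le> y epowr r \<Longrightarrow> 0 < r \<Longrightarrow> x \<le> y"
  using epowr_mono[of "x epowr r" "y epowr r" "1 / r"] by (simp add: epowr_epowr)

lemma epowr_eq_0_iff [simp]: "x epowr r = 0 \<longleftrightarrow> x = 0"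
  by (cases x) (auto simp: epowr_ennreal ennreal_eq_0_iff powr_def)

lemma epowr_eq_top_iff [simp]: "x epowr r = top \<longleftrightarrow> x = top"
  by (simp add: epowr_def)

lemma borel_measurable_epowr [measurable]:
  assumes [measurable]: "f \<in> borel_measurable M" "g \<in> borel_measurable M"
  shows "(\<lambda>x. f x epowr g x) \<in> borel_measurable M"
  unfolding epowr_def by measurable

lemma epowr_mono_exponent: "1 \<le> x \<Longrightarrow> r \<le> s \<Longrightarrow> x epowr r \<le> x epowr s"
  by (cases x) (auto simp: epowr_ennreal intro!: ennreal_leI powr_mono)

lemma epowr_antimono_exponent: "x \<le> 1 \<Longrightarrow> r \<le> s \<Longrightarrow> x epowr s \<le> x epowr r"
  by (cases x) (auto simp: epowr_ennreal top_unique intro!: ennreal_leI powr_mono')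

lemma epowr_2: "x epowr 2 = x * x"
  using epowr_add[of x 1 1] by simp

lemma epowr_numeral: "x epowr numeral n = x ^ numeral n"
  by (cases x) (auto simp: epowr_ennreal powr_numeral ennreal_power top_power_ennreal)


section \<open>Layer cake formula and countable subadditivity\<close>

lemma ennreal_eq_top_of_bounds: "(\<And>b. 0 \<le> b \<Longrightarrow> ennreal b \<le> x) \<Longrightarrow> x = top"
proof (cases x)
  case (real r)
  assume "\<And>b. 0 \<le> b \<Longrightarrow> ennreal b \<le> x"
  from this[of "r + 1"] real show ?thesis by simp
qed

text \<open>The density is the derivative of l^r, integrated up to the level \<open>x\<close>. For
  \<open>x = top\<close> the integral exceeds every finite number by comparison with the finite
  case.\<close>

lemma epowr_layer_cake:
  assumes "0 < r"
  shows "x epowr r =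
    (\<integral>\<^sup>+l. ennreal (r * l powr (r - 1)) * indicator {l. 0 < l \<and> ennreal l < x} l \<partial>lborel)"
proof -
  have fin: "(\<integral>\<^sup>+l. ennreal (r * l powr (r - 1)) * indicator {l. 0 < l \<and> ennreal l < ennreal a} l \<partial>lborel)
      = ennreal (a powr r)" if "0 \<le> a" for a
  proof -
    have "((\<lambda>l. r * l powr (r - 1)) has_integral (r * (a powr (r - 1 + 1) / (r - 1 + 1)))) {0..a}"
      using that assms by (intro has_integral_mult_right has_integral_powr_from_0) auto
    then have "(\<integral>\<^sup>+l. ennreal (r * l powr (r - 1)) * indicator {0..a} l \<partial>lborel) = ennreal (a powr r)"
      using assms by (subst nn_integral_has_integral_lebesgue') auto
    moreover have "AE l in lborel. ennreal (r * l powr (r - 1)) * indicator {0..a} l =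
        ennreal (r * l powr (r - 1)) * indicator {l. 0 < l \<and> ennreal l < ennreal a} l"
      using AE_lborel_singleton[of a] AE_lborel_singleton[of 0]
      by eventually_elim (use that in \<open>auto simp: indicator_def ennreal_less_iff\<close>)
    ultimately show ?thesis
      by (simp add: nn_integral_cong_AE)
  qed
  show ?thesis
  proof (cases x)
    case (real a)
    then show ?thesis using fin[of a] by (simp add: epowr_ennreal)
  next
    case top
    have "ennreal b \<le> (\<integral>\<^sup>+l. ennreal (r * l powr (r - 1)) * indicator {l. 0 < l \<and> ennreal l < top} l \<partial>lborel)"
      if "0 \<le> b" for b
    proof -
      have "ennreal b = ennreal ((b powr (1 / r)) powr r)"
        using assms that by (simp add: powr_powr)
      also have "\<dots> \<le> (\<integral>\<^sup>+l. ennreal (r * l powr (r - 1)) * indicator {l. 0 < l \<and> ennreal l < top} l \<partial>lborel)"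
        by (subst fin[symmetric]) (auto intro!: nn_integral_mono simp: indicator_def)
      finally show ?thesis .
    qed
    then have "(\<integral>\<^sup>+l. ennreal (r * l powr (r - 1)) * indicator {l. 0 < l \<and> ennreal l < top} l \<partial>lborel) = top"
      by (rule ennreal_eq_top_of_bounds)
    then show ?thesis using top by simp
  qed
qed

text \<open>Vitali's covering lemma returns a countable set of centres without an enumeration, hence
  subadditivity with an integral over a counting measure.\<close>

lemma emeasure_UN_countable_le:
  assumes [measurable]: "\<And>i. i \<in> I \<Longrightarrow> X i \<in> sets M" and "countable I"
  shows "emeasure M (\<Union>i\<in>I. X i) \<le> (\<integral>\<^sup>+i. emeasure M (X i) \<partial>count_space I)"
proof -
  have [measurable]: "(\<Union>i\<in>I. X i) \<in> sets M"
    using assms by (intro sets.countable_UN') auto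
  have "emeasure M (\<Union>i\<in>I. X i) = (\<integral>\<^sup>+x. indicator (\<Union>i\<in>I. X i) x \<partial>M)"
    by simp
  also have "\<dots> \<le> (\<integral>\<^sup>+x. \<integral>\<^sup>+i. indicator (X i) x \<partial>count_space I \<partial>M)"
  proof (intro nn_integral_mono)
    fix x show "indicator (\<Union>i\<in>I. X i) x \<le> (\<integral>\<^sup>+i. indicator (X i) x \<partial>count_space I :: ennreal)"
    proof (cases "\<exists>i\<in>I. x \<in> X i")
      case True
      then obtain i where "i \<in> I" "x \<in> X i" by blast
      then show ?thesis
        using nn_integral_ge_point[of i I "\<lambda>i. indicator (X i) x"] by (auto simp: indicator_def)
    qed auto
  qed
  also have "\<dots> = (\<integral>\<^sup>+i. \<integral>\<^sup>+x. indicator (X i) x \<partial>M \<partial>count_space I)"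
    using assms by (intro nn_integral_count_space_nn_integral) auto
  also have "\<dots> = (\<integral>\<^sup>+i. emeasure M (X i) \<partial>count_space I)"
    by (intro nn_integral_cong) simp
  finally show ?thesis .
qed

section \<open>The maximal function\<close>

text \<open>Rational radii make the supremum countable, so that measurability is immediate; for the averages of a fixed function the value is that of the supremum over all radii.\<close>

definition maximal :: "('a::euclidean_space \<Rightarrow> ennreal) \<Rightarrow> 'a \<Rightarrow> ennreal" where
  "maximal f x =
     (SUP r\<in>{r\<in>\<rat>. 0 < r}. (\<integral>\<^sup>+y\<in>ball x r. f y \<partial>lborel) / emeasure lborel (ball x r))"

lemma countable_positive_rats: "countable {r \<in> \<rat>. 0 < (r::real)}"
  by (rule countable_subset[OF _ countable_rat]) auto

lemma emeasure_ball_pos: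
  "0 < r \<Longrightarrow> 0 < emeasure lborel (ball (x::'a::euclidean_space) r)"
  by (simp add: emeasure_ball ennreal_zero_less_mult_iff)

lemma emeasure_ball_scale:
  fixes c :: "'a::euclidean_space"
  assumes "0 \<le> r" "0 \<le> k"
  shows "emeasure lborel (ball c (k * r)) = ennreal (k ^ DIM('a)) * emeasure lborel (ball c r)"
  using assms by (simp add: emeasure_ball power_mult_distrib ennreal_mult' ac_simps)

lemma borel_measurable_ball_integral [measurable]:
  fixes f :: "'a::euclidean_space \<Rightarrow> ennreal"
  assumes [measurable]: "f \<in> borel_measurable borel"
  shows "(\<lambda>x. \<integral>\<^sup>+y\<in>ball x r. f y \<partial>lborel) \<in> borel_measurable borel"
proof -
  have "(\<lambda>x. \<integral>\<^sup>+y. f y * indicator {p. dist (fst p) (snd p) < r} (x, y) \<partial>lborel) \<in> borel_measurable borel"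
    by (rule lborel.borel_measurable_nn_integral) measurable
  then show ?thesis
    by (simp add: indicator_def ball_def)
qed

lemma borel_measurable_maximal [measurable]:
  fixes f :: "'a::euclidean_space \<Rightarrow> ennreal"
  assumes [measurable]: "f \<in> borel_measurable borel"
  shows "maximal f \<in> borel_measurable borel"
proof -
  have [measurable]: "(\<lambda>x::'a. emeasure lborel (ball x r)) \<in> borel_measurable borel" for r
    using borel_measurable_ball_integral[of "\<lambda>x. 1" r] by simp
  show ?thesis
    unfolding maximal_def[abs_def] using countable_positive_rats by measurable
qed

lemma ennreal_less_divide_iff:
  "0 < v \<Longrightarrow> ennreal l < I / ennreal v \<longleftrightarrow> ennreal l * ennreal v < I"
proof -
  assume v: "0 < v"
  show ?thesis
  proof (cases I)
    case (real i)
    then show ?thesis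
    proof (cases "0 \<le> l")
      case True
      then show ?thesis
        using v real by (simp add: divide_ennreal ennreal_less_iff pos_less_divide_eq flip: ennreal_mult)
    next
      case False
      then show ?thesis
        using v real by (simp add: divide_ennreal ennreal_neg zero_less_divide_iff)
    qed
  next
    case top
    then show ?thesis
      using v by (simp add: ennreal_top_divide ennreal_mult_less_top)
  qed
qed

lemma ball_average_le_maximal:
  "r \<in> \<rat> \<Longrightarrow> 0 < r \<Longrightarrow> (\<integral>\<^sup>+y\<in>ball x r. f y \<partial>lborel) / emeasure lborel (ball x r) \<le> maximal f x"
  unfolding maximal_def by (rule SUP_upper) simp

text \<open>This is the price of the rational radii: a rational radius lies between r and 2 r, and
  enlarging the ball multiplies its volume by at most 2^n.\<close>

lemma ball_integral_le_maximal:
  fixes x :: "'a::euclidean_space"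
  assumes "0 < r"
  shows "(\<integral>\<^sup>+y\<in>ball x r. f y \<partial>lborel)
    \<le> ennreal (2 ^ DIM('a)) * emeasure lborel (ball x r) * maximal f x"
proof -
  obtain q where q: "q \<in> \<rat>" "r < q" "q < 2 * r"
    using Rats_dense_in_real[of r "2 * r"] assms by auto
  have fin: "emeasure lborel (ball x q) \<noteq> 0" "emeasure lborel (ball x q) \<noteq> top"
    using emeasure_ball_pos[of q x] emeasure_lborel_ball_finite[of x q] q assms by auto
  have "(\<integral>\<^sup>+y\<in>ball x r. f y \<partial>lborel) \<le> (\<integral>\<^sup>+y\<in>ball x q. f y \<partial>lborel)"
    using q by (intro nn_integral_mono) (auto simp: indicator_def)
  also have "\<dots> = emeasure lborel (ball x q) * ((\<integral>\<^sup>+y\<in>ball x q. f y \<partial>lborel) / emeasure lborel (ball x q))"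
    using fin by (metis ennreal_times_divide mult.commute ennreal_mult_divide_eq)
  also have "\<dots> \<le> emeasure lborel (ball x (2 * r)) * maximal f x"
    using q assms by (intro mult_mono ball_average_le_maximal emeasure_mono) auto
  also have "\<dots> = ennreal (2 ^ DIM('a)) * emeasure lborel (ball x r) * maximal f x"
    using assms by (subst emeasure_ball_scale) auto
  finally show ?thesis .
qed

text \<open>Vitali's argument: each point of the superlevel set is the centre of a ball on which f
  has average above l. Disjoint ones among these balls, enlarged five times, still cover, and the
  integrals of f over disjoint balls add up to at most the total integral.\<close>

lemma maximal_weak_type:
  fixes f :: "'a::euclidean_space \<Rightarrow> ennreal"
  assumes [measurable]: "f \<in> borel_measurable borel" and l: "0 < l"
  shows "ennreal l * emeasure lborel {x. ennreal l < maximal f x}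
    \<le> ennreal (5 ^ DIM('a)) * (\<integral>\<^sup>+y. f y \<partial>lborel)"
proof -
  define V where "V r = unit_ball_vol (real DIM('a)) * r ^ DIM('a)" for r
  define J where "J r x = (\<integral>\<^sup>+y\<in>ball x r. f y \<partial>lborel)" for r and x :: 'a
  have [measurable]: "J r \<in> borel_measurable borel" for r
    unfolding J_def[abs_def] by measurable
  have V: "emeasure lborel (ball x r) = ennreal (V r)" if "0 < r" for x :: 'a and r
    using that by (simp add: emeasure_ball V_def)
  have Vpos: "0 < V r" if "0 < r" for r
    using that by (simp add: V_def)
  \<comment> \<open>The covering lemma needs bounded radii, so the superlevel set is exhausted by
    the points that have a witnessing radius of at most N.\<close>
  define A where "A N = {x. \<exists>r\<in>{r \<in> \<rat>. 0 < r \<and> r \<le> real N}. ennreal l * ennreal (V r) < J r x}" for N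
  have cnt: "countable {r \<in> \<rat>. 0 < r \<and> r \<le> real N}" for N
    by (rule countable_subset[OF _ countable_rat]) auto
  have A_eq: "A N = (\<Union>r\<in>{r \<in> \<rat>. 0 < r \<and> r \<le> real N}. {x. ennreal l * ennreal (V r) < J r x})" for N
    by (auto simp: A_def)
  have A_sets [measurable, simp]: "A N \<in> sets borel" for N
    unfolding A_eq using cnt by (intro sets.countable_UN') auto
  have inc: "incseq A"
  proof (intro incseq_SucI subsetI)
    fix N x assume "x \<in> A N"
    then show "x \<in> A (Suc N)" by (force simp: A_def)
  qed
  have eq: "{x. ennreal l < maximal f x} = (\<Union>N. A N)"
  proof (intro set_eqI iffI)
    fix x assume "x \<in> {x. ennreal l < maximal f x}"
    then obtain r where r: "r \<in> \<rat>" "0 < r" "ennreal l < J r x / ennreal (V r)"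
      by (auto simp: maximal_def less_SUP_iff V J_def)
    moreover obtain N where "r \<le> real N" using real_arch_simple by blast
    ultimately have "x \<in> A N"
      using ennreal_less_divide_iff[OF Vpos] by (auto simp: A_def)
    then show "x \<in> (\<Union>N. A N)" by blast
  next
    fix x assume "x \<in> (\<Union>N. A N)"
    then obtain r where r: "r \<in> \<rat>" "0 < r" "ennreal l * ennreal (V r) < J r x"
      by (auto simp: A_def)
    have "ennreal l < J r x / ennreal (V r)"
      using ennreal_less_divide_iff[OF Vpos[OF r(2)]] r(3) by blast
    then have "ennreal l < (\<integral>\<^sup>+y\<in>ball x r. f y \<partial>lborel) / emeasure lborel (ball x r)"
      by (simp only: J_def V[OF r(2)])
    then show "x \<in> {x. ennreal l < maximal f x}"
      using order.strict_trans2[OF _ ball_average_le_maximal[OF r(1,2), of f x]] by blast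
  qed
  have bound: "ennreal l * emeasure lborel (A N) \<le> ennreal (5 ^ DIM('a)) * (\<integral>\<^sup>+y. f y \<partial>lborel)" for N
  proof -
    have "\<forall>x\<in>A N. \<exists>r. 0 < r \<and> r \<le> real N \<and> ennreal l * ennreal (V r) < J r x"
      by (auto simp: A_def)
    then obtain \<rho> where \<rho>: "\<And>x. x \<in> A N \<Longrightarrow>
        0 < \<rho> x \<and> \<rho> x \<le> real N \<and> ennreal l * ennreal (V (\<rho> x)) < J (\<rho> x) x"
      by metis
    have sub: "A N \<subseteq> (\<Union>x\<in>A N. ball x (\<rho> x))" using \<rho> by force
    obtain C where C: "countable C" "C \<subseteq> A N"
       "pairwise (\<lambda>i j. disjnt (ball i (\<rho> i)) (ball j (\<rho> j))) C"
       "A N \<subseteq> (\<Union>i\<in>C. ball i (5 * \<rho> i))"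
    proof (rule Vitali_covering_lemma_balls[OF sub, of "real N"])
      show "0 < \<rho> i \<and> \<rho> i \<le> real N" if "i \<in> A N" for i
        using \<rho>[OF that] by blast
    qed blast
    have disj: "disjoint_family_on (\<lambda>i. ball i (\<rho> i)) C"
      using C(3) by (auto simp: disjoint_family_on_def pairwise_def disjnt_def)
    have "emeasure lborel (A N) \<le> emeasure lborel (\<Union>i\<in>C. ball i (5 * \<rho> i))"
      using C by (intro emeasure_mono) (auto intro!: sets.countable_UN')
    also have "\<dots> \<le> (\<integral>\<^sup>+i. emeasure lborel (ball i (5 * \<rho> i)) \<partial>count_space C)"
      using C by (intro emeasure_UN_countable_le) auto
    finally have "ennreal l * emeasure lborel (A N) \<le>
        ennreal l * (\<integral>\<^sup>+i. emeasure lborel (ball i (5 * \<rho> i)) \<partial>count_space C)"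
      by (rule mult_left_mono) simp
    also have "\<dots> = (\<integral>\<^sup>+i. ennreal l * emeasure lborel (ball i (5 * \<rho> i)) \<partial>count_space C)"
      by (simp add: nn_integral_cmult)
    also have "\<dots> \<le> (\<integral>\<^sup>+i. ennreal (5 ^ DIM('a)) * J (\<rho> i) i \<partial>count_space C)"
    proof (intro nn_integral_mono)
      fix i assume "i \<in> space (count_space C)"
      then have i: "0 < \<rho> i" "ennreal l * ennreal (V (\<rho> i)) \<le> J (\<rho> i) i"
        using \<rho>[of i] C(2) by (auto intro: less_imp_le)
      have "ennreal l * emeasure lborel (ball i (5 * \<rho> i))
          = ennreal (5 ^ DIM('a)) * (ennreal l * ennreal (V (\<rho> i)))"
        using i(1) by (subst emeasure_ball_scale) (auto simp: V ac_simps)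
      also have "\<dots> \<le> ennreal (5 ^ DIM('a)) * J (\<rho> i) i"
        using i(2) by (intro mult_left_mono) auto
      finally show "ennreal l * emeasure lborel (ball i (5 * \<rho> i)) \<le> ennreal (5 ^ DIM('a)) * J (\<rho> i) i" .
    qed
    also have "\<dots> = ennreal (5 ^ DIM('a)) * (\<integral>\<^sup>+i. emeasure (density lborel f) (ball i (\<rho> i)) \<partial>count_space C)"
      by (simp add: nn_integral_cmult J_def emeasure_density)
    also have "(\<integral>\<^sup>+i. emeasure (density lborel f) (ball i (\<rho> i)) \<partial>count_space C)
        = emeasure (density lborel f) (\<Union>i\<in>C. ball i (\<rho> i))"
      using C(1) disj by (intro emeasure_UN_countable[symmetric]) auto
    also have "\<dots> \<le> emeasure (density lborel f) UNIV"
      by (intro emeasure_mono) auto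
    also have "\<dots> = (\<integral>\<^sup>+y. f y \<partial>lborel)"
      by (simp add: emeasure_density)
    finally show ?thesis
      by (simp add: mult_left_mono)
  qed
  have "ennreal l * emeasure lborel {x. ennreal l < maximal f x} = (SUP N. ennreal l * emeasure lborel (A N))"
    unfolding eq by (subst SUP_emeasure_incseq[symmetric]) (auto simp: inc SUP_mult_left_ennreal)
  also have "\<dots> \<le> ennreal (5 ^ DIM('a)) * (\<integral>\<^sup>+y. f y \<partial>lborel)"
    by (intro SUP_least bound)
  finally show ?thesis .
qed


lemma ennreal_half: "0 \<le> l \<Longrightarrow> 2 * ennreal (l / 2) = ennreal l"
  using ennreal_mult[of 2 "l / 2"] by simp

text \<open>Marcinkiewicz interpolation between the weak type bound and boundedness on L^infinity.
  Only the part of f above l / 2 matters at level l; the layer cake formula is used once for the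
  maximal function and once, after exchanging the integrals, for f.\<close>

lemma maximal_strong_type:
  assumes r: "1 < r"
  shows "\<exists>C>0. \<forall>f\<in>borel_measurable (borel :: 'a::euclidean_space measure).
    (\<integral>\<^sup>+x. maximal f x epowr r \<partial>lborel) \<le> ennreal C * (\<integral>\<^sup>+x. f x epowr r \<partial>lborel)"
proof (intro exI conjI ballI)
  \<comment> \<open>The factor 2 * 5^n comes from the weak bound applied at level l / 2, and r *
    2^(r-1) / (r-1) from integrating r * l^(r-2) up to the level 2 f y.\<close>
  let ?D = "2 * 5 ^ DIM('a) * r * (2 powr (r - 1) / (r - 1)) :: real"
  show "0 < ?D" using r by simp
  fix f :: "'a \<Rightarrow> ennreal" assume [measurable]: "f \<in> borel_measurable borel"
  define g where "g l y = f y * indicator {y. ennreal l < 2 * f y} y" for l y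
  have [measurable]: "g l \<in> borel_measurable borel" for l
    unfolding g_def[abs_def] by measurable
  have le: "ennreal l * emeasure lborel {x. ennreal l < maximal f x} \<le> ennreal (2 * 5 ^ DIM('a)) * (\<integral>\<^sup>+y. g l y \<partial>lborel)"
    if l: "0 < l" for l
  proof -
    \<comment> \<open>The part of f below l / 2 adds at most l / 2 to every average.\<close>
    have M: "maximal f x \<le> maximal (g l) x + ennreal (l / 2)" for x
      unfolding maximal_def[of f]
    proof (intro SUP_least)
      fix q :: real assume q: "q \<in> {q \<in> \<rat>. 0 < q}"
      have V: "emeasure lborel (ball x q) \<noteq> 0" "emeasure lborel (ball x q) \<noteq> top"
        using emeasure_ball_pos[of q x] emeasure_lborel_ball_finite[of x q] q by auto
      have fle: "f y \<le> g l y + ennreal (l / 2)" for y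
      proof (cases "ennreal l < 2 * f y")
        case False
        then have "2 * f y \<le> 2 * ennreal (l / 2)"
          using l by (simp add: not_less ennreal_half)
        then show ?thesis
          by (subst (asm) ennreal_mult_le_mult_iff) (auto simp: g_def add_increasing)
      qed (simp add: g_def)
      have "(\<integral>\<^sup>+y\<in>ball x q. f y \<partial>lborel) \<le> (\<integral>\<^sup>+y. g l y * indicator (ball x q) y + ennreal (l / 2) * indicator (ball x q) y \<partial>lborel)"
        using fle by (intro nn_integral_mono) (auto simp: indicator_def)
      also have "\<dots> = (\<integral>\<^sup>+y\<in>ball x q. g l y \<partial>lborel) + ennreal (l / 2) * emeasure lborel (ball x q)"
      proof -
        have [measurable]: "ball x q \<in> sets borel" by simp
        have "(\<lambda>y. g l y * indicator (ball x q) y) \<in> borel_measurable lborel"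
          "(\<lambda>y. ennreal (l / 2) * indicator (ball x q) y) \<in> borel_measurable lborel"
          by measurable
        then show ?thesis
          by (simp add: nn_integral_add nn_integral_cmult_indicator)
      qed
      finally have "(\<integral>\<^sup>+y\<in>ball x q. f y \<partial>lborel) / emeasure lborel (ball x q)
          \<le> ((\<integral>\<^sup>+y\<in>ball x q. g l y \<partial>lborel) + ennreal (l / 2) * emeasure lborel (ball x q)) / emeasure lborel (ball x q)"
        by (rule divide_right_mono_ennreal)
      also have "\<dots> = (\<integral>\<^sup>+y\<in>ball x q. g l y \<partial>lborel) / emeasure lborel (ball x q) + ennreal (l / 2)"
        using V by (simp add: add_divide_distrib_ennreal ennreal_mult_divide_eq)
      also have "\<dots> \<le> maximal (g l) x + ennreal (l / 2)"
        using q by (intro add_right_mono ball_average_le_maximal) auto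
      finally show "(\<integral>\<^sup>+y\<in>ball x q. f y \<partial>lborel) / emeasure lborel (ball x q) \<le> maximal (g l) x + ennreal (l / 2)" .
    qed
    have sub: "{x. ennreal l < maximal f x} \<subseteq> {x. ennreal (l / 2) < maximal (g l) x}"
    proof safe
      fix x assume x: "ennreal l < maximal f x"
      show "ennreal (l / 2) < maximal (g l) x"
      proof (rule ccontr)
        assume "\<not> ennreal (l / 2) < maximal (g l) x"
        then have "maximal (g l) x + ennreal (l / 2) \<le> ennreal (l / 2) + ennreal (l / 2)"
          by (intro add_right_mono) simp
        also have "\<dots> = ennreal l" using l by (simp flip: ennreal_plus)
        finally show False using M[of x] x by auto
      qed
    qed
    have "ennreal l * emeasure lborel {x. ennreal l < maximal f x}
        \<le> ennreal l * emeasure lborel {x. ennreal (l / 2) < maximal (g l) x}"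
      by (intro mult_left_mono emeasure_mono sub) auto
    also have "\<dots> = 2 * (ennreal (l / 2) * emeasure lborel {x. ennreal (l / 2) < maximal (g l) x})"
      using l by (simp add: ennreal_half flip: mult.assoc)
    also have "\<dots> \<le> 2 * (ennreal (5 ^ DIM('a)) * (\<integral>\<^sup>+y. g l y \<partial>lborel))"
      using l by (intro mult_left_mono maximal_weak_type) auto
    finally show ?thesis
      by (simp add: ennreal_mult' mult.assoc)
  qed
  have "(\<integral>\<^sup>+x. maximal f x epowr r \<partial>lborel) =
      (\<integral>\<^sup>+x. \<integral>\<^sup>+l. ennreal (r * l powr (r - 1)) * indicator {l. 0 < l \<and> ennreal l < maximal f x} l \<partial>lborel \<partial>lborel)"
    using r by (subst epowr_layer_cake) auto
  also have "\<dots> = (\<integral>\<^sup>+x. \<integral>\<^sup>+l. ennreal (r * l powr (r - 1)) * indicator {p. 0 < snd p \<and> ennreal (snd p) < maximal f (fst p)} (x, l) \<partial>lborel \<partial>lborel)"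
    by (simp add: indicator_def)
  also have "\<dots> = (\<integral>\<^sup>+l. \<integral>\<^sup>+x. ennreal (r * l powr (r - 1)) * indicator {p. 0 < snd p \<and> ennreal (snd p) < maximal f (fst p)} (x, l) \<partial>lborel \<partial>lborel)"
    by (rule lborel_pair.Fubini'[symmetric]) measurable
  also have "\<dots> = (\<integral>\<^sup>+l. ennreal (r * l powr (r - 1)) * indicator {0<..} l * emeasure lborel {x. ennreal l < maximal f x} \<partial>lborel)"
  proof (intro nn_integral_cong)
    fix l :: real
    have "(\<integral>\<^sup>+x. ennreal (r * l powr (r - 1)) * indicator {p. 0 < snd p \<and> ennreal (snd p) < maximal f (fst p)} (x, l) \<partial>lborel)
      = (\<integral>\<^sup>+x. (ennreal (r * l powr (r - 1)) * indicator {0<..} l) * indicator {x. ennreal l < maximal f x} x \<partial>lborel)"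
      by (intro nn_integral_cong) (auto simp: indicator_def)
    also have "\<dots> = ennreal (r * l powr (r - 1)) * indicator {0<..} l * emeasure lborel {x. ennreal l < maximal f x}"
      by (rule nn_integral_cmult_indicator) measurable
    finally show "(\<integral>\<^sup>+x. ennreal (r * l powr (r - 1)) * indicator {p. 0 < snd p \<and> ennreal (snd p) < maximal f (fst p)} (x, l) \<partial>lborel)
      = ennreal (r * l powr (r - 1)) * indicator {0<..} l * emeasure lborel {x. ennreal l < maximal f x}" .
  qed
  also have "\<dots> \<le> (\<integral>\<^sup>+l. \<integral>\<^sup>+y. (ennreal (2 * 5 ^ DIM('a)) * ennreal (r * l powr (r - 2)) * indicator {0<..} l) * g l y \<partial>lborel \<partial>lborel)"
  proof (intro nn_integral_mono)
    fix l :: real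
    show "ennreal (r * l powr (r - 1)) * indicator {0<..} l * emeasure lborel {x. ennreal l < maximal f x}
      \<le> (\<integral>\<^sup>+y. (ennreal (2 * 5 ^ DIM('a)) * ennreal (r * l powr (r - 2)) * indicator {0<..} l) * g l y \<partial>lborel)"
    proof (cases "0 < l")
      case True
      have "r * l powr (r - 1) = r * l powr (r - 2) * l"
        using True powr_add[of l "r - 2" 1] by simp
      then have "ennreal (r * l powr (r - 1)) = ennreal (r * l powr (r - 2)) * ennreal l"
        using True r by (simp add: ennreal_mult' mult.assoc)
      then have "ennreal (r * l powr (r - 1)) * emeasure lborel {x. ennreal l < maximal f x}
          = ennreal (r * l powr (r - 2)) * (ennreal l * emeasure lborel {x. ennreal l < maximal f x})"
        by (simp add: mult.assoc)
      also have "\<dots> \<le> ennreal (r * l powr (r - 2)) * (ennreal (2 * 5 ^ DIM('a)) * (\<integral>\<^sup>+y. g l y \<partial>lborel))"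
        by (intro mult_left_mono le True) simp
      finally show ?thesis
        using True by (subst nn_integral_cmult) (auto simp: ac_simps)
    qed simp
  qed
  also have "\<dots> = (\<integral>\<^sup>+l. \<integral>\<^sup>+y. (ennreal (2 * 5 ^ DIM('a)) * ennreal (r * l powr (r - 2))) * (f y * indicator {p. 0 < fst p \<and> ennreal (fst p) < 2 * f (snd p)} (l, y)) \<partial>lborel \<partial>lborel)"
    by (intro nn_integral_cong) (auto simp: g_def indicator_def)
  also have "\<dots> = (\<integral>\<^sup>+y. \<integral>\<^sup>+l. (ennreal (2 * 5 ^ DIM('a)) * ennreal (r * l powr (r - 2))) * (f y * indicator {p. 0 < fst p \<and> ennreal (fst p) < 2 * f (snd p)} (l, y)) \<partial>lborel \<partial>lborel)"
    by (rule lborel_pair.Fubini'[symmetric]) measurable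
  also have "\<dots> = (\<integral>\<^sup>+y. ennreal ?D * f y epowr r \<partial>lborel)"
  proof (intro nn_integral_cong)
    fix y
    let ?k = "ennreal (2 * 5 ^ DIM('a) * r / (r - 1))"
    have "(\<integral>\<^sup>+l. (ennreal (2 * 5 ^ DIM('a)) * ennreal (r * l powr (r - 2))) * (f y * indicator {p. 0 < fst p \<and> ennreal (fst p) < 2 * f (snd p)} (l, y)) \<partial>lborel)
      = (\<integral>\<^sup>+l. (?k * f y) * (ennreal ((r - 1) * l powr (r - 1 - 1)) * indicator {l. 0 < l \<and> ennreal l < 2 * f y} l) \<partial>lborel)"
    proof (intro nn_integral_cong)
      fix l :: real
      have "ennreal (2 * 5 ^ DIM('a)) * ennreal (r * l powr (r - 2)) = ?k * ennreal ((r - 1) * l powr (r - 1 - 1))"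
      proof -
        have "2 * 5 ^ DIM('a) * (r * l powr (r - 2)) = 2 * 5 ^ DIM('a) * r / (r - 1) * ((r - 1) * l powr (r - 1 - 1))"
          using r by simp
        then show ?thesis
          using r by (subst (1 2) ennreal_mult[symmetric]) auto
      qed
      then show "(ennreal (2 * 5 ^ DIM('a)) * ennreal (r * l powr (r - 2))) * (f y * indicator {p. 0 < fst p \<and> ennreal (fst p) < 2 * f (snd p)} (l, y))
        = (?k * f y) * (ennreal ((r - 1) * l powr (r - 1 - 1)) * indicator {l. 0 < l \<and> ennreal l < 2 * f y} l)"
        by (simp add: indicator_def ac_simps)
    qed
    also have "\<dots> = ?k * f y * (2 * f y) epowr (r - 1)"
      using r by (subst nn_integral_cmult) (auto simp: epowr_layer_cake[of "r - 1"])
    also have "\<dots> = ?k * 2 epowr (r - 1) * (f y epowr 1 * f y epowr (r - 1))"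
      by (simp add: epowr_mult ac_simps)
    also have "f y epowr 1 * f y epowr (r - 1) = f y epowr r"
      using epowr_add[of "f y" 1 "r - 1"] by simp
    also have "?k * 2 epowr (r - 1) = ennreal ?D"
    proof -
      have "?k * 2 epowr (r - 1) = ?k * ennreal (2 powr (r - 1))"
        using epowr_ennreal[of 2 "r - 1"] by simp
      also have "\<dots> = ennreal (2 * 5 ^ DIM('a) * r / (r - 1) * 2 powr (r - 1))"
        using r by (intro ennreal_mult[symmetric]) auto
      also have "2 * 5 ^ DIM('a) * r / (r - 1) * 2 powr (r - 1) = ?D"
        by simp
      finally show ?thesis .
    qed
    finally show "(\<integral>\<^sup>+l. (ennreal (2 * 5 ^ DIM('a)) * ennreal (r * l powr (r - 2))) * (f y * indicator {p. 0 < fst p \<and> ennreal (fst p) < 2 * f (snd p)} (l, y)) \<partial>lborel)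
      = ennreal ?D * f y epowr r" .
  qed
  also have "\<dots> = ennreal ?D * (\<integral>\<^sup>+y. f y epowr r \<partial>lborel)"
    by (rule nn_integral_cmult) measurable
  finally show "(\<integral>\<^sup>+x. maximal f x epowr r \<partial>lborel) \<le> ennreal ?D * (\<integral>\<^sup>+y. f y epowr r \<partial>lborel)" .
qed

lemma ennreal_le_of_scaled: "(\<And>c. 0 < c \<Longrightarrow> x \<le> ennreal (k * c)) \<Longrightarrow> 0 < k \<Longrightarrow> x = 0"
proof -
  assume *: "\<And>c. 0 < c \<Longrightarrow> x \<le> ennreal (k * c)" and k: "0 < k"
  have "x \<le> 0"
  proof (rule ennreal_le_epsilon)
    fix e :: real assume "0 < e"
    then show "x \<le> 0 + ennreal e" using *[of "e / k"] k by simp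
  qed
  then show ?thesis by simp
qed

text \<open>The power mean inequality with a lossy factor 2^s, which spares convexity arguments for
  extended valued functions: average the pointwise bound h <= c + c^(1-s) h^s and optimize in
  c.\<close>

lemma average_power_le:
  fixes h :: "'a \<Rightarrow> ennreal"
  assumes [measurable]: "h \<in> borel_measurable M" "B \<in> sets M"
    and B: "0 < emeasure M B" "emeasure M B < top" and s: "1 \<le> s"
  shows "((\<integral>\<^sup>+y\<in>B. h y \<partial>M) / emeasure M B) epowr s
    \<le> ennreal (2 powr s) * ((\<integral>\<^sup>+y\<in>B. h y epowr s \<partial>M) / emeasure M B)"
proof -
  define A where "A = (\<integral>\<^sup>+y\<in>B. h y epowr s \<partial>M) / emeasure M B"
  define H where "H = (\<integral>\<^sup>+y\<in>B. h y \<partial>M) / emeasure M B"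
  have *: "H \<le> ennreal c + ennreal (c powr (1 - s)) * A" if c: "0 < c" for c
  proof -
    have le: "h y \<le> ennreal c + ennreal (c powr (1 - s)) * h y epowr s" for y
    proof (cases "h y")
      case (real t)
      show ?thesis
      proof (cases "t \<le> c")
        case True
        then show ?thesis using real by (simp add: ennreal_leI add_increasing2)
      next
        case False
        then have t: "c < t" by simp
        have "t = c powr (1 - s) * (c powr (s - 1) * t)"
          using c by (simp add: mult.assoc[symmetric] flip: powr_add)
        also have "\<dots> \<le> c powr (1 - s) * (t powr (s - 1) * t)"
          using c t s by (intro mult_left_mono mult_right_mono powr_mono2) auto
        also have "t powr (s - 1) * t = t powr s"
          using c t powr_add[of t "s - 1" 1] by simp
        finally have "ennreal t \<le> ennreal (c powr (1 - s)) * ennreal (t powr s)"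
          by (simp add: ennreal_leI flip: ennreal_mult)
        then show ?thesis using real by (simp add: epowr_ennreal add_increasing)
      qed
    next
      case top
      then show ?thesis using c by (simp add: ennreal_mult_top)
    qed
    have "(\<integral>\<^sup>+y\<in>B. h y \<partial>M) \<le> (\<integral>\<^sup>+y. ennreal c * indicator B y + ennreal (c powr (1 - s)) * (h y epowr s * indicator B y) \<partial>M)"
      using le by (intro nn_integral_mono) (auto simp: indicator_def)
    also have "\<dots> = ennreal c * emeasure M B + ennreal (c powr (1 - s)) * (\<integral>\<^sup>+y\<in>B. h y epowr s \<partial>M)"
      by (subst nn_integral_add) (auto simp: nn_integral_cmult_indicator nn_integral_cmult)
    finally have "H \<le> (ennreal c * emeasure M B + ennreal (c powr (1 - s)) * (\<integral>\<^sup>+y\<in>B. h y epowr s \<partial>M)) / emeasure M B"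
      unfolding H_def by (rule divide_right_mono_ennreal)
    also have "\<dots> = ennreal c + ennreal (c powr (1 - s)) * A"
      using B by (simp add: A_def add_divide_distrib_ennreal ennreal_mult_divide_eq ennreal_times_divide)
    finally show ?thesis .
  qed
  have "H epowr s \<le> ennreal (2 powr s) * A"
  proof (cases A)
    case (real a)
    show ?thesis
    proof (cases "a = 0")
      case True
      have "H = 0"
        by (rule ennreal_le_of_scaled[of _ 1]) (use *[unfolded real True] in auto)
      then show ?thesis by simp
    next
      case False
      \<comment> \<open>This choice makes the two terms \<open>c\<close> and c^(1-s) * a equal. For
        a = 0 the bound is instead used with arbitrarily small \<open>c\<close>.\<close>
      define c where "c = a powr (1 / s)"
      have c: "0 < c" "c powr s = a" using False real s by (auto simp: c_def powr_powr)
      have "c powr (1 - s) * a = c"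
        using c by (simp flip: c(2) powr_add)
      then have "H \<le> ennreal (2 * c)"
        using *[OF c(1)] real c(1) by (simp flip: ennreal_mult ennreal_plus)
      then have "H epowr s \<le> ennreal (2 * c) epowr s"
        using s by (intro epowr_mono) auto
      also have "\<dots> = ennreal (2 powr s) * A"
        using c real epowr_ennreal[of "2 * c" s] by (simp add: powr_mult ennreal_mult)
      finally show ?thesis .
    qed
  next
    case top
    then show ?thesis by (simp add: ennreal_mult_top)
  qed
  then show ?thesis by (simp add: A_def H_def)
qed

section \<open>The maximal function on variable exponent spaces\<close>

definition modular :: "('a::euclidean_space \<Rightarrow> real) \<Rightarrow> ('a \<Rightarrow> ennreal) \<Rightarrow> ennreal" where
  "modular q f = (\<integral>\<^sup>+x. f x epowr q x \<partial>lborel)"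

lemma epowr_add_le:
  assumes "0 \<le> s"
  shows "(x + y) epowr s \<le> ennreal (2 powr s) * (x epowr s + y epowr s)"
proof -
  have two: "(2 * z) epowr s = ennreal (2 powr s) * z epowr s" for z
    using epowr_ennreal[of 2 s] by (simp add: epowr_mult)
  have "x + y \<le> 2 * max x y" by (simp add: mult_2 add_mono)
  then have "(x + y) epowr s \<le> (2 * max x y) epowr s"
    by (rule epowr_mono) (use assms in auto)
  also have "\<dots> = ennreal (2 powr s) * (max x y) epowr s" by (rule two)
  also have "\<dots> \<le> ennreal (2 powr s) * (x epowr s + y epowr s)"
    by (intro mult_left_mono) (auto simp: max_def)
  finally show ?thesis .
qed

lemma maximal_add_le:
  fixes f g :: "'a::euclidean_space \<Rightarrow> ennreal"
  assumes [measurable]: "f \<in> borel_measurable borel" "g \<in> borel_measurable borel"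
  shows "maximal (\<lambda>y. f y + g y) x \<le> maximal f x + maximal g x"
  unfolding maximal_def[of "\<lambda>y. f y + g y"]
proof (intro SUP_least)
  fix r :: real assume r: "r \<in> {r \<in> \<rat>. 0 < r}"
  have [measurable]: "ball x r \<in> sets borel" by simp
  have m: "(\<lambda>y. f y * indicator (ball x r) y) \<in> borel_measurable lborel"
    "(\<lambda>y. g y * indicator (ball x r) y) \<in> borel_measurable lborel" by measurable
  have "(\<integral>\<^sup>+y\<in>ball x r. f y + g y \<partial>lborel) / emeasure lborel (ball x r)
    = (\<integral>\<^sup>+y\<in>ball x r. f y \<partial>lborel) / emeasure lborel (ball x r)
      + (\<integral>\<^sup>+y\<in>ball x r. g y \<partial>lborel) / emeasure lborel (ball x r)"
    using m by (simp add: distrib_right nn_integral_add add_divide_distrib_ennreal)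
  also have "\<dots> \<le> maximal f x + maximal g x"
    using r by (intro add_mono ball_average_le_maximal) auto
  finally show "(\<integral>\<^sup>+y\<in>ball x r. f y + g y \<partial>lborel) / emeasure lborel (ball x r) \<le> maximal f x + maximal g x" .
qed

lemma maximal_le_one:
  assumes "\<And>y. f y \<le> 1"
  shows "maximal f x \<le> 1"
  unfolding maximal_def
proof (intro SUP_least)
  fix r :: real assume r: "r \<in> {r \<in> \<rat>. 0 < r}"
  have V: "emeasure lborel (ball x r) \<noteq> 0" "emeasure lborel (ball x r) \<noteq> top"
    using emeasure_ball_pos[of r x] emeasure_lborel_ball_finite[of x r] r by auto
  have "(\<integral>\<^sup>+y\<in>ball x r. f y \<partial>lborel) \<le> (\<integral>\<^sup>+y. indicator (ball x r) y \<partial>lborel)"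
    using assms by (intro nn_integral_mono) (auto simp: indicator_def)
  then have "(\<integral>\<^sup>+y\<in>ball x r. f y \<partial>lborel) / emeasure lborel (ball x r)
      \<le> emeasure lborel (ball x r) / emeasure lborel (ball x r)"
    by (intro divide_right_mono_ennreal) simp
  also have "\<dots> = 1" using V by (simp add: ennreal_divide_self top.not_eq_extremum)
  finally show "(\<integral>\<^sup>+y\<in>ball x r. f y \<partial>lborel) / emeasure lborel (ball x r) \<le> 1" .
qed

text \<open>Integrable, but only polynomially small: for \<open>decay_weight x \<le> t \<le> 1\<close> the decay condition on the exponent makes \<open>t powr q x\<close> and \<open>t powr L\<close> comparable.\<close>

definition decay_weight :: "'a::euclidean_space \<Rightarrow> real" where
  "decay_weight x = (\<Prod>i\<in>Basis. 1 / (1 + (x \<bullet> i)\<^sup>2))"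

lemma decay_weight_pos: "0 < decay_weight x"
  unfolding decay_weight_def by (intro prod_pos) (auto simp: add_pos_nonneg)

lemma borel_measurable_decay_weight [measurable]: "decay_weight \<in> borel_measurable borel"
  unfolding decay_weight_def[abs_def] by measurable

text \<open>Polynomial growth of the reciprocal is what matters: raised to a power of order C / ln
  (e + |x|), it stays bounded.\<close>

lemma decay_weight_lower:
  fixes x :: "'a::euclidean_space"
  shows "1 / decay_weight x \<le> (exp 1 + norm x) ^ (2 * DIM('a))"
proof -
  have "1 / decay_weight x = (\<Prod>i\<in>Basis. 1 + (x \<bullet> i)\<^sup>2)"
    by (simp add: decay_weight_def prod_dividef)
  also have "\<dots> \<le> (\<Prod>i\<in>(Basis::'a set). (exp 1 + norm x)\<^sup>2)"
  proof (intro prod_mono conjI)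
    fix i :: 'a assume i: "i \<in> Basis"
    have "\<bar>x \<bullet> i\<bar> \<le> norm x" using i by (rule Basis_le_norm)
    then have "(x \<bullet> i)\<^sup>2 \<le> (norm x)\<^sup>2" by (simp add: abs_le_square_iff[symmetric])
    moreover have "1 \<le> exp (1::real)" by simp
    then have "1 \<le> (exp (1::real))\<^sup>2" by (simp add: one_le_power)
    moreover have "0 \<le> 2 * exp 1 * norm x" by simp
    ultimately show "1 + (x \<bullet> i)\<^sup>2 \<le> (exp 1 + norm x)\<^sup>2"
      unfolding power2_sum by linarith
  qed simp
  also have "\<dots> = (exp 1 + norm x) ^ (2 * DIM('a))"
    by (simp add: power_mult)
  finally show ?thesis .
qed

lemma nn_integral_decay_weight: "(\<integral>\<^sup>+x. ennreal (decay_weight (x::'a::euclidean_space)) \<partial>lborel) < top"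
proof -
  have "integrable lborel (\<lambda>t::real. inverse (1 + t\<^sup>2))"
    using integrable_inverse_1_plus_square
    by (simp add: set_integrable_def)
  then have fin: "(\<integral>\<^sup>+t. ennreal (1 / (1 + t\<^sup>2)) \<partial>lborel) < top"
    by (auto simp: integrable_iff_bounded inverse_eq_divide)
  have "(\<integral>\<^sup>+x. ennreal (decay_weight (x::'a)) \<partial>lborel)
      = (\<integral>\<^sup>+x. (\<Prod>i\<in>Basis. (\<lambda>i t. ennreal (1 / (1 + t\<^sup>2))) i ((x::'a) \<bullet> i)) \<partial>lborel)"
    by (simp add: decay_weight_def prod_ennreal add_nonneg_nonneg)
  also have "\<dots> = (\<Prod>i\<in>(Basis::'a set). \<integral>\<^sup>+t. ennreal (1 / (1 + t\<^sup>2)) \<partial>lborel)"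
    by (subst nn_integral_lborel_prod) auto
  also have "\<dots> < top"
    using fin by (simp add: power_less_top_ennreal)
  finally show ?thesis .
qed

text \<open>The logarithmic conditions are placed on the exponent itself, since differences of
  exponents are what occurs below, and \<open>L\<close> is the value at infinity rather than its
  reciprocal. The strict bound \<open>1 < a\<close> makes the maximal function bounded on L^a and on
  L^L.\<close>

locale log_exponent =
  fixes q :: "'a::euclidean_space \<Rightarrow> real" and a b C L :: real
  assumes measurable_q [measurable]: "q \<in> borel_measurable borel"
    and a: "1 < a" and ab: "\<And>x. a \<le> q x" "\<And>x. q x \<le> b" and aL: "a \<le> L"
    and local_log: "\<And>x y. \<bar>q x - q y\<bar> \<le> C / ln (exp 1 + 1 / norm (x - y))"
    and decay_log: "\<And>x. \<bar>q x - L\<bar> \<le> C / ln (exp 1 + norm x)"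
begin

lemma C_nonneg: "0 \<le> C"
  using local_log[of 0 0] by simp

lemma b: "1 < b"
  using a ab(1)[of 0] ab(2)[of 0] by linarith

lemma ln_exp_plus: "0 \<le> r \<Longrightarrow> 1 \<le> ln (exp 1 + r)" for r :: real
  by (subst ln_ge_iff) (auto simp: add_pos_nonneg)

lemma exponent_gap:
  assumes "dist x y < r"
  shows "q x - C / ln (exp 1 + 1 / r) \<le> q y"
\<comment> \<open>For \<open>x = y\<close> the quotient \<open>1 / norm (x - y)\<close> is 0 instead
  of infinite, so monotonicity in the distance does not cover this case.\<close>
proof (cases "x = y")
  case True
  have "0 < r" using assms zero_le_dist[of x y] by linarith
  then have "0 \<le> C / ln (exp 1 + 1 / r)"
    using C_nonneg ln_exp_plus[of "1 / r"] by auto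
  then show ?thesis using True by simp
next
  case False
  then have d: "0 < norm (x - y)" "norm (x - y) < r" using assms by (auto simp: dist_norm)
  then have "0 < r" by linarith
  have "ln (exp 1 + 1 / r) \<le> ln (exp 1 + 1 / norm (x - y))"
    using d \<open>0 < r\<close> by (subst ln_le_cancel_iff) (auto simp: add_pos_pos frac_le)
  then have "C / ln (exp 1 + 1 / norm (x - y)) \<le> C / ln (exp 1 + 1 / r)"
    using C_nonneg ln_exp_plus[of "1 / r"] d \<open>0 < r\<close> by (intro divide_left_mono mult_pos_pos) auto
  then show ?thesis using local_log[of x y] by linarith
qed

text \<open>The core of the local condition: a negative power of the ball volume v * r^n blows up as
  r tends to 0, but the exponent \<open>t\<close> is of order 1 / ln (1 / r), so the result is
  bounded uniformly in r.\<close>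

lemma local_power_bound:
  assumes "0 < v" "0 < r" "0 \<le> t" "t \<le> C / (a * ln (exp 1 + 1 / r))" "t \<le> b"
  shows "(2 * (v * r ^ n) powr (- (1 / a))) powr t
    \<le> 2 powr b * (1 + 1 / v) powr b * exp (real n * C)"
proof -
  have "(2 * (v * r ^ n) powr (- (1 / a))) powr t
      = 2 powr t * (1 / v) powr (t / a) * (1 / r) powr (real n * t / a)"
    using assms a
    by (simp add: powr_mult powr_powr powr_minus powr_divide powr_realpow[symmetric] field_simps)
  also have "\<dots> \<le> 2 powr b * (1 + 1 / v) powr b * exp (real n * C)"
  proof (intro mult_mono)
    show "2 powr t \<le> 2 powr b" using assms by (intro powr_mono) auto
    have "t / a \<le> b" using assms a by (simp add: divide_le_eq) (smt (verit) mult_le_cancel_left1 mult.commute)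
    have "(1 / v) powr (t / a) \<le> (1 + 1 / v) powr (t / a)"
      using assms a by (intro powr_mono2) auto
    also have "\<dots> \<le> (1 + 1 / v) powr b"
      using assms \<open>t / a \<le> b\<close> by (intro powr_mono) auto
    finally show "(1 / v) powr (t / a) \<le> (1 + 1 / v) powr b" .
    have l: "1 \<le> ln (exp 1 + 1 / r)" using assms by (intro ln_exp_plus) auto
    have "(1 / r) powr (real n * t / a) \<le> (exp 1 + 1 / r) powr (real n * t / a)"
      using assms a by (intro powr_mono2) auto
    also have "\<dots> = exp (real n * t / a * ln (exp 1 + 1 / r))"
      using assms by (simp add: powr_def add_pos_pos less_imp_neq[symmetric])
    also have "\<dots> \<le> exp (real n * C)"
    proof -
      have "t * ln (exp 1 + 1 / r) \<le> C / a"
        using assms(4) l a by (simp add: field_simps)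
      also have "\<dots> \<le> C" using C_nonneg a by (simp add: divide_le_eq mult_le_cancel_left1)
      finally have "t * ln (exp 1 + 1 / r) \<le> C" .
      then have "t * ln (exp 1 + 1 / r) / a \<le> C"
        using C_nonneg a by (smt (verit) divide_le_eq mult_le_cancel_left1)
      then have "real n * (t * ln (exp 1 + 1 / r) / a) \<le> real n * C"
        by (intro mult_left_mono) auto
      then show ?thesis by (simp add: mult.assoc)
    qed
    finally show "(1 / r) powr (real n * t / a) \<le> exp (real n * C)" .
  qed auto
  finally show ?thesis .
qed

text \<open>Let P be the average of f and G that of f^(q/a). On values that are 0 or at least 1,
  lowering the exponent q y to a common lower bound m only decreases powers, so the power mean
  inequality gives P^(m/a) <= 2^b G. Raising this to q x / m produces G times an excess factor G^t
  with t = q x / m - 1; the modular bound controls G by a negative power of the ball volume, and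
  \<open>local_power_bound\<close> then controls G^t.\<close>

lemma large_average_bound:
  "\<exists>K>0. \<forall>f\<in>borel_measurable borel. (\<forall>y. f y = 0 \<or> 1 \<le> f y) \<longrightarrow> modular q f \<le> 1 \<longrightarrow>
     (\<forall>x r. 0 < r \<longrightarrow>
       ((\<integral>\<^sup>+y\<in>ball x r. f y \<partial>lborel) / emeasure lborel (ball x r)) epowr (q x / a)
       \<le> ennreal K * ((\<integral>\<^sup>+y\<in>ball x r. f y epowr (q y / a) \<partial>lborel) / emeasure lborel (ball x r)))"
proof (intro exI conjI ballI impI allI)
  let ?v = "unit_ball_vol (real DIM('a))"
  let ?D = "2 powr b * (1 + 1 / ?v) powr b * exp (real DIM('a) * C)"
  let ?K = "2 powr (b * b) * ?D"
  show "0 < ?K" by (simp add: add_pos_pos less_imp_neq[symmetric])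
  fix f :: "'a \<Rightarrow> ennreal" and x :: 'a and r :: real
  assume "f \<in> borel_measurable borel" and f: "\<forall>y. f y = 0 \<or> 1 \<le> f y"
    and mod: "modular q f \<le> 1" and r: "0 < r"
  then have [measurable]: "f \<in> borel_measurable borel" by simp
  have [measurable]: "ball x r \<in> sets lborel" by simp
  define w where "w = ?v * r ^ DIM('a)"
  have w: "0 < w" "emeasure lborel (ball x r) = ennreal w"
    using r by (auto simp: w_def emeasure_ball)
  have V: "0 < emeasure lborel (ball x r)" "emeasure lborel (ball x r) < top" using w by auto
  \<comment> \<open>A lower bound for the exponent on the ball, cut off at \<open>a\<close> so that
    \<open>m / a\<close> is at least 1 and the power mean inequality applies.\<close>
  define m where "m = max a (q x - C / ln (exp 1 + 1 / r))"
  have l: "1 \<le> ln (exp 1 + 1 / r)" using r by (intro ln_exp_plus) auto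
  then have "0 \<le> C / ln (exp 1 + 1 / r)" using C_nonneg by auto
  then have m: "a \<le> m" "m \<le> q x" "m \<le> b" "m \<le> q y" if "y \<in> ball x r" for y
    using ab(1)[of x] ab(1)[of y] ab(2)[of x] exponent_gap[of x y r] that by (auto simp: m_def)
  have m: "a \<le> m" "m \<le> q x" "m \<le> b" "0 < m" and mq: "\<And>y. y \<in> ball x r \<Longrightarrow> m \<le> q y"
    using m[of x] m(4) r a by auto
  define g where "g y = f y epowr (q y / a)" for y
  have [measurable]: "g \<in> borel_measurable borel" unfolding g_def[abs_def] by measurable
  define P where "P = (\<integral>\<^sup>+y\<in>ball x r. f y \<partial>lborel) / emeasure lborel (ball x r)"
  define G where "G = (\<integral>\<^sup>+y\<in>ball x r. g y \<partial>lborel) / emeasure lborel (ball x r)"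
  define t where "t = q x / m - 1"
  have qm: "q x / m \<le> b"
  proof -
    have "q x / m \<le> q x / 1" using m a ab(1)[of x] by (intro divide_left_mono) auto
    then show ?thesis using ab(2)[of x] by simp
  qed
  have ma: "m / a \<le> b"
  proof -
    have "m / a \<le> m / 1" using m a by (intro divide_left_mono) auto
    then show ?thesis using m by simp
  qed
  have t: "0 \<le> t" "t \<le> b" "t \<le> C / (a * ln (exp 1 + 1 / r))"
  proof -
    show "0 \<le> t" using m by (simp add: t_def)
    show "t \<le> b" using qm by (simp add: t_def)
    have "t = (q x - m) / m" using m by (simp add: t_def diff_divide_distrib)
    also have "\<dots> \<le> (q x - m) / a" using m a by (intro divide_left_mono) auto
    also have "\<dots> \<le> (C / ln (exp 1 + 1 / r)) / a"
      using a by (intro divide_right_mono) (auto simp: m_def)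
    finally show "t \<le> C / (a * ln (exp 1 + 1 / r))" by (simp add: mult.commute)
  qed
  have s1: "P epowr (m / a) \<le> ennreal (2 powr b) * G"
  proof -
    have "P epowr (m / a) \<le> ennreal (2 powr (m / a)) *
        ((\<integral>\<^sup>+y\<in>ball x r. f y epowr (m / a) \<partial>lborel) / emeasure lborel (ball x r))"
      unfolding P_def using V m a by (intro average_power_le) auto
    also have "\<dots> \<le> ennreal (2 powr b) * G"
    proof -
      have "f y epowr (m / a) * indicator (ball x r) y \<le> g y * indicator (ball x r) y" for y
      proof (cases "f y = 0 \<or> y \<notin> ball x r")
        case False
        then have "f y epowr (m / a) \<le> f y epowr (q y / a)"
          using f[rule_format, of y] mq[of y] a by (intro epowr_mono_exponent divide_right_mono) auto
        then show ?thesis by (simp add: g_def mult_right_mono)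
      qed (auto simp: g_def)
      then have "(\<integral>\<^sup>+y\<in>ball x r. f y epowr (m / a) \<partial>lborel) / emeasure lborel (ball x r) \<le> G"
        unfolding G_def by (intro divide_right_mono_ennreal nn_integral_mono)
      then show ?thesis
        using ma by (intro mult_mono ennreal_leI powr_mono) auto
    qed
    finally show ?thesis .
  qed
  \<comment> \<open>Since g^a = f^q, the modular bound limits the average of g^a by the reciprocal
    volume.\<close>
  have s4: "G \<le> ennreal (2 * w powr (- (1 / a)))"
  proof -
    have "G epowr a \<le> ennreal (2 powr a) * ((\<integral>\<^sup>+y\<in>ball x r. g y epowr a \<partial>lborel) / emeasure lborel (ball x r))"
      unfolding G_def using V a by (intro average_power_le) auto
    also have "(\<integral>\<^sup>+y\<in>ball x r. g y epowr a \<partial>lborel) \<le> modular q f"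
      unfolding modular_def using a by (intro nn_integral_mono) (auto simp: indicator_def g_def epowr_epowr)
    also have "\<dots> \<le> 1" by (rule mod)
    also have "ennreal (2 powr a) * (1 / emeasure lborel (ball x r)) = ennreal (2 powr a * (1 / w))"
      using w by (simp add: divide_ennreal flip: ennreal_mult ennreal_1)
    also have "\<dots> = ennreal (2 * w powr (- (1 / a))) epowr a"
      using w a by (subst epowr_ennreal) (auto simp: powr_mult powr_powr powr_minus_divide powr_divide)
    finally show ?thesis
      using a by (intro epowr_le_cancel[of G a]) (auto simp: mult_left_mono divide_right_mono_ennreal)
  qed
  have "P epowr (q x / a) = (P epowr (m / a)) epowr (q x / m)"
    using m by (simp add: epowr_epowr)
  also have "\<dots> \<le> (ennreal (2 powr b) * G) epowr (q x / m)"
    using m by (intro epowr_mono s1) auto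
  also have "\<dots> = ennreal (2 powr b) epowr (q x / m) * (G * G epowr t)"
    using epowr_add[of G 1 t] by (simp add: epowr_mult t_def)
  also have "\<dots> \<le> ennreal (2 powr (b * b)) * (G * ennreal ?D)"
  proof (intro mult_mono)
    show "ennreal (2 powr b) epowr (q x / m) \<le> ennreal (2 powr (b * b))"
      using mult_left_mono[OF qm, of b] b by (simp add: epowr_ennreal powr_powr ennreal_leI powr_mono)
    have "G epowr t \<le> ennreal (2 * w powr (- (1 / a))) epowr t"
      using t by (intro epowr_mono s4)
    also have "\<dots> = ennreal ((2 * w powr (- (1 / a))) powr t)"
      by (simp add: epowr_ennreal)
    also have "\<dots> \<le> ennreal ?D"
      unfolding w_def using t r by (intro ennreal_leI local_power_bound) auto
    finally show "G epowr t \<le> ennreal ?D" .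
  qed auto
  also have "\<dots> = ennreal ?K * G"
    by (simp add: ennreal_mult ac_simps)
  finally show "((\<integral>\<^sup>+y\<in>ball x r. f y \<partial>lborel) / emeasure lborel (ball x r)) epowr (q x / a)
       \<le> ennreal ?K * ((\<integral>\<^sup>+y\<in>ball x r. f y epowr (q y / a) \<partial>lborel) / emeasure lborel (ball x r))"
    by (simp add: P_def G_def g_def)
qed

text \<open>Dividing the exponent by \<open>a\<close> leaves room for the constant exponent theorem:
  (M f)^q is at most K^a (M g)^a with g = f^(q/a), and M is bounded on L^a.\<close>

lemma modular_maximal_large:
  "\<exists>K>0. \<forall>f\<in>borel_measurable borel. (\<forall>y. f y = 0 \<or> 1 \<le> f y) \<longrightarrow> modular q f \<le> 1 \<longrightarrow>
     modular q (maximal f) \<le> ennreal K"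
proof -
  obtain K where K: "0 < K" "\<And>f x r. f \<in> borel_measurable borel \<Longrightarrow> \<forall>y. f y = 0 \<or> 1 \<le> f y \<Longrightarrow> modular q f \<le> 1 \<Longrightarrow> 0 < r \<Longrightarrow>
       ((\<integral>\<^sup>+y\<in>ball x r. f y \<partial>lborel) / emeasure lborel (ball x r)) epowr (q x / a)
       \<le> ennreal K * ((\<integral>\<^sup>+y\<in>ball x r. f y epowr (q y / a) \<partial>lborel) / emeasure lborel (ball x r))"
    using large_average_bound by auto
  obtain D where D: "0 < D" "\<And>f::'a \<Rightarrow> ennreal. f \<in> borel_measurable borel \<Longrightarrow>
      (\<integral>\<^sup>+x. maximal f x epowr a \<partial>lborel) \<le> ennreal D * (\<integral>\<^sup>+x. f x epowr a \<partial>lborel)"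
    using maximal_strong_type[OF a, where 'a='a] by auto
  show ?thesis
  proof (intro exI[of _ "K powr a * D"] conjI ballI impI)
    show "0 < K powr a * D" using K(1) D(1) by simp
    fix f :: "'a \<Rightarrow> ennreal"
    assume f: "f \<in> borel_measurable borel" "\<forall>y. f y = 0 \<or> 1 \<le> f y" "modular q f \<le> 1"
    note [measurable] = f(1)
    define g where "g y = f y epowr (q y / a)" for y
    have [measurable]: "g \<in> borel_measurable borel" unfolding g_def[abs_def] by measurable
    have pos: "0 < q x" for x using ab(1)[of x] a by linarith
    have "maximal f x epowr q x \<le> ennreal (K powr a) * maximal g x epowr a" for x
    proof -
      have "maximal f x \<le> (ennreal K * maximal g x) epowr (a / q x)"
        unfolding maximal_def[of f]
      proof (intro SUP_least)
        fix r :: real assume r: "r \<in> {r \<in> \<rat>. 0 < r}"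
        let ?P = "(\<integral>\<^sup>+y\<in>ball x r. f y \<partial>lborel) / emeasure lborel (ball x r)"
        have "?P epowr (q x / a) \<le> ennreal K * ((\<integral>\<^sup>+y\<in>ball x r. g y \<partial>lborel) / emeasure lborel (ball x r))"
          unfolding g_def using r f by (intro K(2)) auto
        also have "\<dots> \<le> ennreal K * maximal g x"
          using r by (intro mult_left_mono ball_average_le_maximal) auto
        finally have "(?P epowr (q x / a)) epowr (a / q x) \<le> (ennreal K * maximal g x) epowr (a / q x)"
          using a pos[of x] by (intro epowr_mono) auto
        then show "?P \<le> (ennreal K * maximal g x) epowr (a / q x)"
          using a pos[of x] by (simp add: epowr_epowr)
      qed
      then have "maximal f x epowr q x \<le> ((ennreal K * maximal g x) epowr (a / q x)) epowr q x"
        using pos[of x] by (intro epowr_mono) auto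
      also have "\<dots> = (ennreal K * maximal g x) epowr a"
        using pos[of x] by (simp add: epowr_epowr)
      also have "\<dots> = ennreal (K powr a) * maximal g x epowr a"
        using K(1) by (simp add: epowr_mult epowr_ennreal)
      finally show ?thesis .
    qed
    then have "modular q (maximal f) \<le> (\<integral>\<^sup>+x. ennreal (K powr a) * maximal g x epowr a \<partial>lborel)"
      unfolding modular_def by (intro nn_integral_mono)
    also have "\<dots> = ennreal (K powr a) * (\<integral>\<^sup>+x. maximal g x epowr a \<partial>lborel)"
      by (rule nn_integral_cmult) measurable
    also have "\<dots> \<le> ennreal (K powr a) * (ennreal D * (\<integral>\<^sup>+x. g x epowr a \<partial>lborel))"
      by (intro mult_left_mono D(2)) auto
    also have "(\<integral>\<^sup>+x. g x epowr a \<partial>lborel) = modular q f"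
      using a by (simp add: g_def modular_def epowr_epowr)
    also have "ennreal (K powr a) * (ennreal D * modular q f) \<le> ennreal (K powr a) * (ennreal D * 1)"
      by (intro mult_left_mono f(3)) auto
    also have "\<dots> = ennreal (K powr a * D)"
      using D by (simp add: ennreal_mult)
    finally show "modular q (maximal f) \<le> ennreal (K powr a * D)" .
  qed
qed

text \<open>If F is below the weight, then F^s1 <= F is already below it. Otherwise ln (1 / F) is at
  most 2 n ln (e + |x|), so a change of the exponent by C / ln (e + |x|) costs at most the factor
  exp (2 n C).\<close>

lemma compare_exponents:
  assumes F: "F \<le> 1" and s: "1 \<le> s1" "1 \<le> s2" "\<bar>s1 - s2\<bar> \<le> C / ln (exp 1 + norm (x::'a))"
  shows "F epowr s1 \<le> ennreal (exp (real (2 * DIM('a)) * C)) * F epowr s2 + ennreal (decay_weight x)"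
proof -
  obtain t where t: "F = ennreal t" "0 \<le> t" "t \<le> 1"
    using F by (cases F) (auto simp: top_unique)
  let ?R = "decay_weight x" and ?e = "exp 1 + norm x"
  have e: "1 \<le> ln ?e" "0 < ?e" by (auto intro: ln_exp_plus add_pos_nonneg)
  show ?thesis
  proof (cases "t < ?R")
    case True
    have "t powr s1 \<le> t powr 1" using t s by (intro powr_mono') auto
    then have "F epowr s1 \<le> ennreal ?R"
      using t True by (simp add: epowr_ennreal ennreal_leI)
    then show ?thesis by (simp add: add_increasing)
  next
    case False
    then have t0: "0 < t" "?R \<le> t" using decay_weight_pos[of x] by auto
    have "t powr (s1 - s2) \<le> (1 / t) powr \<bar>s1 - s2\<bar>"
    proof (cases "s2 \<le> s1")
      case True
      then have "t powr (s1 - s2) \<le> 1" "1 \<le> (1 / t) powr \<bar>s1 - s2\<bar>"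
        using t t0 by (auto intro!: powr_le1 ge_one_powr_ge_zero)
      then show ?thesis by linarith
    next
      case False
      then have "t powr (s1 - s2) = (1 / t) powr (s2 - s1)"
        using t0 by (simp add: powr_divide powr_diff field_simps)
      then show ?thesis using False by simp
    qed
    also have "\<dots> \<le> (?e ^ (2 * DIM('a))) powr \<bar>s1 - s2\<bar>"
    proof (intro powr_mono2)
      have "1 / t \<le> 1 / ?R" using t0 decay_weight_pos[of x] by (simp add: frac_le)
      then show "1 / t \<le> ?e ^ (2 * DIM('a))" using decay_weight_lower[of x] by linarith
    qed (use t in auto)
    also have "\<dots> = exp (real (2 * DIM('a)) * (\<bar>s1 - s2\<bar> * ln ?e))"
      using e by (simp add: powr_def ln_realpow less_imp_neq[symmetric] ac_simps)
    also have "\<dots> \<le> exp (real (2 * DIM('a)) * C)"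
    proof -
      have "\<bar>s1 - s2\<bar> * ln ?e \<le> C"
        using s(3) e(1) by (subst pos_le_divide_eq[symmetric]) auto
      then have "real (2 * DIM('a)) * (\<bar>s1 - s2\<bar> * ln ?e) \<le> real (2 * DIM('a)) * C"
        by (rule mult_left_mono) simp
      then show ?thesis by simp
    qed
    finally have "t powr (s1 - s2) \<le> exp (real (2 * DIM('a)) * C)" .
    then have "t powr (s1 - s2) * t powr s2 \<le> exp (real (2 * DIM('a)) * C) * t powr s2"
      by (rule mult_right_mono) simp
    moreover have "t powr (s1 - s2) * t powr s2 = t powr s1"
      by (simp flip: powr_add)
    ultimately have "F epowr s1 \<le> ennreal (exp (real (2 * DIM('a)) * C)) * F epowr s2"
      using t by (simp add: epowr_ennreal ennreal_leI flip: ennreal_mult)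
    then show ?thesis by (simp add: add_increasing2)
  qed
qed

text \<open>The exponent is exchanged for the constant \<open>L\<close>, the constant exponent
  theorem is applied, and the exchange is undone for the maximal function, which is again at most 1.
  Each exchange costs the integral of the weight.\<close>

lemma modular_maximal_small:
  "\<exists>K>0. \<forall>f\<in>borel_measurable borel. (\<forall>y. f y \<le> 1) \<longrightarrow> modular q f \<le> 1 \<longrightarrow>
     modular q (maximal f) \<le> ennreal K"
proof -
  have L: "1 < L" using a aL by linarith
  obtain D where D: "0 < D" "\<And>f::'a \<Rightarrow> ennreal. f \<in> borel_measurable borel \<Longrightarrow>
      (\<integral>\<^sup>+x. maximal f x epowr L \<partial>lborel) \<le> ennreal D * (\<integral>\<^sup>+x. f x epowr L \<partial>lborel)"
    using maximal_strong_type[OF L, where 'a='a] by auto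
  obtain c where c: "0 \<le> c" "(\<integral>\<^sup>+x. ennreal (decay_weight (x::'a)) \<partial>lborel) = ennreal c"
    using nn_integral_decay_weight[where 'a='a] by (cases "(\<integral>\<^sup>+x. ennreal (decay_weight (x::'a)) \<partial>lborel)") auto
  define E where "E = exp (real (2 * DIM('a)) * C)"
  have E: "0 < E" by (simp add: E_def)
  have q1: "1 \<le> q x" for x using ab(1)[of x] a by linarith
  have up: "(\<integral>\<^sup>+x. F x epowr q x \<partial>lborel) \<le> ennreal E * (\<integral>\<^sup>+x. F x epowr L \<partial>lborel) + ennreal c"
    if [measurable]: "F \<in> borel_measurable borel" and "\<And>x. F x \<le> 1" for F
  proof -
    have "(\<integral>\<^sup>+x. F x epowr q x \<partial>lborel) \<le> (\<integral>\<^sup>+x. ennreal E * F x epowr L + ennreal (decay_weight x) \<partial>lborel)"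
      unfolding E_def using that(2) q1 L decay_log by (intro nn_integral_mono compare_exponents) auto
    also have "\<dots> = ennreal E * (\<integral>\<^sup>+x. F x epowr L \<partial>lborel) + ennreal c"
      by (simp add: nn_integral_add nn_integral_cmult c)
    finally show ?thesis .
  qed
  have down: "(\<integral>\<^sup>+x. F x epowr L \<partial>lborel) \<le> ennreal E * (\<integral>\<^sup>+x. F x epowr q x \<partial>lborel) + ennreal c"
    if [measurable]: "F \<in> borel_measurable borel" and "\<And>x. F x \<le> 1" for F
  proof -
    have "(\<integral>\<^sup>+x. F x epowr L \<partial>lborel) \<le> (\<integral>\<^sup>+x. ennreal E * F x epowr q x + ennreal (decay_weight x) \<partial>lborel)"
      unfolding E_def using that(2) q1 L decay_log
      by (intro nn_integral_mono compare_exponents) (auto simp: abs_minus_commute)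
    also have "\<dots> = ennreal E * (\<integral>\<^sup>+x. F x epowr q x \<partial>lborel) + ennreal c"
      by (simp add: nn_integral_add nn_integral_cmult c)
    finally show ?thesis .
  qed
  show ?thesis
  proof (intro exI[of _ "E * (D * (E + c)) + c"] conjI ballI impI)
    show "0 < E * (D * (E + c)) + c" using E D(1) c(1) by (intro add_pos_nonneg mult_pos_pos) auto
    fix f :: "'a \<Rightarrow> ennreal"
    assume f: "f \<in> borel_measurable borel" "\<forall>y. f y \<le> 1" "modular q f \<le> 1"
    have "modular q (maximal f) \<le> ennreal E * (\<integral>\<^sup>+x. maximal f x epowr L \<partial>lborel) + ennreal c"
      unfolding modular_def using f by (intro up maximal_le_one borel_measurable_maximal) auto
    also have "\<dots> \<le> ennreal E * (ennreal D * (\<integral>\<^sup>+x. f x epowr L \<partial>lborel)) + ennreal c"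
      using f by (intro add_right_mono mult_left_mono D) auto
    also have "\<dots> \<le> ennreal E * (ennreal D * (ennreal E * modular q f + ennreal c)) + ennreal c"
      unfolding modular_def using f by (intro add_right_mono mult_left_mono down) auto
    also have "\<dots> \<le> ennreal E * (ennreal D * (ennreal E * 1 + ennreal c)) + ennreal c"
      using f by (intro add_right_mono mult_left_mono) auto
    also have "\<dots> = ennreal (E * (D * (E + c)) + c)"
      using E D(1) c(1) by (simp add: ennreal_mult ennreal_plus)
    finally show "modular q (maximal f) \<le> ennreal (E * (D * (E + c)) + c)" .
  qed
qed

text \<open>As exponents are at least 1, dividing the function by \<open>K\<close> divides its
  modular by at least \<open>K\<close>. This converts modular bounds into norm bounds.\<close>

lemma modular_scale_le:
  assumes [measurable]: "f \<in> borel_measurable borel" and "modular q f \<le> ennreal K" "1 \<le> K"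
  shows "modular q (\<lambda>x. ennreal (1 / K) * f x) \<le> 1"
proof -
  have "modular q (\<lambda>x. ennreal (1 / K) * f x) \<le> (\<integral>\<^sup>+x. ennreal (1 / K) * f x epowr q x \<partial>lborel)"
    unfolding modular_def
  proof (intro nn_integral_mono)
    fix x
    have "1 \<le> q x" using ab(1)[of x] a by linarith
    then have "ennreal (1 / K) epowr q x \<le> ennreal (1 / K) epowr 1"
      using assms(3) by (intro epowr_antimono_exponent) auto
    then show "(ennreal (1 / K) * f x) epowr q x \<le> ennreal (1 / K) * f x epowr q x"
      unfolding epowr_mult by (intro mult_right_mono) auto
  qed
  also have "\<dots> = ennreal (1 / K) * modular q f"
    unfolding modular_def by (rule nn_integral_cmult) measurable
  also have "\<dots> \<le> ennreal (1 / K) * ennreal K"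
    by (intro mult_left_mono assms) auto
  also have "\<dots> = 1"
    using assms(3) by (simp flip: ennreal_mult)
  finally show ?thesis .
qed

text \<open>Boundedness of the maximal function in the Luxemburg norm, phrased on the unit ball. The
  function is cut at height 1 and the two regimes are added.\<close>

theorem modular_maximal:
  "\<exists>A\<ge>1. \<forall>f\<in>borel_measurable borel. modular q f \<le> 1 \<longrightarrow>
     modular q (\<lambda>x. ennreal (1 / A) * maximal f x) \<le> 1"
proof -
  obtain K1 where K1: "0 < K1" "\<And>f. f \<in> borel_measurable borel \<Longrightarrow> \<forall>y. f y = 0 \<or> 1 \<le> f y \<Longrightarrow>
      modular q f \<le> 1 \<Longrightarrow> modular q (maximal f) \<le> ennreal K1"
    using modular_maximal_large by auto
  obtain K2 where K2: "0 < K2" "\<And>f. f \<in> borel_measurable borel \<Longrightarrow> \<forall>y. f y \<le> 1 \<Longrightarrow>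
      modular q f \<le> 1 \<Longrightarrow> modular q (maximal f) \<le> ennreal K2"
    using modular_maximal_small by auto
  \<comment> \<open>The factor 2^b comes from splitting the power of a sum; the summand 1 makes the
    constant at least 1, as \<open>modular_scale_le\<close> requires.\<close>
  let ?K = "1 + 2 powr b * (K1 + K2)"
  show ?thesis
  proof (intro exI[of _ ?K] conjI ballI impI)
    show "1 \<le> ?K" using K1 K2 by simp
    fix f :: "'a \<Rightarrow> ennreal"
    assume f: "f \<in> borel_measurable borel" "modular q f \<le> 1"
    note [measurable] = f(1)
    define f1 where "f1 y = (if 1 \<le> f y then f y else 0)" for y
    define f2 where "f2 y = (if 1 \<le> f y then 0 else f y)" for y
    have [measurable]: "f1 \<in> borel_measurable borel" "f2 \<in> borel_measurable borel"
      unfolding f1_def[abs_def] f2_def[abs_def] by measurable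
    have q0: "0 \<le> q x" for x using ab(1)[of x] a by linarith
    have "modular q f1 \<le> modular q f" "modular q f2 \<le> modular q f"
      unfolding modular_def f1_def f2_def using q0 by (auto intro!: nn_integral_mono epowr_mono)
    then have "modular q f1 \<le> 1" "modular q f2 \<le> 1" using f(2) by auto
    then have M: "modular q (maximal f1) \<le> ennreal K1" "modular q (maximal f2) \<le> ennreal K2"
      by (auto intro!: K1(2) K2(2) simp: f1_def f2_def)
    have "f = (\<lambda>y. f1 y + f2 y)" by (auto simp: f1_def f2_def)
    then have le: "maximal f x \<le> maximal f1 x + maximal f2 x" for x
      using maximal_add_le[of f1 f2 x] by simp
    have "modular q (maximal f) \<le> (\<integral>\<^sup>+x. ennreal (2 powr b) * (maximal f1 x epowr q x + maximal f2 x epowr q x) \<partial>lborel)"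
      unfolding modular_def
    proof (intro nn_integral_mono)
      fix x
      have "maximal f x epowr q x \<le> (maximal f1 x + maximal f2 x) epowr q x"
        using le q0 by (intro epowr_mono)
      also have "\<dots> \<le> ennreal (2 powr q x) * (maximal f1 x epowr q x + maximal f2 x epowr q x)"
        using q0 by (rule epowr_add_le)
      also have "\<dots> \<le> ennreal (2 powr b) * (maximal f1 x epowr q x + maximal f2 x epowr q x)"
        using ab(2)[of x] by (intro mult_right_mono ennreal_leI powr_mono) auto
      finally show "maximal f x epowr q x \<le> \<dots>" .
    qed
    also have "\<dots> = ennreal (2 powr b) * (modular q (maximal f1) + modular q (maximal f2))"
      unfolding modular_def by (simp add: nn_integral_cmult nn_integral_add)
    also have "\<dots> \<le> ennreal (2 powr b) * (ennreal K1 + ennreal K2)"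
      using M by (intro mult_left_mono add_mono) auto
    also have "\<dots> \<le> ennreal ?K"
      using K1(1) K2(1) by (simp add: ennreal_leI flip: ennreal_mult ennreal_plus)
    finally show "modular q (\<lambda>x. ennreal (1 / ?K) * maximal f x) \<le> 1"
      using K1(1) K2(1) by (intro modular_scale_le) auto
  qed
qed

end

section \<open>Radial kernels as superpositions of balls\<close>

lemma ennreal_mult_assoc: "0 \<le> a \<Longrightarrow> 0 \<le> b \<Longrightarrow> ennreal a * (ennreal b * x) = ennreal (a * b) * x"
  by (simp add: ennreal_mult mult.assoc)

text \<open>It writes the power c^(-n) as an integral over radii beyond c, which is how the radial
  kernels below become superpositions of indicators of balls.\<close>

lemma tail_power_integral:
  assumes c: "0 < c" and n: "0 < n"
  shows "(\<integral>\<^sup>+r. ennreal (real n / r ^ Suc n) * indicator {c..} r \<partial>lborel) = ennreal (1 / c ^ n)"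
proof -
  have "(\<integral>\<^sup>+r. ennreal (real n / r ^ Suc n) * indicator {c..} r \<partial>lborel) = ennreal (0 - (- inverse (c ^ n)))"
  proof (rule nn_integral_FTC_atLeast[where F="\<lambda>r. - inverse (r ^ n)"])
    fix r assume r: "c \<le> r"
    then have r0: "0 < r" using c by simp
    have "((\<lambda>r. - inverse (r ^ n)) has_real_derivative - (- (real n * r ^ (n - 1)) / (r ^ n)\<^sup>2)) (at r)"
      using r0 by (auto intro!: derivative_eq_intros simp: power2_eq_square divide_inverse)
    moreover have "r ^ n * r ^ n = r ^ (n - 1) * r ^ Suc n"
      using n by (cases n) (simp_all add: mult_ac)
    then have "- (- (real n * r ^ (n - 1)) / (r ^ n)\<^sup>2) = real n / r ^ Suc n"
      using r0 by (simp add: power2_eq_square divide_simps)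
    ultimately show "((\<lambda>r. - inverse (r ^ n)) has_real_derivative real n / r ^ Suc n) (at r)"
      by simp
    show "0 \<le> real n / r ^ Suc n" using r0 by simp
  next
    have "((\<lambda>r::real. inverse (r ^ n)) \<longlongrightarrow> 0) at_top"
      using n by (intro tendsto_inverse_0_at_top filterlim_pow_at_top filterlim_ident)
    then show "((\<lambda>r::real. - inverse (r ^ n)) \<longlongrightarrow> 0) at_top"
      using tendsto_minus by fastforce
  qed measurable
  then show ?thesis by (simp add: divide_inverse)
qed

text \<open>A kernel dominated by a superposition of indicators of balls turns, after exchanging the
  integrals, into a superposition of ball integrals, to which the maximal function applies.\<close>

lemma radial_convolution_le:
  fixes f :: "'a::euclidean_space \<Rightarrow> ennreal" and w :: "real \<Rightarrow> ennreal"
  assumes [measurable]: "f \<in> borel_measurable borel" "w \<in> borel_measurable borel"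
    and k: "\<And>y. k y \<le> (\<integral>\<^sup>+r. w r * indicator {dist x y<..} r \<partial>lborel)"
  shows "(\<integral>\<^sup>+y. f y * k y \<partial>lborel) \<le> (\<integral>\<^sup>+r. w r * (\<integral>\<^sup>+y\<in>ball x r. f y \<partial>lborel) \<partial>lborel)"
proof -
  have "(\<integral>\<^sup>+y. f y * k y \<partial>lborel) \<le> (\<integral>\<^sup>+y. f y * (\<integral>\<^sup>+r. w r * indicator {dist x y<..} r \<partial>lborel) \<partial>lborel)"
    by (intro nn_integral_mono mult_left_mono k) auto
  also have "\<dots> = (\<integral>\<^sup>+y. \<integral>\<^sup>+r. f y * (w r * indicator {p. dist x (fst p) < snd p} (y, r)) \<partial>lborel \<partial>lborel)"
    by (intro nn_integral_cong) (simp add: nn_integral_cmult[symmetric] indicator_def)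
  also have "\<dots> = (\<integral>\<^sup>+r. \<integral>\<^sup>+y. f y * (w r * indicator {p. dist x (fst p) < snd p} (y, r)) \<partial>lborel \<partial>lborel)"
    by (rule lborel_pair.Fubini'[symmetric]) measurable
  also have "\<dots> = (\<integral>\<^sup>+r. \<integral>\<^sup>+y. w r * (f y * indicator (ball x r) y) \<partial>lborel \<partial>lborel)"
    by (intro nn_integral_cong) (auto simp: indicator_def mult.commute)
  also have "\<dots> = (\<integral>\<^sup>+r. w r * (\<integral>\<^sup>+y\<in>ball x r. f y \<partial>lborel) \<partial>lborel)"
  proof (intro nn_integral_cong nn_integral_cmult)
    fix r
    have [measurable]: "ball x r \<in> sets borel" by simp
    show "(\<lambda>y. f y * indicator (ball x r) y) \<in> borel_measurable lborel" by measurable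
  qed
  finally show ?thesis .
qed

lemma emeasure_ball_3:
  "0 \<le> r \<Longrightarrow> emeasure lborel (ball (x::real^3) r) = ennreal (unit_ball_vol 3 * r ^ 3)"
  by (simp add: emeasure_ball)

lemma ball_integral_le_maximal_3:
  fixes x :: "real^3"
  shows "0 < r \<Longrightarrow> (\<integral>\<^sup>+y\<in>ball x r. f y \<partial>lborel) \<le> ennreal (8 * unit_ball_vol 3 * r ^ 3) * maximal f x"
  using ball_integral_le_maximal[of r f x] by (simp add: emeasure_ball_3 ennreal_mult' mult.assoc)

section \<open>Time integrals of kernels and the Riesz potential\<close>

text \<open>The scale invariant size of the Oseen kernel. Its time integral is of order \<open>1 / (norm z)\<^sup>2\<close>, so the Duhamel term is controlled by a Riesz potential of the supremum in time. The kernel vanishes at \<open>s = 0\<close>, \<open>z = 0\<close>, since \<open>1 / 0 = 0\<close>.\<close>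

definition time_kernel :: "real \<Rightarrow> real^3 \<Rightarrow> real" where
  "time_kernel s z = 1 / max (sqrt s) (norm z) ^ 4"

lemma time_kernel_nonneg [simp]: "0 \<le> s \<Longrightarrow> 0 \<le> time_kernel s z"
  by (simp add: time_kernel_def)

lemma borel_measurable_time_kernel [measurable]:
  assumes [measurable]: "f \<in> borel_measurable M" "g \<in> borel_measurable M"
  shows "(\<lambda>x. time_kernel (f x) (g x)) \<in> borel_measurable M"
  unfolding time_kernel_def by measurable

text \<open>The kernel is the tail integral of 4 / r^5 from max (sqrt s) |x - y|. Against ball
  integrals of order r^3 this leaves r^(-2), whose integral from sqrt s is 1 / sqrt s.\<close>

lemma time_kernel_convolution_le:
  assumes [measurable]: "f \<in> borel_measurable borel" and s: "0 < s"
  shows "(\<integral>\<^sup>+y. f y * ennreal (time_kernel s (y - x)) \<partial>lborel)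
    \<le> ennreal (32 * unit_ball_vol 3 / sqrt s) * maximal f x"
proof -
  let ?w = "\<lambda>r. ennreal (4 / r ^ 5) * indicator {sqrt s..} r"
  have "(\<integral>\<^sup>+y. f y * ennreal (time_kernel s (y - x)) \<partial>lborel)
    \<le> (\<integral>\<^sup>+r. ?w r * (\<integral>\<^sup>+y\<in>ball x r. f y \<partial>lborel) \<partial>lborel)"
  proof (rule radial_convolution_le)
    fix y :: "real^3"
    define c where "c = max (sqrt s) (dist x y)"
    have c: "0 < c" using s by (simp add: c_def less_max_iff_disj)
    have "ennreal (time_kernel s (y - x)) = ennreal (1 / c ^ 4)"
      by (simp add: time_kernel_def c_def dist_norm norm_minus_commute)
    also have "\<dots> = (\<integral>\<^sup>+r. ennreal (4 / r ^ 5) * indicator {c..} r \<partial>lborel)"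
      using tail_power_integral[OF c, of 4] by simp
    also have "\<dots> \<le> (\<integral>\<^sup>+r. ?w r * indicator {dist x y<..} r \<partial>lborel)"
      using AE_lborel_singleton[of "dist x y"]
      by (intro nn_integral_mono_AE) (auto simp: indicator_def c_def)
    finally show "ennreal (time_kernel s (y - x)) \<le> (\<integral>\<^sup>+r. ?w r * indicator {dist x y<..} r \<partial>lborel)" .
  qed measurable
  also have "\<dots> \<le> (\<integral>\<^sup>+r. ennreal (32 * unit_ball_vol 3) * maximal f x * (ennreal (1 / r ^ 2) * indicator {sqrt s..} r) \<partial>lborel)"
  proof (intro nn_integral_mono)
    fix r :: real
    show "?w r * (\<integral>\<^sup>+y\<in>ball x r. f y \<partial>lborel)
      \<le> ennreal (32 * unit_ball_vol 3) * maximal f x * (ennreal (1 / r ^ 2) * indicator {sqrt s..} r)"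
    proof (cases "sqrt s \<le> r")
      case True
      then have r: "0 < r" using s by (smt (verit) real_sqrt_gt_zero)
      have "?w r * (\<integral>\<^sup>+y\<in>ball x r. f y \<partial>lborel)
          \<le> ennreal (4 / r ^ 5) * (ennreal (8 * unit_ball_vol 3 * r ^ 3) * maximal f x)"
        using True r by (auto intro!: mult_left_mono ball_integral_le_maximal_3)
      also have "\<dots> = ennreal (4 / r ^ 5 * (8 * unit_ball_vol 3 * r ^ 3)) * maximal f x"
        using r by (intro ennreal_mult_assoc) auto
      also have "4 / r ^ 5 * (8 * unit_ball_vol 3 * r ^ 3) = 32 * unit_ball_vol 3 * (1 / r ^ 2)"
        using r by (simp add: field_simps power_numeral_reduce)
      also have "ennreal (32 * unit_ball_vol 3 * (1 / r ^ 2)) * maximal f x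
        = ennreal (32 * unit_ball_vol 3) * maximal f x * (ennreal (1 / r ^ 2) * indicator {sqrt s..} r)"
        using True r by (subst ennreal_mult) (auto simp: ac_simps)
      finally show ?thesis .
    qed auto
  qed
  also have "\<dots> = ennreal (32 * unit_ball_vol 3) * maximal f x * ennreal (1 / sqrt s)"
    using tail_power_integral[of "sqrt s" 1] s by (simp add: nn_integral_cmult power2_eq_square)
  also have "\<dots> = ennreal (32 * unit_ball_vol 3) * ennreal (1 / sqrt s) * maximal f x"
    by (simp add: ac_simps)
  also have "ennreal (32 * unit_ball_vol 3) * ennreal (1 / sqrt s) = ennreal (32 * unit_ball_vol 3 / sqrt s)"
    using s by (subst ennreal_mult[symmetric]) auto
  finally show ?thesis .
qed

text \<open>Up to time |z|^2 the kernel is at most |z|^(-4), afterwards at most s^(-2); each range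
  contributes |z|^(-2).\<close>

lemma time_kernel_integral_le:
  assumes z: "z \<noteq> 0"
  shows "(\<integral>\<^sup>+s. ennreal (time_kernel s z) * indicator {0<..} s \<partial>lborel) \<le> ennreal (2 / (norm z)\<^sup>2)"
proof -
  let ?d = "norm z"
  have d: "0 < ?d" using z by simp
  have "(\<integral>\<^sup>+s. ennreal (time_kernel s z) * indicator {0<..} s \<partial>lborel)
    \<le> (\<integral>\<^sup>+s. ennreal (1 / ?d ^ 4) * indicator {0..?d\<^sup>2} s + ennreal (1 / s ^ 2) * indicator {?d\<^sup>2..} s \<partial>lborel)"
  proof (intro nn_integral_mono)
    fix s :: real
    show "ennreal (time_kernel s z) * indicator {0<..} s
      \<le> ennreal (1 / ?d ^ 4) * indicator {0..?d\<^sup>2} s + ennreal (1 / s ^ 2) * indicator {?d\<^sup>2..} s"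
    proof (cases "0 < s")
      case True
      have mx: "0 < max (sqrt s) ?d" using d by (simp add: less_max_iff_disj)
      have "time_kernel s z \<le> 1 / ?d ^ 4"
        unfolding time_kernel_def using d mx
        by (intro divide_left_mono power_mono mult_pos_pos zero_less_power) auto
      moreover have "time_kernel s z \<le> 1 / s ^ 2"
      proof -
        have "s ^ 2 = sqrt s ^ 4" using True by (simp add: power_numeral_reduce mult.assoc)
        then show ?thesis
          unfolding time_kernel_def \<open>s ^ 2 = sqrt s ^ 4\<close> using True mx
          by (intro divide_left_mono power_mono mult_pos_pos zero_less_power) auto
      qed
      ultimately show ?thesis
        using True by (auto simp: indicator_def intro: ennreal_leI add_increasing add_increasing2)
    qed simp
  qed
  also have "\<dots> = ennreal (1 / ?d ^ 4) * ennreal (?d\<^sup>2) + ennreal (1 / ?d\<^sup>2)"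
    using tail_power_integral[of "?d\<^sup>2" 1] d
    by (simp add: nn_integral_add nn_integral_cmult_indicator power2_eq_square)
  also have "\<dots> = ennreal (1 / ?d ^ 4 * ?d\<^sup>2 + 1 / ?d\<^sup>2)"
    by (subst ennreal_mult[symmetric], simp, simp, subst ennreal_plus[symmetric]) auto
  also have "1 / ?d ^ 4 * ?d\<^sup>2 + 1 / ?d\<^sup>2 = 2 / ?d\<^sup>2"
    using d by (simp add: field_simps power_numeral_reduce)
  finally show ?thesis .
qed

text \<open>The potential I_1 in dimension three without its normalizing constant.\<close>

definition riesz :: "(real^3 \<Rightarrow> ennreal) \<Rightarrow> real^3 \<Rightarrow> ennreal" where
  "riesz f x = (\<integral>\<^sup>+y. f y * ennreal (1 / (norm (y - x))\<^sup>2) \<partial>lborel)"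

lemma borel_measurable_riesz [measurable]:
  assumes [measurable]: "f \<in> borel_measurable borel"
  shows "riesz f \<in> borel_measurable borel"
proof -
  have "(\<lambda>x. \<integral>\<^sup>+y. f y * ennreal (1 / (norm (y - x))\<^sup>2) \<partial>lborel) \<in> borel_measurable borel"
    by (rule lborel.borel_measurable_nn_integral) measurable
  then show ?thesis unfolding riesz_def[abs_def] .
qed

lemma riesz_mono: "(\<And>y. f y \<le> g y) \<Longrightarrow> riesz f x \<le> riesz g x"
  unfolding riesz_def by (intro nn_integral_mono mult_right_mono) auto

text \<open>Instead of Hoelder's inequality on the ball, the pointwise bound F <= r F^(3/2) + r^(-2)
  is integrated; with the threshold r^(-2) both terms contribute order r.\<close>

lemma ball_integral_le_radius:
  fixes x :: "real^3"
  assumes [measurable]: "f \<in> borel_measurable borel"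
    and f: "(\<integral>\<^sup>+y. f y epowr (3 / 2) \<partial>lborel) \<le> 1" and r: "0 < r"
  shows "(\<integral>\<^sup>+y\<in>ball x r. f y \<partial>lborel) \<le> ennreal ((1 + unit_ball_vol 3) * r)"
proof -
  have [measurable]: "ball x r \<in> sets borel" by simp
  have young: "F \<le> ennreal r * F epowr (3 / 2) + ennreal (1 / r\<^sup>2)" for F
  proof (cases F)
    case (real t)
    show ?thesis
    proof (cases "t \<le> 1 / r\<^sup>2")
      case True
      then show ?thesis using real by (simp add: ennreal_leI add_increasing)
    next
      case False
      then have t: "1 / r\<^sup>2 < t" by simp
      then have "0 < t" by (smt (verit) divide_nonneg_nonneg zero_le_power2)
      have "1 / r = sqrt (1 / r\<^sup>2)" using r by (simp add: real_sqrt_divide)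
      also have "\<dots> \<le> sqrt t" using t by simp
      finally have "1 \<le> r * sqrt t" using r by (simp add: field_simps)
      then have "1 * t \<le> r * sqrt t * t" using \<open>0 < t\<close> by (intro mult_right_mono) auto
      moreover have "sqrt t * t = t powr (3 / 2)"
        using powr_add[of t "1 / 2" 1] \<open>0 < t\<close> by (simp add: powr_half_sqrt)
      ultimately have "t \<le> r * t powr (3 / 2)" by (simp add: mult.assoc)
      then have "F \<le> ennreal r * F epowr (3 / 2)"
        using real r by (simp add: epowr_ennreal ennreal_leI flip: ennreal_mult)
      then show ?thesis by (simp add: add_increasing2)
    qed
  next
    case top
    then show ?thesis using r by (simp add: ennreal_mult_top)
  qed
  have "(\<integral>\<^sup>+y\<in>ball x r. f y \<partial>lborel) \<le> (\<integral>\<^sup>+y. ennreal r * f y epowr (3 / 2) + ennreal (1 / r\<^sup>2) * indicator (ball x r) y \<partial>lborel)"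
    using young by (intro nn_integral_mono) (auto simp: indicator_def)
  also have "\<dots> = ennreal r * (\<integral>\<^sup>+y. f y epowr (3 / 2) \<partial>lborel) + ennreal (1 / r\<^sup>2) * emeasure lborel (ball x r)"
    by (subst nn_integral_add) (auto simp: nn_integral_cmult nn_integral_cmult_indicator)
  also have "\<dots> \<le> ennreal r * 1 + ennreal (1 / r\<^sup>2) * ennreal (unit_ball_vol 3 * r ^ 3)"
    using r f by (intro add_mono mult_left_mono) (auto simp: emeasure_ball_3)
  also have "\<dots> = ennreal (r + 1 / r\<^sup>2 * (unit_ball_vol 3 * r ^ 3))"
    using r by (subst ennreal_mult[symmetric], simp, simp, subst ennreal_plus) auto
  also have "r + 1 / r\<^sup>2 * (unit_ball_vol 3 * r ^ 3) = (1 + unit_ball_vol 3) * r"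
    using r by (simp add: field_simps power_numeral_reduce)
  finally show ?thesis .
qed

text \<open>The inner part of the potential is dominated by the maximal function, the outer part by the norm in \<open>L\<^bsup>3/2\<^esup>\<close>; the choice of the radius \<open>d\<close> gives Hedberg's inequality.\<close>

lemma riesz_le_split:
  assumes [measurable]: "f \<in> borel_measurable borel"
    and f: "(\<integral>\<^sup>+y. f y epowr (3 / 2) \<partial>lborel) \<le> 1" and d: "0 < d"
  shows "riesz f x \<le> ennreal (16 * unit_ball_vol 3 * d) * maximal f x + ennreal (2 * (1 + unit_ball_vol 3) / d)"
proof -
  let ?v = "unit_ball_vol 3" and ?w = "\<lambda>r. ennreal (2 / r ^ 3) * indicator {0<..} r"
  have "riesz f x \<le> (\<integral>\<^sup>+r. ?w r * (\<integral>\<^sup>+y\<in>ball x r. f y \<partial>lborel) \<partial>lborel)"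
    unfolding riesz_def
  proof (rule radial_convolution_le)
    fix y :: "real^3"
    show "ennreal (1 / (norm (y - x))\<^sup>2) \<le> (\<integral>\<^sup>+r. ?w r * indicator {dist x y<..} r \<partial>lborel)"
    proof (cases "x = y")
      case False
      then have c: "0 < dist x y" by simp
      have "ennreal (1 / (norm (y - x))\<^sup>2) = (\<integral>\<^sup>+r. ennreal (2 / r ^ 3) * indicator {dist x y..} r \<partial>lborel)"
        using tail_power_integral[OF c, of 2] by (simp add: dist_norm norm_minus_commute numeral_3_eq_3)
      also have "\<dots> \<le> (\<integral>\<^sup>+r. ?w r * indicator {dist x y<..} r \<partial>lborel)"
      proof (rule nn_integral_mono_AE)
        show "AE r in lborel. ennreal (2 / r ^ 3) * indicator {dist x y..} r \<le> ?w r * indicator {dist x y<..} r"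
          using AE_lborel_singleton[of "dist x y"]
        proof eventually_elim
          case (elim r)
          then show ?case
          proof (cases "dist x y < r")
            case True
            then have "0 < r" using c by linarith
            then show ?thesis using True by simp
          qed auto
        qed
      qed
      finally show ?thesis .
    qed simp
  qed measurable
  also have "\<dots> \<le> (\<integral>\<^sup>+r. ennreal (16 * ?v) * maximal f x * indicator {0..d} r
      + ennreal (2 * (1 + ?v)) * (ennreal (1 / r ^ 2) * indicator {d..} r) \<partial>lborel)"
  proof (intro nn_integral_mono)
    fix r :: real
    show "?w r * (\<integral>\<^sup>+y\<in>ball x r. f y \<partial>lborel) \<le> ennreal (16 * ?v) * maximal f x * indicator {0..d} r
      + ennreal (2 * (1 + ?v)) * (ennreal (1 / r ^ 2) * indicator {d..} r)"
    proof (cases "0 < r")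
      case True
      have a: "ennreal (2 / r ^ 3) * (\<integral>\<^sup>+y\<in>ball x r. f y \<partial>lborel) \<le> ennreal (16 * ?v) * maximal f x"
      proof -
        have "ennreal (2 / r ^ 3) * (\<integral>\<^sup>+y\<in>ball x r. f y \<partial>lborel)
            \<le> ennreal (2 / r ^ 3) * (ennreal (8 * ?v * r ^ 3) * maximal f x)"
          using True by (intro mult_left_mono ball_integral_le_maximal_3) auto
        also have "\<dots> = ennreal (2 / r ^ 3 * (8 * ?v * r ^ 3)) * maximal f x"
          using True by (intro ennreal_mult_assoc) auto
        also have "2 / r ^ 3 * (8 * ?v * r ^ 3) = 16 * ?v" using True by simp
        finally show ?thesis .
      qed
      have b: "ennreal (2 / r ^ 3) * (\<integral>\<^sup>+y\<in>ball x r. f y \<partial>lborel) \<le> ennreal (2 * (1 + ?v)) * ennreal (1 / r ^ 2)"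
      proof -
        have "ennreal (2 / r ^ 3) * (\<integral>\<^sup>+y\<in>ball x r. f y \<partial>lborel)
            \<le> ennreal (2 / r ^ 3) * ennreal ((1 + ?v) * r)"
          using True f by (intro mult_left_mono ball_integral_le_radius) auto
        also have "\<dots> = ennreal (2 * (1 + ?v) * (1 / r ^ 2))"
          using True by (subst ennreal_mult[symmetric]) (auto simp: field_simps power_numeral_reduce)
        also have "\<dots> = ennreal (2 * (1 + ?v)) * ennreal (1 / r ^ 2)"
          using True by (intro ennreal_mult) auto
        finally show ?thesis .
      qed
      show ?thesis
      proof (cases "r \<le> d")
        case True
        then show ?thesis using a \<open>0 < r\<close> by (simp add: add_increasing2)
      next
        case False
        then show ?thesis using b \<open>0 < r\<close> by (simp add: add_increasing)
      qed
    qed simp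
  qed
  also have "\<dots> = ennreal (16 * ?v) * maximal f x * ennreal d + ennreal (2 * (1 + ?v)) * ennreal (1 / d)"
    using tail_power_integral[of d 1] d
    by (simp add: nn_integral_add nn_integral_cmult_indicator nn_integral_cmult power2_eq_square)
  also have "\<dots> = ennreal (16 * ?v * d) * maximal f x + ennreal (2 * (1 + ?v) / d)"
  proof -
    have "ennreal (16 * ?v * d) = ennreal (16 * ?v) * ennreal d" 
      "ennreal (2 * (1 + ?v) / d) = ennreal (2 * (1 + ?v)) * ennreal (1 / d)"
      using d ennreal_mult[of "16 * ?v" d] ennreal_mult[of "2 * (1 + ?v)" "1 / d"] by auto
    then show ?thesis by (simp add: ac_simps)
  qed
  finally show ?thesis .
qed

text \<open>The radius \<open>1 / sqrt m\<close> balances the two terms of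
  \<open>riesz_le_split\<close>. Where the maximal function vanishes, the radius may tend to
  infinity and the potential is 0.\<close>

lemma hedberg:
  "\<exists>K>0. \<forall>f\<in>borel_measurable borel. (\<integral>\<^sup>+y. f y epowr (3 / 2) \<partial>lborel) \<le> 1 \<longrightarrow>
     (\<forall>x. riesz f x \<le> ennreal K * maximal f x epowr (1 / 2))"
proof (intro exI conjI ballI impI allI)
  let ?v = "unit_ball_vol 3"
  let ?K = "16 * ?v + 2 * (1 + ?v)"
  show "0 < ?K" by (simp add: add_pos_pos)
  fix f :: "real^3 \<Rightarrow> ennreal" and x
  assume f: "f \<in> borel_measurable borel" "(\<integral>\<^sup>+y. f y epowr (3 / 2) \<partial>lborel) \<le> 1"
  show "riesz f x \<le> ennreal ?K * maximal f x epowr (1 / 2)"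
  proof (cases "maximal f x")
    case (real m)
    show ?thesis
    proof (cases "m = 0")
      case True
      have "riesz f x = 0"
      proof (rule ennreal_le_of_scaled)
        show "riesz f x \<le> ennreal ((2 * (1 + ?v)) * c)" if "0 < c" for c
          using riesz_le_split[OF f, of "1 / c" x] real True that by simp
        show "0 < 2 * (1 + ?v)" by (simp add: add_pos_pos)
      qed
      then show ?thesis by simp
    next
      case False
      then have m: "0 < m" using real by simp
      have "riesz f x \<le> ennreal (16 * ?v * (1 / sqrt m)) * ennreal m + ennreal (2 * (1 + ?v) / (1 / sqrt m))"
        using riesz_le_split[OF f, of "1 / sqrt m" x] real m by simp
      also have "\<dots> = ennreal (16 * ?v * (1 / sqrt m) * m + 2 * (1 + ?v) / (1 / sqrt m))"
        using m by (subst ennreal_mult[symmetric], simp, simp, subst ennreal_plus) auto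
      also have "16 * ?v * (1 / sqrt m) * m = 16 * ?v * sqrt m"
      proof -
        have "16 * ?v * (1 / sqrt m) * m = 16 * ?v * (m / sqrt m)" by simp
        also have "m / sqrt m = sqrt m" using m by (intro real_div_sqrt) auto
        finally show ?thesis .
      qed
      also have "16 * ?v * sqrt m + 2 * (1 + ?v) / (1 / sqrt m) = ?K * sqrt m"
        by (simp add: algebra_simps)
      also have "ennreal (?K * sqrt m) = ennreal ?K * maximal f x epowr (1 / 2)"
        using m real by (subst ennreal_mult) (auto simp: epowr_ennreal powr_half_sqrt add_nonneg_nonneg)
      finally show ?thesis .
    qed
  next
    case top
    then show ?thesis by (simp add: ennreal_mult_top add_pos_pos ennreal_eq_0_iff not_le)
  qed
qed

lemma modular_mono:
  "(\<And>x. f x \<le> g x) \<Longrightarrow> (\<And>x. 0 \<le> q x) \<Longrightarrow> modular q f \<le> modular q g"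
  unfolding modular_def by (intro nn_integral_mono epowr_mono) auto

text \<open>The p-modular of a square root is the p/2-modular of the function under the root, so
  Hedberg's inequality reduces the claim to the maximal theorem with exponent p/2. The bound with
  exponent 3/2 is the normalization in Hedberg's inequality.\<close>

lemma modular_riesz:
  assumes "log_exponent (\<lambda>x. p x / 2) a b C L"
  shows "\<exists>A\<ge>1. \<forall>f\<in>borel_measurable borel. modular (\<lambda>x. p x / 2) f \<le> 1 \<longrightarrow>
     modular (\<lambda>_. 3 / 2) f \<le> 1 \<longrightarrow> modular p (\<lambda>x. ennreal (1 / A) * riesz f x) \<le> 1"
proof -
  interpret log_exponent "\<lambda>x. p x / 2" a b C L by fact
  obtain B where B: "1 \<le> B" "\<And>f. f \<in> borel_measurable borel \<Longrightarrow> modular (\<lambda>x. p x / 2) f \<le> 1 \<Longrightarrow>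
     modular (\<lambda>x. p x / 2) (\<lambda>x. ennreal (1 / B) * maximal f x) \<le> 1"
    using modular_maximal by auto
  obtain K where K: "0 < K" "\<And>f x. f \<in> borel_measurable borel \<Longrightarrow> (\<integral>\<^sup>+y. f y epowr (3 / 2) \<partial>lborel) \<le> 1 \<Longrightarrow>
     riesz f x \<le> ennreal K * maximal f x epowr (1 / 2)"
    using hedberg by auto
  define A where "A = max 1 (K * sqrt B)"
  have A: "1 \<le> A" "K * sqrt B \<le> A" by (auto simp: A_def)
  show ?thesis
  proof (intro exI[of _ A] conjI ballI impI A(1))
    fix f :: "real^3 \<Rightarrow> ennreal"
    assume f: "f \<in> borel_measurable borel" "modular (\<lambda>x. p x / 2) f \<le> 1" "modular (\<lambda>_. 3 / 2) f \<le> 1"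
    have p0: "0 \<le> p x" for x using ab(1)[of x] a by simp
    have "ennreal (1 / A) * riesz f x \<le> (ennreal (1 / B) * maximal f x) epowr (1 / 2)" for x
    proof -
      have "ennreal (1 / A) * riesz f x \<le> ennreal (1 / A) * (ennreal K * maximal f x epowr (1 / 2))"
        using f(3) by (intro mult_left_mono K(2) f(1)) (auto simp: modular_def)
      also have "\<dots> = ennreal (K / A) * maximal f x epowr (1 / 2)"
        using A(1) K(1) by (simp add: mult.assoc[symmetric] flip: ennreal_mult)
      also have "\<dots> \<le> ennreal (1 / sqrt B) * maximal f x epowr (1 / 2)"
        using A B(1) by (intro mult_right_mono ennreal_leI) (auto simp: field_simps)
      also have "\<dots> = (ennreal (1 / B) * maximal f x) epowr (1 / 2)"
        using B(1) by (simp add: epowr_mult epowr_ennreal powr_half_sqrt real_sqrt_divide)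
      finally show ?thesis .
    qed
    then have "modular p (\<lambda>x. ennreal (1 / A) * riesz f x)
        \<le> modular p (\<lambda>x. (ennreal (1 / B) * maximal f x) epowr (1 / 2))"
      using p0 by (rule modular_mono)
    also have "\<dots> = modular (\<lambda>x. p x / 2) (\<lambda>x. ennreal (1 / B) * maximal f x)"
      by (simp add: modular_def epowr_epowr)
    also have "\<dots> \<le> 1" by (rule B(2)[OF f(1,2)])
    finally show "modular p (\<lambda>x. ennreal (1 / A) * riesz f x) \<le> 1" .
  qed
qed

lemma log_exponent_const: "1 < r \<Longrightarrow> log_exponent (\<lambda>_. r) r r 0 r"
  by unfold_locales auto

section \<open>The Oseen kernel\<close>

text \<open>With \<open>N\<close> the Newtonian kernel, \<open>N * g\<^sub>t\<close> is the integral of \<open>g\<^sub>s\<close> over \<open>s > t\<close>. The substitution \<open>a = 1 / sqrt s\<close> turns it into an integral of \<open>exp (- a\<^sup>2 (norm z)\<^sup>2 / 4)\<close> over \<open>0 < a < 1 / sqrt t\<close>, and each derivative in \<open>z\<close> raises the order of the moment.\<close>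

definition gauss_moment :: "nat \<Rightarrow> real \<Rightarrow> real \<Rightarrow> real" where
  "gauss_moment m b \<rho> = integral {0..b} (\<lambda>a. a ^ (2 * m) * exp (- (a\<^sup>2 * \<rho>)))"

lemma gauss_moment_has_derivative:
  "((\<lambda>\<rho>. gauss_moment m b \<rho>) has_real_derivative - gauss_moment (Suc m) b \<rho>) (at \<rho>)"
proof -
  have "((\<lambda>\<rho>. integral (cbox 0 b) (\<lambda>a. a ^ (2 * m) * exp (- (a\<^sup>2 * \<rho>)))) has_field_derivative
      integral (cbox 0 b) (\<lambda>a. - (a ^ (2 * Suc m) * exp (- (a\<^sup>2 * \<rho>))))) (at \<rho> within UNIV)"
  proof (rule leibniz_rule_field_derivative)
    fix x t :: real
    show "((\<lambda>x. t ^ (2 * m) * exp (- (t\<^sup>2 * x))) has_field_derivative - (t ^ (2 * Suc m) * exp (- (t\<^sup>2 * x)))) (at x within UNIV)"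
      by (auto intro!: derivative_eq_intros simp: power_add power2_eq_square)
    show "(\<lambda>a. a ^ (2 * m) * exp (- (a\<^sup>2 * x))) integrable_on cbox 0 b"
      by (intro integrable_continuous continuous_intros)
  next
    show "continuous_on (UNIV \<times> cbox 0 b) (\<lambda>(x, t). - (t ^ (2 * Suc m) * exp (- (t\<^sup>2 * x))))"
      by (auto simp: split_beta intro!: continuous_intros)
  qed auto
  then show ?thesis
    by (simp add: gauss_moment_def cbox_interval del: mult_Suc_right)
qed

lemma gauss_moment_nonneg: "0 \<le> gauss_moment m b \<rho>"
  unfolding gauss_moment_def
  by (intro integral_nonneg integrable_continuous_interval continuous_intros) auto

lemma set_integrable_gauss_moment:
  "set_integrable lborel {0..b} (\<lambda>a::real. a ^ (2 * m) * exp (- (a\<^sup>2 * \<rho>)))"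
  by (intro borel_integrable_atLeastAtMost' continuous_intros)

lemma borel_measurable_gauss_moment [measurable]:
  assumes [measurable]: "f \<in> borel_measurable M" "g \<in> borel_measurable M"
  shows "(\<lambda>x. gauss_moment m (f x) (g x)) \<in> borel_measurable M"
proof -
  have "gauss_moment m b \<rho> = (LINT a|lborel. (if 0 \<le> a \<and> a \<le> b then a ^ (2 * m) * exp (- (a\<^sup>2 * \<rho>)) else 0))" for b \<rho>
    unfolding gauss_moment_def
    by (subst set_borel_integral_eq_integral(2)[OF set_integrable_gauss_moment, symmetric])
       (auto simp: set_lebesgue_integral_def indicator_def intro!: Bochner_Integration.integral_cong)
  moreover have "(\<lambda>x. LINT a|lborel. (if 0 \<le> a \<and> a \<le> f x then a ^ (2 * m) * exp (- (a\<^sup>2 * g x)) else 0)) \<in> borel_measurable M"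
    by (rule lborel.borel_measurable_lebesgue_integral) measurable
  ultimately show ?thesis by simp
qed

lemma ennreal_gauss_moment:
  "ennreal (gauss_moment m b \<rho>) = (\<integral>\<^sup>+a. ennreal (a ^ (2 * m) * exp (- (a\<^sup>2 * \<rho>))) * indicator {0..b} a \<partial>lborel)"
proof (rule nn_integral_has_integral_lebesgue'[symmetric])
  show "((\<lambda>a. a ^ (2 * m) * exp (- (a\<^sup>2 * \<rho>))) has_integral gauss_moment m b \<rho>) {0..b}"
    unfolding gauss_moment_def
    by (intro integrable_integral integrable_continuous_interval continuous_intros)
qed auto

text \<open>The sixth order decay is what makes a^3 / max 1 (a d)^6 integrable in
  \<open>gauss_moment_bound\<close>. For x > 1 the exponential is bounded below by the fifth term of
  its series, and 122880 = 4^5 * 5!.\<close>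

lemma power_gauss_le:
  fixes x :: real
  assumes x: "0 \<le> x" and j: "j \<le> 4"
  shows "x ^ j * exp (- x\<^sup>2 / 4) \<le> 122880 / max 1 x ^ 6"
proof (cases "x \<le> 1")
  case True
  have "x ^ j * exp (- x\<^sup>2 / 4) \<le> 1 * 1"
    using x True by (intro mult_mono power_le_one) auto
  also have "1 * 1 \<le> 122880 / max 1 x ^ 6"
    using True by (simp add: max_absorb1)
  finally show ?thesis .
next
  case False
  then have x1: "1 < x" by simp
  have "(x\<^sup>2 / 4) ^ 5 / fact 5 \<le> exp (x\<^sup>2 / 4)"
  proof -
    define f where "f n = (x\<^sup>2 / 4) ^ n /\<^sub>R fact n" for n
    have S: "f sums exp (x\<^sup>2 / 4)"
      unfolding f_def by (rule exp_converges)
    have "0 \<le> f n" for n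
      unfolding f_def by (intro scaleR_nonneg_nonneg zero_le_power) auto
    then have "sum f {5} \<le> suminf f"
      by (intro sum_le_suminf sums_summable[OF S]) auto
    then have "f 5 \<le> exp (x\<^sup>2 / 4)" using sums_unique[OF S] by simp
    moreover have "f 5 = (x\<^sup>2 / 4) ^ 5 / fact 5"
      unfolding f_def scaleR_conv_of_real of_real_eq_id id_apply divide_inverse by (rule mult.commute)
    ultimately show ?thesis by metis
  qed
  then have "x ^ 10 \<le> 122880 * exp (x\<^sup>2 / 4)"
    by (simp add: power_divide fact_numeral flip: power_mult)
  then have "x ^ 10 * exp (- x\<^sup>2 / 4) \<le> 122880 * exp (x\<^sup>2 / 4) * exp (- x\<^sup>2 / 4)"
    by (intro mult_right_mono) auto
  then have *: "x ^ 10 * exp (- x\<^sup>2 / 4) \<le> 122880"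
    by (simp add: mult.assoc flip: exp_add)
  have "x ^ j * exp (- x\<^sup>2 / 4) * x ^ 6 \<le> x ^ 4 * exp (- x\<^sup>2 / 4) * x ^ 6"
    using x1 j by (intro mult_right_mono power_increasing) auto
  also have "\<dots> = x ^ 10 * exp (- x\<^sup>2 / 4)"
    by (simp add: mult_ac flip: power_add)
  also note *
  finally show ?thesis using x1 by (simp add: pos_le_divide_eq)
qed

lemma time_kernel_eq:
  assumes "0 < t"
  shows "time_kernel t z = 1 / (t\<^sup>2 * max 1 (norm z / sqrt t) ^ 4)"
proof -
  have "max (sqrt t) (norm z) = sqrt t * max 1 (norm z / sqrt t)"
    using assms by (auto simp: max_def field_simps)
  then show ?thesis
    using assms by (simp add: time_kernel_def power_mult_distrib power4_eq_xxxx power2_eq_square mult.assoc[symmetric])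
qed

text \<open>The relation \<open>j + 3 = 2 * m\<close> is scaling: the integrand becomes a^3 times a
  function of a |z|. If |z| <= sqrt t, integrating a^3 up to 1 / sqrt t gives order t^(-2).
  Otherwise the integral is split at a = 1 / |z|, beyond which the decay leaves a^(-3), and both
  parts are of order |z|^(-4).\<close>

lemma gauss_moment_bound:
  assumes t: "0 < t" and j: "j + 3 = 2 * m" "j \<le> 4"
  shows "norm z ^ j * gauss_moment m (1 / sqrt t) ((norm z)\<^sup>2 / 4) \<le> 245760 * time_kernel t z"
proof -
  let ?d = "norm z" and ?b = "1 / sqrt t"
  have pw: "?d ^ j * (a ^ (2 * m) * exp (- (a\<^sup>2 * (?d\<^sup>2 / 4)))) \<le> 122880 * (a ^ 3 / max 1 (a * ?d) ^ 6)" if "0 \<le> a" for a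
  proof -
    have "?d ^ j * (a ^ (2 * m) * exp (- (a\<^sup>2 * (?d\<^sup>2 / 4)))) = a ^ 3 * ((a * ?d) ^ j * exp (- (a * ?d)\<^sup>2 / 4))"
      by (simp add: power_mult_distrib power_add flip: j(1))
    also have "\<dots> \<le> a ^ 3 * (122880 / max 1 (a * ?d) ^ 6)"
      using that j by (intro mult_left_mono power_gauss_le) auto
    finally show ?thesis by (simp add: mult.commute)
  qed
  have eq: "ennreal (?d ^ j * gauss_moment m ?b (?d\<^sup>2 / 4))
      = (\<integral>\<^sup>+a. ennreal (?d ^ j * (a ^ (2 * m) * exp (- (a\<^sup>2 * (?d\<^sup>2 / 4))))) * indicator {0..?b} a \<partial>lborel)"
    by (subst ennreal_mult) (auto simp: gauss_moment_nonneg ennreal_gauss_moment nn_integral_cmult[symmetric] ennreal_mult mult.assoc)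
  also have "\<dots> \<le> ennreal (245760 * time_kernel t z)"
  proof (cases "?d \<le> sqrt t")
    case True
    have "(\<integral>\<^sup>+a. ennreal (?d ^ j * (a ^ (2 * m) * exp (- (a\<^sup>2 * (?d\<^sup>2 / 4))))) * indicator {0..?b} a \<partial>lborel)
        \<le> (\<integral>\<^sup>+a. ennreal (122880 * ?b ^ 3) * indicator {0..?b} a \<partial>lborel)"
    proof (intro nn_integral_mono)
      fix a :: real
      show "ennreal (?d ^ j * (a ^ (2 * m) * exp (- (a\<^sup>2 * (?d\<^sup>2 / 4))))) * indicator {0..?b} a
        \<le> ennreal (122880 * ?b ^ 3) * indicator {0..?b} a"
      proof (cases "a \<in> {0..?b}")
        case True
        have "a ^ 3 / max 1 (a * ?d) ^ 6 \<le> a ^ 3 / 1"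
          using True by (intro divide_left_mono one_le_power) auto
        also have "\<dots> \<le> ?b ^ 3" using True by (simp add: power_mono del: power_divide power_one_over)
        finally have "122880 * (a ^ 3 / max 1 (a * ?d) ^ 6) \<le> 122880 * ?b ^ 3" by simp
        then show ?thesis using pw[of a] True by (auto intro!: ennreal_leI)
      qed simp
    qed
    also have "\<dots> = ennreal (122880 * ?b ^ 3 * ?b)"
      using t by (simp add: nn_integral_cmult_indicator del: power_divide power_one_over flip: ennreal_mult)
    also have "122880 * ?b ^ 3 * ?b = 122880 * time_kernel t z"
      using t True by (simp add: time_kernel_def max_def power_divide power_numeral_reduce)
    also have "ennreal \<dots> \<le> ennreal (245760 * time_kernel t z)"
      using t by (intro ennreal_leI mult_right_mono) auto
    finally show ?thesis .
  next
    case False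
    then have d: "sqrt t < ?d" "0 < ?d" using t by (auto intro: less_trans[of 0 "sqrt t"])
    have "(\<integral>\<^sup>+a. ennreal (?d ^ j * (a ^ (2 * m) * exp (- (a\<^sup>2 * (?d\<^sup>2 / 4))))) * indicator {0..?b} a \<partial>lborel)
        \<le> (\<integral>\<^sup>+a. ennreal (122880 / ?d ^ 3) * indicator {0..1 / ?d} a
          + ennreal (61440 / ?d ^ 6) * (ennreal (2 / a ^ 3) * indicator {1 / ?d..} a) \<partial>lborel)"
    proof (intro nn_integral_mono)
      fix a :: real
      show "ennreal (?d ^ j * (a ^ (2 * m) * exp (- (a\<^sup>2 * (?d\<^sup>2 / 4))))) * indicator {0..?b} a
        \<le> ennreal (122880 / ?d ^ 3) * indicator {0..1 / ?d} a
          + ennreal (61440 / ?d ^ 6) * (ennreal (2 / a ^ 3) * indicator {1 / ?d..} a)"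
      proof (cases "a \<in> {0..?b}")
        case a: True
        show ?thesis
        proof (cases "a < 1 / ?d")
          case True
          have "a ^ 3 / max 1 (a * ?d) ^ 6 \<le> a ^ 3 / 1"
            using a by (intro divide_left_mono one_le_power) auto
          also have "\<dots> \<le> (1 / ?d) ^ 3"
            using True a by (simp add: power_mono del: power_divide power_one_over)
          finally have "122880 * (a ^ 3 / max 1 (a * ?d) ^ 6) \<le> 122880 / ?d ^ 3"
            by (simp add: power_divide)
          then show ?thesis
            using pw[of a] a True by (auto intro!: ennreal_leI add_increasing2)
        next
          case False
          then have a0: "0 < a" "1 \<le> a * ?d" using d by (auto simp: field_simps intro: less_le_trans[of 0 "1 / ?d"])
          have "122880 * (a ^ 3 / max 1 (a * ?d) ^ 6) = 61440 / ?d ^ 6 * (2 / a ^ 3)"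
            using a0 d by (simp add: max_absorb2 power_mult_distrib field_simps power_numeral_reduce)
          then have "ennreal (?d ^ j * (a ^ (2 * m) * exp (- (a\<^sup>2 * (?d\<^sup>2 / 4))))) \<le> ennreal (61440 / ?d ^ 6 * (2 / a ^ 3))"
            using pw[of a] a0 by (intro ennreal_leI) auto
          also have "\<dots> = ennreal (61440 / ?d ^ 6) * ennreal (2 / a ^ 3)"
            using a0 d by (intro ennreal_mult) auto
          finally show ?thesis
            using a False by (auto intro: add_increasing)
        qed
      qed simp
    qed
    also have "\<dots> = ennreal (122880 / ?d ^ 3) * ennreal (1 / ?d) + ennreal (61440 / ?d ^ 6) * ennreal (1 / (1 / ?d) ^ 2)"
      using tail_power_integral[of "1 / ?d" 2] d
      by (subst nn_integral_add) (auto simp: nn_integral_cmult_indicator nn_integral_cmult numeral_3_eq_3)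
    also have "\<dots> = ennreal (122880 / ?d ^ 3 * (1 / ?d) + 61440 / ?d ^ 6 * (1 / (1 / ?d) ^ 2))"
    proof -
      have "ennreal a * ennreal b + ennreal c * ennreal e = ennreal (a * b + c * e)"
        if "0 \<le> a" "0 \<le> b" "0 \<le> c" "0 \<le> e" for a b c e
        using that by (simp add: ennreal_mult ennreal_plus)
      then show ?thesis using d by simp
    qed
    also have "122880 / ?d ^ 3 * (1 / ?d) + 61440 / ?d ^ 6 * (1 / (1 / ?d) ^ 2) = 184320 * time_kernel t z"
      using d by (simp add: time_kernel_def max_def field_simps power_numeral_reduce)
    also have "ennreal \<dots> \<le> ennreal (245760 * time_kernel t z)"
      using t by (intro ennreal_leI mult_right_mono) auto
    finally show ?thesis .
  qed
  finally show ?thesis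
    using t by (subst (asm) ennreal_le_iff) auto
qed

definition heat_grad :: "3 \<Rightarrow> real \<Rightarrow> real^3 \<Rightarrow> real" where
  "heat_grad k t z = - (z $ k / (2 * t)) * heat_kernel t z"

text \<open>The factor (4 pi)^(-3/2) of the heat kernel times the 2 from ds = -2 a^(-3) da under the
  substitution a = 1 / sqrt s; the remaining powers of a cancel.\<close>

definition oseen_const :: real where
  "oseen_const = 2 / sqrt (4 * pi) ^ 3"

text \<open>The derivatives \<open>\<partial>\<^sub>i\<close>, \<open>\<partial>\<^sub>i\<partial>\<^sub>j\<close>, \<open>\<partial>\<^sub>i\<partial>\<^sub>j\<partial>\<^sub>k\<close> of \<open>N * g\<^sub>t\<close>.\<close>

definition newton_deriv :: "3 \<Rightarrow> real \<Rightarrow> real^3 \<Rightarrow> real" where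
  "newton_deriv i t z = - (oseen_const * (z $ i / 2) * gauss_moment 1 (1 / sqrt t) ((norm z)\<^sup>2 / 4))"

definition newton_deriv2 :: "3 \<Rightarrow> 3 \<Rightarrow> real \<Rightarrow> real^3 \<Rightarrow> real" where
  "newton_deriv2 i j t z = oseen_const *
     (z $ i * z $ j / 4 * gauss_moment 2 (1 / sqrt t) ((norm z)\<^sup>2 / 4)
      - of_bool (i = j) / 2 * gauss_moment 1 (1 / sqrt t) ((norm z)\<^sup>2 / 4))"

definition newton_deriv3 :: "3 \<Rightarrow> 3 \<Rightarrow> 3 \<Rightarrow> real \<Rightarrow> real^3 \<Rightarrow> real" where
  "newton_deriv3 i j k t z = oseen_const *
     ((of_bool (i = j) * z $ k + of_bool (i = k) * z $ j + of_bool (j = k) * z $ i) / 4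
        * gauss_moment 2 (1 / sqrt t) ((norm z)\<^sup>2 / 4)
      - z $ i * z $ j * z $ k / 8 * gauss_moment 3 (1 / sqrt t) ((norm z)\<^sup>2 / 4))"

text \<open>The derivative in direction \<open>k\<close> of the \<open>(i, j)\<close> entry of the
  Leray projection of the heat kernel, that is, of delta_ij g_t plus the second derivative in
  directions i, j of N * g_t.\<close>

definition oseen_kernel :: "3 \<Rightarrow> 3 \<Rightarrow> 3 \<Rightarrow> real \<Rightarrow> real^3 \<Rightarrow> real" where
  "oseen_kernel i j k t z = of_bool (i = j) * heat_grad k t z + newton_deriv3 i j k t z"

lemma heat_kernel_eq:
  "0 < t \<Longrightarrow> heat_kernel t z = exp (- (norm z)\<^sup>2 / (4 * t)) / sqrt (4 * pi * t) ^ 3"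
proof -
  assume t: "0 < t"
  have "(4 * pi * t) powr (- 3 / 2) = 1 / (4 * pi * t) powr (1 / 2 + 1 / 2 + 1 / 2)"
    by (subst powr_minus_divide[symmetric]) simp
  also have "\<dots> = 1 / sqrt (4 * pi * t) ^ 3"
    using t by (simp only: powr_add) (simp add: powr_half_sqrt power3_eq_cube)
  finally show ?thesis by (simp add: heat_kernel_def)
qed

lemma heat_kernel_minus: "heat_kernel t (x - y) = heat_kernel t (y - x)"
  by (simp add: heat_kernel_def norm_minus_commute)

lemma borel_measurable_heat_kernel [measurable]:
  assumes [measurable]: "f \<in> borel_measurable M" "g \<in> borel_measurable M"
  shows "(\<lambda>x. heat_kernel (f x) (g x)) \<in> borel_measurable M"
  unfolding heat_kernel_def by measurable

lemma borel_measurable_vec_nth [measurable]: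
  assumes [measurable]: "g \<in> borel_measurable M"
  shows "(\<lambda>x. (g x :: 'b::euclidean_space^'n) $ i) \<in> borel_measurable M"
proof -
  have "(\<lambda>v::'b^'n. v $ i) \<in> borel_measurable borel"
    by (intro borel_measurable_continuous_onI continuous_intros)
  from measurable_compose[OF assms this] show ?thesis .
qed

lemma borel_measurable_heat_grad [measurable]:
  assumes [measurable]: "f \<in> borel_measurable M" "g \<in> borel_measurable M"
  shows "(\<lambda>x. heat_grad k (f x) (g x)) \<in> borel_measurable M"
  unfolding heat_grad_def by measurable

lemma borel_measurable_oseen_kernel [measurable]:
  assumes [measurable]: "f \<in> borel_measurable M" "g \<in> borel_measurable M"
  shows "(\<lambda>x. oseen_kernel i j k (f x) (g x)) \<in> borel_measurable M"
  unfolding oseen_kernel_def newton_deriv3_def by measurable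

text \<open>One estimate serves the heat kernel (\<open>j = 0\<close>) and its gradient
  (\<open>j = 1\<close>). Of the sixth order decay only the fourth order is kept, to match
  \<open>time_kernel\<close>.\<close>

lemma heat_kernel_bound_aux:
  assumes "0 < t" "j \<le> 4"
  shows "(norm z / sqrt t) ^ j * heat_kernel t z \<le> 122880 * (t * t / sqrt t ^ 3 * time_kernel t z)"
proof -
  let ?x = "norm z / sqrt t"
  have pi4: "1 \<le> sqrt (4 * pi) ^ 3" using pi_gt3 by (intro one_le_power) (simp add: real_le_rsqrt)
  have e: "exp (- (norm z)\<^sup>2 / (4 * t)) = exp (- ?x\<^sup>2 / 4)"
    using assms by (simp add: power_divide field_simps)
  have "?x ^ j * heat_kernel t z = (?x ^ j * exp (- ?x\<^sup>2 / 4)) / (sqrt (4 * pi) ^ 3 * sqrt t ^ 3)"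
    unfolding heat_kernel_eq[OF assms(1)] e by (simp add: real_sqrt_mult power_mult_distrib)
  also have "\<dots> \<le> (122880 / max 1 ?x ^ 6) / (1 * sqrt t ^ 3)"
    using assms pi4 by (intro frac_le power_gauss_le mult_right_mono) auto
  also have "\<dots> \<le> (122880 / max 1 ?x ^ 4) / (1 * sqrt t ^ 3)"
    using assms by (intro divide_right_mono divide_left_mono power_increasing mult_pos_pos zero_less_power) auto
  also have "\<dots> = 122880 * (t * t / sqrt t ^ 3 * time_kernel t z)"
    using assms by (simp add: time_kernel_eq power2_eq_square)
  finally show ?thesis .
qed

lemma heat_kernel_nonneg: "0 \<le> heat_kernel t z"
  by (simp add: heat_kernel_def)

lemma heat_grad_bound:
  assumes t: "0 < t"
  shows "\<bar>heat_grad k t z\<bar> \<le> 122880 * time_kernel t z"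
proof -
  have "\<bar>heat_grad k t z\<bar> = \<bar>z $ k\<bar> / (2 * t) * heat_kernel t z"
    using t heat_kernel_nonneg[of t z] by (simp add: heat_grad_def abs_mult)
  also have "\<dots> \<le> norm z / t * heat_kernel t z"
    using t heat_kernel_nonneg[of t z] component_le_norm_cart[of z k]
    by (intro mult_right_mono frac_le) auto
  also have "\<dots> = (norm z / sqrt t) ^ 1 * heat_kernel t z * (sqrt t / t)"
    using t by (simp add: field_simps)
  also have "\<dots> \<le> 122880 * (t * t / sqrt t ^ 3 * time_kernel t z) * (sqrt t / t)"
    using t by (intro mult_right_mono heat_kernel_bound_aux) auto
  also have "\<dots> = 122880 * time_kernel t z"
    using t by (simp add: field_simps power3_eq_cube)
  finally show ?thesis .
qed

lemma heat_kernel_bound: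
  assumes t: "0 < t"
  shows "heat_kernel t z \<le> 122880 * (sqrt t * time_kernel t z)"
proof -
  have "t * t / sqrt t ^ 3 = sqrt t"
    using t by (simp add: field_simps power3_eq_cube)
  then show ?thesis using heat_kernel_bound_aux[OF t, of 0 z] by simp
qed

lemma oseen_const_bounds: "0 < oseen_const" "oseen_const \<le> 1"
proof -
  have "2 \<le> sqrt (4 * pi)" using pi_gt3 by (simp add: real_le_rsqrt)
  then have "2 ^ 3 \<le> sqrt (4 * pi) ^ 3" by (intro power_mono) auto
  then show "oseen_const \<le> 1" by (simp add: oseen_const_def)
qed (simp add: oseen_const_def)

text \<open>The third derivatives consist of terms of size |z| times the second moment and |z|^3
  times the third, exactly the combinations allowed in \<open>gauss_moment_bound\<close>. Their
  weights 3/4 and 1/8 sum to less than 1, and 368640 = 122880 + 245760.\<close>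

lemma oseen_kernel_bound:
  assumes t: "0 < t"
  shows "\<bar>oseen_kernel i j k t z\<bar> \<le> 368640 * time_kernel t z"
proof -
  let ?d = "norm z" and ?H = "\<lambda>m. gauss_moment m (1 / sqrt t) ((norm z)\<^sup>2 / 4)"
  have c: "\<bar>z $ l\<bar> \<le> ?d" for l by (rule component_le_norm_cart)
  have ob: "\<bar>of_bool P * z $ l\<bar> \<le> ?d" for P l using c[of l] by (cases P) auto
  let ?A = "of_bool (i = j) * z $ k + of_bool (i = k) * z $ j + of_bool (j = k) * z $ i"
  have A: "\<bar>?A\<bar> \<le> 3 * ?d"
    using ob[of "i = j" k] ob[of "i = k" j] ob[of "j = k" i] by linarith
  have B: "\<bar>z $ i * z $ j * z $ k\<bar> \<le> ?d ^ 3"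
    unfolding abs_mult power3_eq_cube using c by (intro mult_mono) auto
  have "\<bar>newton_deriv3 i j k t z\<bar> \<le> \<bar>?A / 4 * ?H 2 - z $ i * z $ j * z $ k / 8 * ?H 3\<bar>"
    using oseen_const_bounds by (simp add: newton_deriv3_def abs_mult mult_left_le_one_le)
  also have "\<dots> \<le> \<bar>?A / 4 * ?H 2\<bar> + \<bar>z $ i * z $ j * z $ k / 8 * ?H 3\<bar>"
    by (rule abs_triangle_ineq4)
  also have "\<dots> = \<bar>?A\<bar> / 4 * ?H 2 + \<bar>z $ i * z $ j * z $ k\<bar> / 8 * ?H 3"
    by (simp add: abs_mult gauss_moment_nonneg)
  also have "\<dots> \<le> 3 * ?d / 4 * ?H 2 + ?d ^ 3 / 8 * ?H 3"
    using A B by (intro add_mono mult_right_mono divide_right_mono gauss_moment_nonneg) auto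
  also have "\<dots> = 3 / 4 * (?d ^ 1 * ?H 2) + 1 / 8 * (?d ^ 3 * ?H 3)" by simp
  also have "\<dots> \<le> 3 / 4 * (245760 * time_kernel t z) + 1 / 8 * (245760 * time_kernel t z)"
    using t by (intro add_mono mult_left_mono gauss_moment_bound) auto
  also have "\<dots> \<le> 245760 * time_kernel t z" using t time_kernel_nonneg[of t z] by simp
  finally have "\<bar>newton_deriv3 i j k t z\<bar> \<le> 245760 * time_kernel t z" .
  moreover have "\<bar>of_bool (i = j) * heat_grad k t z\<bar> \<le> 122880 * time_kernel t z"
    using heat_grad_bound[OF t, of k z] t time_kernel_nonneg[of t z] by (cases "i = j") auto
  ultimately show ?thesis unfolding oseen_kernel_def by linarith
qed

section \<open>Derivatives of the heat kernel and of its Newtonian potential\<close>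

lemma partial_deriv_eqI: "(f has_derivative D) (at x) \<Longrightarrow> partial_deriv k f x = D (axis k 1)"
  unfolding partial_deriv_def by (metis frechet_derivative_at)

lemma has_derivative_gauss_moment_norm:
  "((\<lambda>y::real^3. gauss_moment m b ((norm (y - x))\<^sup>2 / 4)) has_derivative
     (\<lambda>h. - gauss_moment (Suc m) b ((norm (y - x))\<^sup>2 / 4) * ((y - x) \<bullet> h / 2))) (at y)"
proof -
  have 1: "((\<lambda>y::real^3. (norm (y - x))\<^sup>2 / 4) has_derivative (\<lambda>h. (y - x) \<bullet> h / 2)) (at y)"
    unfolding power2_norm_eq_inner
    by (auto intro!: derivative_eq_intros simp: inner_commute)
  show ?thesis
    using DERIV_compose_FDERIV[OF gauss_moment_has_derivative 1] by (simp add: mult.commute)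
qed

lemma has_derivative_heat_kernel:
  "0 < t \<Longrightarrow> ((\<lambda>y. heat_kernel t (y - x)) has_derivative
     (\<lambda>h. - ((y - x) \<bullet> h / (2 * t)) * heat_kernel t (y - x))) (at y)"
  unfolding heat_kernel_def power2_norm_eq_inner
  by (auto intro!: derivative_eq_intros simp: inner_commute field_simps)

lemma inner_axis_1: "(v::real^'n) \<bullet> axis k 1 = v $ k"
  by (simp add: inner_axis)

lemma partial_deriv_heat_kernel:
  "0 < t \<Longrightarrow> partial_deriv k (\<lambda>y. heat_kernel t (y - x)) y = heat_grad k t (y - x)"
  by (subst partial_deriv_eqI[OF has_derivative_heat_kernel]) (auto simp: inner_axis_1 heat_grad_def)

lemma has_derivative_vec_nth_diff:
  "((\<lambda>y::real^'n. (y - x) $ k) has_derivative (\<lambda>h. h $ k)) (at y)"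
proof -
  have "((\<lambda>y. y - x) has_derivative (\<lambda>h. h)) (at y)"
    by (auto intro!: derivative_eq_intros)
  then show ?thesis
    by (rule bounded_linear.has_derivative[OF bounded_linear_vec_nth])
qed

lemma axis_1_nth: "(axis k 1 :: real^'n) $ i = of_bool (i = k)"
  by (simp add: axis_def)

lemma has_derivative_newton_deriv:
  "((\<lambda>y. newton_deriv i t (y - x)) has_derivative
    (\<lambda>h. - (oseen_const * (h $ i / 2) * gauss_moment 1 (1 / sqrt t) ((norm (y - x))\<^sup>2 / 4))
        - oseen_const * ((y - x) $ i / 2) * (- gauss_moment (Suc 1) (1 / sqrt t) ((norm (y - x))\<^sup>2 / 4) * ((y - x) \<bullet> h / 2)))) (at y)"
proof -
  note G = has_derivative_gauss_moment_norm[where b="1 / sqrt t" and x=x and y=y]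
  note L = has_derivative_vec_nth_diff[where x=x and y=y]
  define w where "w = y - x"
  show ?thesis
    unfolding newton_deriv_def
    by (rule has_derivative_eq_rhs[OF has_derivative_minus[OF has_derivative_mult[OF
          has_derivative_mult_right[OF bounded_linear.has_derivative[OF bounded_linear_divide, OF L]] G]]])
       (simp only: fun_eq_iff w_def[symmetric], simp add: algebra_simps)
qed

lemma partial_deriv_newton_deriv:
  "partial_deriv j (\<lambda>y. newton_deriv i t (y - x)) y = newton_deriv2 i j t (y - x)"
proof -
  define w where "w = y - x"
  show ?thesis
    unfolding partial_deriv_eqI[OF has_derivative_newton_deriv] inner_axis_1 axis_1_nth newton_deriv2_def
    unfolding w_def[symmetric]
    by (simp add: algebra_simps numeral_2_eq_2)
qed

lemma has_derivative_newton_deriv2: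
  "((\<lambda>y. newton_deriv2 i j t (y - x)) has_derivative
    (\<lambda>h. oseen_const *
       ((h $ i * (y - x) $ j + (y - x) $ i * h $ j) / 4 * gauss_moment 2 (1 / sqrt t) ((norm (y - x))\<^sup>2 / 4)
       - (y - x) $ i * (y - x) $ j / 4 * (gauss_moment (Suc 2) (1 / sqrt t) ((norm (y - x))\<^sup>2 / 4) * ((y - x) \<bullet> h / 2))
       + of_bool (i = j) / 2 * (gauss_moment (Suc 1) (1 / sqrt t) ((norm (y - x))\<^sup>2 / 4) * ((y - x) \<bullet> h / 2))))) (at y)"
proof -
  note G = has_derivative_gauss_moment_norm[where b="1 / sqrt t" and x=x and y=y]
  note L = has_derivative_vec_nth_diff[where x=x and y=y]
  define w where "w = y - x"
  show ?thesis
    unfolding newton_deriv2_def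
    by (rule has_derivative_eq_rhs[OF has_derivative_mult_right[OF has_derivative_diff[OF
          has_derivative_mult[OF bounded_linear.has_derivative[OF bounded_linear_divide, OF has_derivative_mult[OF L L]] G]
          has_derivative_mult_right[OF G]]]])
       (simp only: fun_eq_iff w_def[symmetric], simp add: algebra_simps)
qed

lemma partial_deriv_oseen:
  assumes "0 < t"
  shows "partial_deriv k (\<lambda>y. of_bool (i = j) * heat_kernel t (y - x) + newton_deriv2 i j t (y - x)) y
    = oseen_kernel i j k t (y - x)"
proof -
  define w where "w = y - x"
  have "((\<lambda>y. of_bool (i = j) * heat_kernel t (y - x) + newton_deriv2 i j t (y - x)) has_derivative
    (\<lambda>h. of_bool (i = j) * (- ((y - x) \<bullet> h / (2 * t)) * heat_kernel t (y - x)) + oseen_const *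
       ((h $ i * (y - x) $ j + (y - x) $ i * h $ j) / 4 * gauss_moment 2 (1 / sqrt t) ((norm (y - x))\<^sup>2 / 4)
       - (y - x) $ i * (y - x) $ j / 4 * (gauss_moment (Suc 2) (1 / sqrt t) ((norm (y - x))\<^sup>2 / 4) * ((y - x) \<bullet> h / 2))
       + of_bool (i = j) / 2 * (gauss_moment (Suc 1) (1 / sqrt t) ((norm (y - x))\<^sup>2 / 4) * ((y - x) \<bullet> h / 2))))) (at y)"
    by (intro has_derivative_add has_derivative_mult_right has_derivative_heat_kernel[OF assms] has_derivative_newton_deriv2)
  from partial_deriv_eqI[OF this, of k] show ?thesis
    unfolding inner_axis_1 axis_1_nth oseen_kernel_def heat_grad_def newton_deriv3_def w_def[symmetric]
    by (simp add: algebra_simps numeral_2_eq_2 numeral_3_eq_3)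
qed

section \<open>Gaussian integrals and the Newtonian potential\<close>

lemma nn_integral_gauss_real:
  assumes k: "0 < k"
  shows "(\<integral>\<^sup>+x. ennreal (exp (- (k * (x::real)\<^sup>2))) \<partial>lborel) = ennreal (sqrt (pi / k))"
proof -
  define \<sigma> where "\<sigma> = sqrt (1 / (2 * k))"
  have s: "0 < \<sigma>" "\<sigma>\<^sup>2 = 1 / (2 * k)" using k by (auto simp: \<sigma>_def)
  have "exp (- (k * x\<^sup>2)) = sqrt (pi / k) * normal_density 0 \<sigma> x" for x
    using k by (simp add: normal_density_def s(2) real_sqrt_divide mult.commute)
  then have "(\<integral>\<^sup>+x. ennreal (exp (- (k * x\<^sup>2))) \<partial>lborel)
      = ennreal (sqrt (pi / k)) * (\<integral>\<^sup>+x. ennreal (normal_density 0 \<sigma> x) \<partial>lborel)"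
    using k by (simp add: ennreal_mult nn_integral_cmult)
  also have "(\<integral>\<^sup>+x. ennreal (normal_density 0 \<sigma> x) \<partial>lborel) = ennreal 1"
    using s(1) by (subst nn_integral_eq_integral) auto
  finally show ?thesis by simp
qed

lemma nn_integral_gauss:
  assumes k: "0 < k"
  shows "(\<integral>\<^sup>+u. ennreal (exp (- (k * (norm (u::real^3))\<^sup>2))) \<partial>lborel) = ennreal (sqrt (pi / k) ^ 3)"
proof -
  have "exp (- (k * (norm u)\<^sup>2)) = (\<Prod>b\<in>Basis. exp (- (k * (u \<bullet> b)\<^sup>2)))" for u :: "real^3"
  proof -
    have "(norm u)\<^sup>2 = (\<Sum>b\<in>Basis. (u \<bullet> b)\<^sup>2)"
      by (subst power2_norm_eq_inner, subst euclidean_inner) (simp add: power2_eq_square)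
    then show ?thesis
      by (simp add: exp_sum[symmetric] sum_distrib_left sum_negf)
  qed
  then have "(\<integral>\<^sup>+u. ennreal (exp (- (k * (norm (u::real^3))\<^sup>2))) \<partial>lborel)
     = (\<integral>\<^sup>+u. (\<Prod>b\<in>Basis. (\<lambda>b x. ennreal (exp (- (k * x\<^sup>2)))) b ((u::real^3) \<bullet> b)) \<partial>lborel)"
    by (simp add: prod_ennreal)
  also have "\<dots> = (\<Prod>b\<in>(Basis::(real^3) set). \<integral>\<^sup>+x. ennreal (exp (- (k * x\<^sup>2))) \<partial>lborel)"
    by (subst nn_integral_lborel_prod) auto
  also have "\<dots> = ennreal (sqrt (pi / k) ^ 3)"
    using k by (simp add: nn_integral_gauss_real ennreal_power)
  finally show ?thesis .
qed

lemma integral_gauss: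
  assumes k: "0 < k"
  shows "integrable lborel (\<lambda>u::real^3. exp (- (k * (norm u)\<^sup>2)))"
    "(LINT u|lborel. exp (- (k * (norm (u::real^3))\<^sup>2))) = sqrt (pi / k) ^ 3"
proof -
  have "has_bochner_integral lborel (\<lambda>u::real^3. exp (- (k * (norm u)\<^sup>2))) (sqrt (pi / k) ^ 3)"
    using k by (intro has_bochner_integral_nn_integral nn_integral_gauss) auto
  then show "integrable lborel (\<lambda>u::real^3. exp (- (k * (norm u)\<^sup>2)))"
    "(LINT u|lborel. exp (- (k * (norm (u::real^3))\<^sup>2))) = sqrt (pi / k) ^ 3"
    by (auto simp: has_bochner_integral_iff)
qed

lemma lborel_distr_uminus_euclidean: "distr lborel borel uminus = (lborel :: 'a::euclidean_space measure)"
  using lborel_affine[of "-1" "0::'a"] by (simp add: density_1)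

lemma integral_odd_eq_0:
  fixes f :: "'a::euclidean_space \<Rightarrow> real"
  assumes [measurable]: "f \<in> borel_measurable borel" and odd: "\<And>u. f (- u) = - f u"
  shows "(LINT u|lborel. f u) = 0"
proof -
  have "(LINT u|lborel. f u) = (LINT u|distr lborel borel uminus. f u)"
    by (simp add: lborel_distr_uminus_euclidean)
  also have "\<dots> = (LINT u|lborel. f (- u))"
    by (rule integral_distr) auto
  also have "\<dots> = - (LINT u|lborel. f u)"
    by (simp add: odd)
  finally show ?thesis by simp
qed

lemma integral_lborel_translate:
  fixes f :: "'a::euclidean_space \<Rightarrow> real"
  assumes [measurable]: "f \<in> borel_measurable borel"
  shows "(LINT u|lborel. f u) = (LINT u|lborel. f (c + u))"
proof -
  have "(LINT u|lborel. f u) = (LINT u|distr lborel borel ((+) c). f u)"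
    by (simp add: lborel_distr_plus)
  also have "\<dots> = (LINT u|lborel. f (c + u))"
    by (rule integral_distr) auto
  finally show ?thesis .
qed

lemma nn_integral_lborel_translate:
  fixes f :: "'a::euclidean_space \<Rightarrow> ennreal"
  assumes [measurable]: "f \<in> borel_measurable borel"
  shows "(\<integral>\<^sup>+u. f u \<partial>lborel) = (\<integral>\<^sup>+u. f (c + u) \<partial>lborel)"
proof -
  have "(\<integral>\<^sup>+u. f u \<partial>lborel) = (\<integral>\<^sup>+u. f u \<partial>distr lborel borel ((+) c))"
    by (simp add: lborel_distr_plus)
  also have "\<dots> = (\<integral>\<^sup>+u. f (c + u) \<partial>lborel)"
    by (rule nn_integral_distr) auto
  finally show ?thesis .
qed

lemma integrable_gauss_first_moment:
  assumes k: "0 < k"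
  shows "integrable lborel (\<lambda>u::real^3. u $ i * exp (- (k * (norm u)\<^sup>2)))"
proof (rule Bochner_Integration.integrable_bound)
  show "integrable lborel (\<lambda>u::real^3. (1 + 2 / k) * exp (- (k / 2 * (norm u)\<^sup>2)))"
    using k by (intro integrable_mult_right integral_gauss) auto
  show "AE u in lborel. norm (u $ i * exp (- (k * (norm u)\<^sup>2))) \<le> norm ((1 + 2 / k) * exp (- (k / 2 * (norm u)\<^sup>2)))"
  proof (intro AE_I2)
    fix u :: "real^3"
    let ?x = "norm u"
    have "\<bar>u $ i\<bar> \<le> ?x" by (rule component_le_norm_cart)
    also have "?x \<le> 1 + ?x\<^sup>2" by (smt (verit) one_le_power power2_eq_square mult_left_le_one_le norm_ge_zero self_le_power zero_le_power2 pos2)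
    also have "\<dots> \<le> (1 + 2 / k) * (1 + k / 2 * ?x\<^sup>2)"
      using k by (simp add: field_simps)
    also have "\<dots> \<le> (1 + 2 / k) * exp (k / 2 * ?x\<^sup>2)"
      using k by (intro mult_left_mono exp_ge_add_one_self) auto
    finally have "\<bar>u $ i\<bar> * exp (- (k * ?x\<^sup>2)) \<le> (1 + 2 / k) * exp (k / 2 * ?x\<^sup>2) * exp (- (k * ?x\<^sup>2))"
      by (intro mult_right_mono) auto
    also have "\<dots> = (1 + 2 / k) * exp (- (k / 2 * ?x\<^sup>2))"
      by (simp add: mult.assoc flip: exp_add)
    finally show "norm (u $ i * exp (- (k * ?x\<^sup>2))) \<le> norm ((1 + 2 / k) * exp (- (k / 2 * ?x\<^sup>2)))"
      using k by (simp add: abs_mult)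
  qed
qed measurable

text \<open>Completing the square centres the product of the two Gaussians at b / (a + b) times
  \<open>w\<close>; the first moment about that centre vanishes by symmetry.\<close>

lemma integral_gauss_product_moment:
  fixes w :: "real^3"
  assumes a: "0 < a" and b: "0 \<le> b"
  shows "(LINT v|lborel. v $ i * exp (- (a * (norm v)\<^sup>2 + b * (norm (v - w))\<^sup>2)))
    = b / (a + b) * w $ i * sqrt (pi / (a + b)) ^ 3 * exp (- (a * b / (a + b) * (norm w)\<^sup>2))"
proof -
  define g where "g = b / (a + b)"
  have ab: "0 < a + b" using a b by simp
  have sq: "a * (norm (g *\<^sub>R w + u))\<^sup>2 + b * (norm (g *\<^sub>R w + u - w))\<^sup>2
      = (a + b) * (norm u)\<^sup>2 + a * b / (a + b) * (norm w)\<^sup>2" for u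
  proof -
    have "g *\<^sub>R w + u - w = u - (1 - g) *\<^sub>R w" by (simp add: algebra_simps)
    then have "a * (norm (g *\<^sub>R w + u))\<^sup>2 + b * (norm (g *\<^sub>R w + u - w))\<^sup>2
      = (a + b) * (u \<bullet> u) + 2 * (a * g - b * (1 - g)) * (u \<bullet> w) + (a * g\<^sup>2 + b * (1 - g)\<^sup>2) * (w \<bullet> w)"
      unfolding power2_norm_eq_inner
      by (simp add: inner_add_left inner_add_right inner_diff_left inner_diff_right
          inner_commute[of w u] power2_eq_square algebra_simps)
    also have "a * g - b * (1 - g) = 0" using ab by (simp add: g_def field_simps)
    also have "a * g\<^sup>2 + b * (1 - g)\<^sup>2 = a * b / (a + b)"
    proof -
      define r where "r = a + b"
      have *: "g = b / r" "1 - g = a / r" "r \<noteq> 0" using ab by (auto simp: g_def r_def field_simps)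
      have "a * g\<^sup>2 + b * (1 - g)\<^sup>2 = a * b * (a + b) / (r * r)"
        unfolding *(2) unfolding *(1)
        by (simp add: power_divide power2_eq_square add_divide_distrib algebra_simps)
      then show ?thesis using \<open>r \<noteq> 0\<close> by (simp flip: r_def)
    qed
    finally show ?thesis by (simp add: power2_norm_eq_inner)
  qed
  have "(LINT v|lborel. v $ i * exp (- (a * (norm v)\<^sup>2 + b * (norm (v - w))\<^sup>2)))
    = (LINT u|lborel. (g *\<^sub>R w + u) $ i * exp (- (a * (norm (g *\<^sub>R w + u))\<^sup>2 + b * (norm (g *\<^sub>R w + u - w))\<^sup>2)))"
    by (rule integral_lborel_translate) measurable
  also have "\<dots> = (LINT u|lborel. exp (- (a * b / (a + b) * (norm w)\<^sup>2)) *
      (g * w $ i * exp (- ((a + b) * (norm u)\<^sup>2)) + u $ i * exp (- ((a + b) * (norm u)\<^sup>2))))"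
    unfolding sq by (intro Bochner_Integration.integral_cong) (simp_all add: exp_add[symmetric] algebra_simps)
  also have "\<dots> = exp (- (a * b / (a + b) * (norm w)\<^sup>2)) *
      (g * w $ i * sqrt (pi / (a + b)) ^ 3 + (LINT u|lborel. u $ i * exp (- ((a + b) * (norm (u::real^3))\<^sup>2))))"
    using integral_gauss[OF ab] integrable_gauss_first_moment[OF ab, of i]
    by (simp add: Bochner_Integration.integral_add)
  also have "(LINT u|lborel. u $ i * exp (- ((a + b) * (norm (u::real^3))\<^sup>2))) = 0"
    by (rule integral_odd_eq_0) auto
  finally show ?thesis by (simp add: g_def mult_ac)
qed

text \<open>This represents the Newtonian kernel as a superposition of Gaussians, so that its
  convolution with the heat kernel gradient reduces to products of Gaussians.\<close>

lemma nn_integral_inverse_distance: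
  assumes d: "0 < d"
  shows "(\<integral>\<^sup>+a. ennreal (exp (- (a\<^sup>2 / 4 * d\<^sup>2))) * indicator {0..} a \<partial>lborel) = ennreal (sqrt pi / d)"
proof -
  have m: "(\<integral>\<^sup>+x. ennreal (indicator {0..} x *\<^sub>R exp (- x\<^sup>2)) \<partial>lborel) = ennreal (sqrt pi / 2)"
    using gaussian_moment_0
    by (subst nn_integral_eq_integral) (auto simp: has_bochner_integral_iff)
  have "(\<integral>\<^sup>+x. ennreal (indicator {0..} x *\<^sub>R exp (- x\<^sup>2)) \<partial>lborel)
      = ennreal \<bar>d / 2\<bar> * (\<integral>\<^sup>+a. ennreal (indicator {0..} (0 + d / 2 * a) *\<^sub>R exp (- (0 + d / 2 * a)\<^sup>2)) \<partial>lborel)"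
    using d by (intro nn_integral_real_affine) auto
  also have "(\<integral>\<^sup>+a. ennreal (indicator {0..} (0 + d / 2 * a) *\<^sub>R exp (- (0 + d / 2 * a)\<^sup>2)) \<partial>lborel)
      = (\<integral>\<^sup>+a. ennreal (exp (- (a\<^sup>2 / 4 * d\<^sup>2))) * indicator {0..} a \<partial>lborel)"
    using d by (intro nn_integral_cong) (auto simp: indicator_def zero_le_mult_iff power_mult_distrib power_divide mult_ac)
  finally have "ennreal (d / 2) * (\<integral>\<^sup>+a. ennreal (exp (- (a\<^sup>2 / 4 * d\<^sup>2))) * indicator {0..} a \<partial>lborel) = ennreal (sqrt pi / 2)"
    using m d by simp
  then have "ennreal (2 / d) * (ennreal (d / 2) * (\<integral>\<^sup>+a. ennreal (exp (- (a\<^sup>2 / 4 * d\<^sup>2))) * indicator {0..} a \<partial>lborel))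
      = ennreal (2 / d) * ennreal (sqrt pi / 2)"
    by (rule arg_cong)
  then show ?thesis
    using d by (subst (asm) ennreal_mult_assoc) (auto simp flip: ennreal_mult)
qed

text \<open>Convolving Gaussians adds variances: a^(-2) + t = s^(-2) for s = a / sqrt (1 + t a^2).
  This substitution maps the half line onto [0, 1 / sqrt t), which is the origin of the finite upper
  limit in \<open>gauss_moment\<close>.\<close>

lemma nn_integral_gauss_moment_substitution:
  assumes t: "0 < t"
  shows "(\<integral>\<^sup>+a. ennreal (a\<^sup>2 / sqrt (1 + t * a\<^sup>2) ^ 5 * exp (- (\<rho> * a\<^sup>2 / (1 + t * a\<^sup>2)))) * indicator {0..} a \<partial>lborel)
    = ennreal (gauss_moment 1 (1 / sqrt t) \<rho>)"
proof -
  define g where "g u = u\<^sup>2 * exp (- (u\<^sup>2 * \<rho>))" for u :: real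
  define \<sigma> where "\<sigma> a = a / sqrt (1 + t * a\<^sup>2)" for a
  \<comment> \<open>The antiderivative starts at -1 so that 0 is an interior point, where it has a
    two-sided derivative.\<close>
  define Q where "Q s = integral {-1..s} g" for s
  have cont: "continuous_on A g" for A unfolding g_def by (intro continuous_intros)
  have DQ: "(Q has_real_derivative g s) (at s)" if "0 \<le> s" for s
  proof -
    have "(Q has_real_derivative g s) (at s within {-1..s + 1})"
      unfolding Q_def using that by (intro integral_has_real_derivative cont) auto
    then show ?thesis
      using that by (subst (asm) at_within_interior) (auto simp: interior_atLeastAtMost_real)
  qed
  have pos: "0 < 1 + t * a\<^sup>2" for a using t by (simp add: add_pos_nonneg)
  have D\<sigma>: "(\<sigma> has_real_derivative 1 / sqrt (1 + t * a\<^sup>2) ^ 3) (at a)" for a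
  proof -
    have s: "0 < sqrt (1 + t * a\<^sup>2)" "(sqrt (1 + t * a\<^sup>2))\<^sup>2 = 1 + t * a\<^sup>2" using pos[of a] by auto
    have "(\<sigma> has_real_derivative (sqrt (1 + t * a\<^sup>2) - a * (t * a / sqrt (1 + t * a\<^sup>2))) / (sqrt (1 + t * a\<^sup>2) * sqrt (1 + t * a\<^sup>2))) (at a)"
      unfolding \<sigma>_def using pos[of a]
      by (auto intro!: derivative_eq_intros simp: field_simps)
    moreover have "(sqrt (1 + t * a\<^sup>2) - a * (t * a / sqrt (1 + t * a\<^sup>2))) = 1 / sqrt (1 + t * a\<^sup>2)"
      using s by (simp add: field_simps power2_eq_square)
    ultimately show ?thesis by (simp add: power3_eq_cube mult.commute)
  qed
  have "(\<integral>\<^sup>+a. ennreal (a\<^sup>2 / sqrt (1 + t * a\<^sup>2) ^ 5 * exp (- (\<rho> * a\<^sup>2 / (1 + t * a\<^sup>2)))) * indicator {0..} a \<partial>lborel)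
    = ennreal (Q (1 / sqrt t) - Q (\<sigma> 0))"
  proof (rule nn_integral_FTC_atLeast[where F="\<lambda>a. Q (\<sigma> a)"])
    fix a :: real assume a: "0 \<le> a"
    have "0 \<le> \<sigma> a" using a pos[of a] by (simp add: \<sigma>_def)
    from DERIV_chain2[OF DQ[OF this] D\<sigma>]
    have "((\<lambda>a. Q (\<sigma> a)) has_real_derivative g (\<sigma> a) * (1 / sqrt (1 + t * a\<^sup>2) ^ 3)) (at a)" .
    moreover have "g (\<sigma> a) * (1 / sqrt (1 + t * a\<^sup>2) ^ 3) = a\<^sup>2 / sqrt (1 + t * a\<^sup>2) ^ 5 * exp (- (\<rho> * a\<^sup>2 / (1 + t * a\<^sup>2)))"
    proof -
      have e: "(\<sigma> a)\<^sup>2 = a\<^sup>2 / (1 + t * a\<^sup>2)"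
        using pos[of a] by (simp add: \<sigma>_def power_divide)
      have "(a / S)\<^sup>2 * E * (1 / S ^ 3) = a\<^sup>2 / S ^ 5 * E" for S E :: real
        by (simp add: power_divide power_numeral_reduce)
      from this[of "sqrt (1 + t * a\<^sup>2)" "exp (- (\<rho> * a\<^sup>2 / (1 + t * a\<^sup>2)))"] show ?thesis
        unfolding g_def e by (simp add: \<sigma>_def[symmetric] e mult.commute)
    qed
    ultimately show "((\<lambda>a. Q (\<sigma> a)) has_real_derivative
        a\<^sup>2 / sqrt (1 + t * a\<^sup>2) ^ 5 * exp (- (\<rho> * a\<^sup>2 / (1 + t * a\<^sup>2)))) (at a)" by simp
    show "0 \<le> a\<^sup>2 / sqrt (1 + t * a\<^sup>2) ^ 5 * exp (- (\<rho> * a\<^sup>2 / (1 + t * a\<^sup>2)))"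
      using pos[of a] by simp
  next
    have "((\<lambda>a::real. inverse (a ^ 2)) \<longlongrightarrow> 0) at_top"
      by (intro tendsto_inverse_0_at_top filterlim_pow_at_top filterlim_ident) auto
    then have "((\<lambda>a. 1 / sqrt (inverse (a ^ 2) + t)) \<longlongrightarrow> 1 / sqrt (0 + t)) at_top"
      using t by (intro tendsto_intros) auto
    moreover have "eventually (\<lambda>a. 1 / sqrt (inverse (a ^ 2) + t) = \<sigma> a) at_top"
      using eventually_gt_at_top[of 0]
    proof eventually_elim
      case (elim a)
      have "inverse (a ^ 2) + t = (1 + t * a\<^sup>2) / a\<^sup>2" using elim by (simp add: field_simps)
      then show ?case using elim by (simp add: \<sigma>_def real_sqrt_divide)
    qed
    ultimately have "(\<sigma> \<longlongrightarrow> 1 / sqrt t) at_top"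
      by (simp add: filterlim_cong[OF refl refl])
    moreover have "isCont Q (1 / sqrt t)" using DQ[of "1 / sqrt t"] t by (intro DERIV_isCont) auto
    ultimately show "((\<lambda>a. Q (\<sigma> a)) \<longlongrightarrow> Q (1 / sqrt t)) at_top"
      by (rule isCont_tendsto_compose[rotated])
  qed measurable
  also have "Q (1 / sqrt t) - Q (\<sigma> 0) = gauss_moment 1 (1 / sqrt t) \<rho>"
  proof -
    have "integral {-1..0} g + integral {0..1 / sqrt t} g = integral {-1..1 / sqrt t} g"
      using t by (intro Henstock_Kurzweil_Integration.integral_combine integrable_continuous_interval cont) auto
    then show ?thesis by (simp add: Q_def \<sigma>_def gauss_moment_def g_def[abs_def])
  qed
  finally show ?thesis .
qed

text \<open>The kernel 1 / |w - v| is written as a Gaussian superposition in a, the integrals are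
  exchanged, the integral in v is a Gaussian moment and the integral in a is the substitution above.
  Since the gradient falls on the heat kernel first, no derivative of the singular Newtonian kernel
  occurs.\<close>

lemma newtonian_potential_heat_grad:
  assumes t: "0 < t"
  shows "(LINT v|lborel. heat_grad i t v / (4 * pi * norm (w - v))) = newton_deriv i t w"
proof -
  define f where "f v a = heat_grad i t v * (oseen_const * (exp (- (a\<^sup>2 / 4 * (norm (v - w))\<^sup>2)) * indicator {0..} a))" for v a
  have [measurable]: "case_prod f \<in> borel_measurable (lborel \<Otimes>\<^sub>M lborel)"
    unfolding f_def[abs_def] by measurable
  let ?s = "\<lambda>a. sqrt (1 + t * a\<^sup>2)" and ?\<rho> = "(norm w)\<^sup>2 / 4"
  have pos: "0 < 1 + t * a\<^sup>2" for a using t by (simp add: add_pos_nonneg)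
  have inner_a: "(LINT a|lborel. f v a) = heat_grad i t v / (4 * pi * norm (w - v))" if "v \<noteq> w" for v
  proof -
    have d: "0 < norm (v - w)" using that by simp
    have "has_bochner_integral lborel (\<lambda>a. exp (- (a\<^sup>2 / 4 * (norm (v - w))\<^sup>2)) * indicator {0..} a) (sqrt pi / norm (v - w))"
      using nn_integral_inverse_distance[OF d]
      by (intro has_bochner_integral_nn_integral) (auto simp: ennreal_mult' ennreal_indicator)
    then have "(LINT a|lborel. f v a) = heat_grad i t v * (oseen_const * (sqrt pi / norm (v - w)))"
      by (simp add: f_def has_bochner_integral_iff)
    also have "oseen_const * (sqrt pi / norm (v - w)) = 1 / (4 * pi * norm (w - v))"
      using d by (simp add: oseen_const_def real_sqrt_mult power3_eq_cube norm_minus_commute field_simps)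
    finally show ?thesis by simp
  qed
  have inner_v: "(LINT v|lborel. f v a) = - (oseen_const * (w $ i / 2)) *
      (a\<^sup>2 / ?s a ^ 5 * exp (- (?\<rho> * a\<^sup>2 / (1 + t * a\<^sup>2))) * indicator {0..} a)" for a
  proof -
    define A where "A = 1 / (4 * t)"
    define B where "B = a\<^sup>2 / 4"
    have AB: "0 < A" "0 \<le> B" using t by (auto simp: A_def B_def)
    have sum: "A + B = (1 + t * a\<^sup>2) / (4 * t)" using t by (simp add: A_def B_def field_simps)
    have e: "exp (- (A * (norm v)\<^sup>2 + B * (norm (v - w))\<^sup>2)) = exp (- (norm v)\<^sup>2 / (4 * t)) * exp (- (a\<^sup>2 / 4 * (norm (v - w))\<^sup>2))" for v
      by (simp add: A_def B_def exp_add[symmetric])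
    let ?c = "- (oseen_const / (2 * t * sqrt (4 * pi * t) ^ 3) * indicator {0..} a)"
    have "f v a = ?c * (v $ i * exp (- (A * (norm v)\<^sup>2 + B * (norm (v - w))\<^sup>2)))" for v
      unfolding f_def heat_grad_def heat_kernel_eq[OF t] e by simp
    then have "(LINT v|lborel. f v a) = ?c * (LINT v|lborel. v $ i * exp (- (A * (norm v)\<^sup>2 + B * (norm (v - w))\<^sup>2)))"
      by simp
    also have "\<dots> = ?c * (B / (A + B) * w $ i * sqrt (pi / (A + B)) ^ 3 * exp (- (A * B / (A + B) * (norm w)\<^sup>2)))"
      by (simp only: integral_gauss_product_moment[OF AB])
    also have "B / (A + B) = t * a\<^sup>2 / ?s a ^ 2"
      using t pos[of a] unfolding sum by (simp add: B_def field_simps)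
    also have "sqrt (pi / (A + B)) = sqrt (4 * pi * t) / ?s a"
      using t unfolding sum by (simp add: real_sqrt_divide[symmetric] mult_ac)
    also have "A * B / (A + B) * (norm w)\<^sup>2 = ?\<rho> * a\<^sup>2 / (1 + t * a\<^sup>2)"
      using t pos[of a] unfolding sum by (simp add: A_def B_def)
    also have "?c * (t * a\<^sup>2 / ?s a ^ 2 * w $ i * (sqrt (4 * pi * t) / ?s a) ^ 3 * exp (- (?\<rho> * a\<^sup>2 / (1 + t * a\<^sup>2))))
      = - (oseen_const * (w $ i / 2)) * (a\<^sup>2 / ?s a ^ 5 * exp (- (?\<rho> * a\<^sup>2 / (1 + t * a\<^sup>2))) * indicator {0..} a)"
    proof -
      have p: "sqrt (4 * pi * t) ^ 3 \<noteq> 0" "?s a \<noteq> 0" using t pos[of a] by auto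
      have key: "oseen_const / (2 * t * P) * I * (t * a\<^sup>2 / S ^ 2 * W * (R / S) ^ 3 * E) = oseen_const * (W / 2) * (a\<^sup>2 / S ^ 5 * E * I)"
        if "S \<noteq> 0" "P = R ^ 3" "R \<noteq> 0" for P S W R E I :: real
        using that t by (simp add: power_divide field_simps power_numeral_reduce)
      show ?thesis
        unfolding mult_minus_left using t by (subst key[OF p(2) refl]) auto
    qed
    finally show ?thesis .
  qed
  \<comment> \<open>For a <= 1 the Gaussian factor is at most 1 and the heat gradient is integrable;
    for a > 1 the heat gradient is bounded and the Gaussian has integral of order a^(-3).\<close>
  have int: "integrable (lborel \<Otimes>\<^sub>M lborel) (case_prod f)"
  proof (rule integrableI_bounded)
    define T where "T = (\<integral>\<^sup>+v. ennreal (time_kernel t v) \<partial>lborel)"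
    have T: "T < top"
    proof -
      have "T \<le> ennreal (32 * unit_ball_vol 3 / sqrt t) * maximal (\<lambda>_::real^3. 1) 0"
        using time_kernel_convolution_le[of "\<lambda>_. 1" t 0] t by (simp add: T_def)
      also have "\<dots> \<le> ennreal (32 * unit_ball_vol 3 / sqrt t) * 1"
        by (intro mult_left_mono maximal_le_one) auto
      finally show ?thesis by (simp add: order.strict_trans1)
    qed
    have hg: "\<bar>heat_grad i t v\<bar> \<le> 122880 / t\<^sup>2" for v
    proof -
      have "1 \<le> max 1 (norm v / sqrt t) ^ 4" by (intro one_le_power) auto
      then have "time_kernel t v \<le> 1 / t\<^sup>2"
        unfolding time_kernel_eq[OF t] using t by (intro divide_left_mono) auto
      then show ?thesis using heat_grad_bound[OF t, of i v] by simp
    qed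
    have nf: "norm (f v a) \<le> \<bar>heat_grad i t v\<bar> * (exp (- (a\<^sup>2 / 4 * (norm (v - w))\<^sup>2)) * indicator {0..} a)" for v a
      using oseen_const_bounds by (auto simp: f_def abs_mult indicator_def intro!: mult_left_mono mult_left_le_one_le)
    have "(\<integral>\<^sup>+ p. ennreal (norm (case_prod f p)) \<partial>(lborel \<Otimes>\<^sub>M lborel)) = (\<integral>\<^sup>+a. \<integral>\<^sup>+v. ennreal (norm (f v a)) \<partial>lborel \<partial>lborel)"
      by (subst lborel_pair.nn_integral_snd[symmetric]) auto
    also have "\<dots> \<le> (\<integral>\<^sup>+a. (ennreal 122880 * T) * indicator {0..1} a
        + ennreal (122880 / t\<^sup>2 * sqrt (4 * pi) ^ 3 / 2) * (ennreal (2 / a ^ 3) * indicator {1..} a) \<partial>lborel)"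
    proof (intro nn_integral_mono)
      fix a :: real
      show "(\<integral>\<^sup>+v. ennreal (norm (f v a)) \<partial>lborel) \<le> (ennreal 122880 * T) * indicator {0..1} a
        + ennreal (122880 / t\<^sup>2 * sqrt (4 * pi) ^ 3 / 2) * (ennreal (2 / a ^ 3) * indicator {1..} a)"
      proof (cases "0 \<le> a")
        case a: True
        show ?thesis
        proof (cases "a \<le> 1")
          case True
          have "(\<integral>\<^sup>+v. ennreal (norm (f v a)) \<partial>lborel) \<le> (\<integral>\<^sup>+v. ennreal 122880 * ennreal (time_kernel t v) \<partial>lborel)"
          proof (intro nn_integral_mono)
            fix v
            have "\<bar>heat_grad i t v\<bar> * (exp (- (a\<^sup>2 / 4 * (norm (v - w))\<^sup>2)) * indicator {0..} a) \<le> \<bar>heat_grad i t v\<bar> * 1"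
              using a by (intro mult_left_mono) auto
            then have "norm (f v a) \<le> \<bar>heat_grad i t v\<bar>"
              using nf[of v a] by linarith
            also have "\<dots> \<le> 122880 * time_kernel t v" by (rule heat_grad_bound[OF t])
            finally show "ennreal (norm (f v a)) \<le> ennreal 122880 * ennreal (time_kernel t v)"
              using t by (subst ennreal_mult[symmetric]) (auto intro!: ennreal_leI)
          qed
          also have "\<dots> = ennreal 122880 * T"
            unfolding T_def by (rule nn_integral_cmult) measurable
          finally show ?thesis using True a by (simp add: add_increasing2)
        next
          case False
          have "(\<integral>\<^sup>+v. ennreal (norm (f v a)) \<partial>lborel)
             \<le> (\<integral>\<^sup>+v. ennreal (122880 / t\<^sup>2) * ennreal (exp (- (a\<^sup>2 / 4 * (norm (v - w))\<^sup>2))) \<partial>lborel)"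
          proof (intro nn_integral_mono)
            fix v
            have "norm (f v a) \<le> \<bar>heat_grad i t v\<bar> * exp (- (a\<^sup>2 / 4 * (norm (v - w))\<^sup>2))"
              using nf[of v a] a by simp
            also have "\<dots> \<le> 122880 / t\<^sup>2 * exp (- (a\<^sup>2 / 4 * (norm (v - w))\<^sup>2))"
              by (intro mult_right_mono hg) auto
            finally show "ennreal (norm (f v a)) \<le> ennreal (122880 / t\<^sup>2) * ennreal (exp (- (a\<^sup>2 / 4 * (norm (v - w))\<^sup>2)))"
              by (simp add: ennreal_leI flip: ennreal_mult)
          qed
          also have "\<dots> = ennreal (122880 / t\<^sup>2) * (\<integral>\<^sup>+v. ennreal (exp (- (a\<^sup>2 / 4 * (norm (v - w))\<^sup>2))) \<partial>lborel)"
            by (rule nn_integral_cmult) measurable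
          also have "(\<integral>\<^sup>+v. ennreal (exp (- (a\<^sup>2 / 4 * (norm (v - w))\<^sup>2))) \<partial>lborel)
              = (\<integral>\<^sup>+u. ennreal (exp (- (a\<^sup>2 / 4 * (norm (u::real^3))\<^sup>2))) \<partial>lborel)"
            by (subst nn_integral_lborel_translate[of _ w]) auto
          also have "\<dots> = ennreal (sqrt (pi / (a\<^sup>2 / 4)) ^ 3)"
            using False by (intro nn_integral_gauss) auto
          also have "ennreal (122880 / t\<^sup>2) * ennreal (sqrt (pi / (a\<^sup>2 / 4)) ^ 3)
              = ennreal (122880 / t\<^sup>2 * sqrt (4 * pi) ^ 3 / 2) * ennreal (2 / a ^ 3)"
          proof -
            have "sqrt (pi / (a\<^sup>2 / 4)) = sqrt (4 * pi) / a"
              using False by (simp add: real_sqrt_divide real_sqrt_mult)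
            then show ?thesis
              using False by (subst (1 2) ennreal_mult[symmetric]) (auto simp: power_divide)
          qed
          finally show ?thesis using False by (simp add: add_increasing)
        qed
      next
        case False
        then have "(\<integral>\<^sup>+v. ennreal (norm (f v a)) \<partial>lborel) = 0" by (simp add: f_def)
        then show ?thesis by simp
      qed
    qed
    also have "\<dots> = (ennreal 122880 * T) * 1 + ennreal (122880 / t\<^sup>2 * sqrt (4 * pi) ^ 3 / 2) * ennreal (1 / 1 ^ 2)"
      using tail_power_integral[of 1 2]
      by (subst nn_integral_add) (auto simp: nn_integral_cmult_indicator nn_integral_cmult numeral_3_eq_3)
    also have "\<dots> < \<infinity>" using T by (simp add: ennreal_mult_less_top)
    finally show "(\<integral>\<^sup>+ p. ennreal (norm (case_prod f p)) \<partial>(lborel \<Otimes>\<^sub>M lborel)) < \<infinity>" .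
  qed measurable
  have "(LINT v|lborel. heat_grad i t v / (4 * pi * norm (w - v))) = (LINT v|lborel. LINT a|lborel. f v a)"
  proof (rule integral_cong_AE)
    show "AE v in lborel. heat_grad i t v / (4 * pi * norm (w - v)) = (LINT a|lborel. f v a)"
      using AE_lborel_singleton[of w] by eventually_elim (simp add: inner_a)
  qed measurable
  also have "\<dots> = (LINT a|lborel. LINT v|lborel. f v a)"
    by (rule lborel_pair.Fubini_integral[OF int, symmetric])
  also have "\<dots> = (LINT a|lborel. - (oseen_const * (w $ i / 2)) *
      (a\<^sup>2 / ?s a ^ 5 * exp (- (?\<rho> * a\<^sup>2 / (1 + t * a\<^sup>2))) * indicator {0..} a))"
    unfolding inner_v ..
  also have "\<dots> = - (oseen_const * (w $ i / 2)) * gauss_moment 1 (1 / sqrt t) ?\<rho>"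
  proof -
    have "has_bochner_integral lborel (\<lambda>a. a\<^sup>2 / ?s a ^ 5 * exp (- (?\<rho> * a\<^sup>2 / (1 + t * a\<^sup>2))) * indicator {0..} a)
        (gauss_moment 1 (1 / sqrt t) ?\<rho>)"
    proof (rule has_bochner_integral_nn_integral)
      have "(\<integral>\<^sup>+a. ennreal (a\<^sup>2 / ?s a ^ 5 * exp (- (?\<rho> * a\<^sup>2 / (1 + t * a\<^sup>2))) * indicator {0..} a) \<partial>lborel)
        = (\<integral>\<^sup>+a. ennreal (a\<^sup>2 / ?s a ^ 5 * exp (- (?\<rho> * a\<^sup>2 / (1 + t * a\<^sup>2)))) * indicator {0..} a \<partial>lborel)"
        by (intro nn_integral_cong) (simp add: indicator_def)
      then show "(\<integral>\<^sup>+a. ennreal (a\<^sup>2 / ?s a ^ 5 * exp (- (?\<rho> * a\<^sup>2 / (1 + t * a\<^sup>2))) * indicator {0..} a) \<partial>lborel)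
        = ennreal (gauss_moment 1 (1 / sqrt t) ?\<rho>)"
        by (simp only: nn_integral_gauss_moment_substitution[OF t])
    qed (use pos in \<open>auto simp: gauss_moment_nonneg less_imp_le\<close>)
    from has_bochner_integral_integral_eq[OF this] show ?thesis
      by (simp only: integral_mult_right_zero)
  qed
  finally show ?thesis by (simp add: newton_deriv_def)
qed

lemma inv_neg_laplacian_divergence:
  assumes t: "0 < t"
  shows "inv_neg_laplacian (divergence (\<lambda>y. heat_kernel t (x - y) *\<^sub>R axis i 1)) z = newton_deriv i t (z - x)"
proof -
  have "partial_deriv k (\<lambda>y. (heat_kernel t (x - y) *\<^sub>R axis i 1 :: real^3) $ k) y = of_bool (k = i) * heat_grad i t (y - x)" for k y
  proof (cases "k = i")
    case True
    then show ?thesis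
      using partial_deriv_heat_kernel[OF t, of i x y] by (simp add: heat_kernel_minus axis_1_nth)
  next
    case False
    then show ?thesis
      by (simp add: axis_1_nth partial_deriv_eqI[OF has_derivative_const])
  qed
  then have div: "divergence (\<lambda>y. heat_kernel t (x - y) *\<^sub>R axis i 1) y = heat_grad i t (y - x)" for y
    by (simp add: divergence_def of_bool_def if_distrib[of "\<lambda>c. c * _"] cong: if_cong)
  have "inv_neg_laplacian (divergence (\<lambda>y. heat_kernel t (x - y) *\<^sub>R axis i 1)) z
      = (LINT y|lborel. heat_grad i t (y - x) / (4 * pi * norm (z - y)))"
    unfolding inv_neg_laplacian_def div by (rule integral_completion) measurable
  also have "\<dots> = (LINT v|lborel. heat_grad i t (x + v - x) / (4 * pi * norm (z - (x + v))))"
    by (rule integral_lborel_translate) measurable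
  also have "\<dots> = (LINT v|lborel. heat_grad i t v / (4 * pi * norm (z - x - v)))"
    by (simp add: algebra_simps)
  also have "\<dots> = newton_deriv i t (z - x)"
    by (rule newtonian_potential_heat_grad[OF t])
  finally show ?thesis .
qed

text \<open>The link between \<open>leray\<close>, which is defined by an integral and a derivative,
  and the explicit kernel that was estimated.\<close>

lemma partial_deriv_leray:
  assumes t: "0 < t"
  shows "partial_deriv k (\<lambda>z. leray (\<lambda>y. heat_kernel t (x - y) *\<^sub>R axis i 1) z $ j) y = oseen_kernel i j k t (y - x)"
proof -
  let ?\<phi> = "\<lambda>y. heat_kernel t (x - y) *\<^sub>R axis i 1"
  have e: "inv_neg_laplacian (divergence ?\<phi>) = (\<lambda>z. newton_deriv i t (z - x))"
    by (rule ext) (rule inv_neg_laplacian_divergence[OF t])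
  have "leray ?\<phi> z $ j = of_bool (i = j) * heat_kernel t (z - x) + newton_deriv2 i j t (z - x)" for z
    unfolding leray_def gradient_def e
    by (auto simp: partial_deriv_newton_deriv axis_1_nth heat_kernel_minus[of t x z])
  then show ?thesis by (simp add: partial_deriv_oseen[OF t])
qed

lemma partial_deriv_heat_kernel_axis:
  assumes t: "0 < t"
  shows "partial_deriv k (\<lambda>z. (heat_kernel t (x - z) *\<^sub>R axis i 1 :: real^3) $ j) y = of_bool (i = j) * heat_grad k t (y - x)"
proof (cases "i = j")
  case True
  then show ?thesis
    using partial_deriv_heat_kernel[OF t, of k x y] by (simp add: heat_kernel_minus axis_1_nth)
next
  case False
  then show ?thesis
    by (simp add: axis_1_nth partial_deriv_eqI[OF has_derivative_const])
qed

section \<open>The Duhamel operator\<close>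

text \<open>The minus sign of the distributional divergence is left out. The quadratic term carries
  another minus in the mild equation and therefore becomes a positive
  \<open>duhamel oseen_kernel\<close>.\<close>

definition kernel_conv :: "(3 \<Rightarrow> 3 \<Rightarrow> 3 \<Rightarrow> real \<Rightarrow> real^3 \<Rightarrow> real) \<Rightarrow> real \<Rightarrow> (real^3 \<Rightarrow> real^3^3) \<Rightarrow> real^3 \<Rightarrow> real^3" where
  "kernel_conv k t M x = (\<chi> i. LINT y|lebesgue. (\<Sum>j\<in>UNIV. \<Sum>l\<in>UNIV. M y $ j $ l * k i j l t (y - x)))"

lemma heat_conv_leray_div_eq:
  "0 < t \<Longrightarrow> heat_conv_leray_div t M x = - kernel_conv oseen_kernel t M x"
  by (simp add: heat_conv_leray_div_def div_distr_def kernel_conv_def partial_deriv_leray vec_eq_iff)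

lemma heat_conv_div_eq:
  "0 < t \<Longrightarrow> heat_conv_div t M x = - kernel_conv (\<lambda>i j k t z. of_bool (i = j) * heat_grad k t z) t M x"
  unfolding heat_conv_div_def div_distr_def kernel_conv_def
  by (subst partial_deriv_heat_kernel_axis) (simp_all add: vec_eq_iff)

lemma measurable_fst_borel [measurable]:
  "fst \<in> borel_measurable (borel :: ('a::second_countable_topology \<times> 'b::second_countable_topology) measure)"
  by (simp add: borel_prod[symmetric])

lemma measurable_snd_borel [measurable]:
  "snd \<in> borel_measurable (borel :: ('a::second_countable_topology \<times> 'b::second_countable_topology) measure)"
  by (simp add: borel_prod[symmetric])

lemma borel_measurable_vec:
  fixes f :: "'x \<Rightarrow> real^'n"
  assumes "\<And>i. (\<lambda>x. f x $ i) \<in> borel_measurable M"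
  shows "f \<in> borel_measurable M"
proof (subst borel_measurable_euclidean_space, intro ballI)
  fix b :: "real^'n" assume "b \<in> Basis"
  then obtain i where "b = axis i 1" by (auto simp: Basis_vec_def)
  then show "(\<lambda>x. f x \<bullet> b) \<in> borel_measurable M"
    using assms[of i] by (simp add: inner_axis_1)
qed

lemma borel_measurable_tensor [measurable]:
  fixes f g :: "'x \<Rightarrow> real^3"
  assumes [measurable]: "f \<in> borel_measurable M" "g \<in> borel_measurable M"
  shows "(\<lambda>x. tensor (f x) (g x)) \<in> borel_measurable M"
proof (subst borel_measurable_euclidean_space, intro ballI)
  fix b :: "real^3^3" assume "b \<in> Basis"
  then obtain i j where b: "b = axis i (axis j 1)" by (auto simp: Basis_vec_def)
  have "tensor (f x) (g x) \<bullet> b = f x $ i * g x $ j" for x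
    by (simp add: b inner_axis tensor_def)
  then show "(\<lambda>x. tensor (f x) (g x) \<bullet> b) \<in> borel_measurable M" by simp
qed

lemma norm_tensor: "norm (tensor u v) = norm u * norm v"
proof -
  have "tensor u v $ i = u $ i *\<^sub>R v" for i
    by (simp add: tensor_def vec_eq_iff)
  then have "norm (tensor u v) = L2_set (\<lambda>i. \<bar>u $ i\<bar> * norm v) UNIV"
    by (simp add: norm_vec_def[of "tensor u v"])
  also have "\<dots> = norm u * norm v"
    by (simp add: norm_vec_def[of u] L2_set_left_distrib)
  finally show ?thesis .
qed

lemma tensor_diff: "tensor u u - tensor v v = tensor (u - v) u + tensor v (u - v)"
  by (simp add: tensor_def vec_eq_iff algebra_simps)

lemma norm_tensor_diff_le: "norm (tensor u u - tensor v v) \<le> norm (u - v) * (norm u + norm v)"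
  unfolding tensor_diff
  by (rule order_trans[OF norm_triangle_ineq]) (simp add: norm_tensor algebra_simps)

lemma AE_lborel_snd:
  assumes "AE x in lborel. P x"
  shows "AE p in (lborel :: ('a::euclidean_space \<times> 'b::euclidean_space) measure). P (snd p)"
proof -
  obtain N where N: "{x. \<not> P x} \<subseteq> N" "N \<in> sets lborel" "emeasure lborel N = 0"
    using assms by (auto elim!: AE_E)
  have "emeasure (lborel \<Otimes>\<^sub>M lborel) ((UNIV :: 'a set) \<times> N) = emeasure (lborel :: 'a measure) UNIV * emeasure lborel N"
    using N by (intro lborel.emeasure_pair_measure_Times) auto
  then have "(UNIV :: 'a set) \<times> N \<in> null_sets (lborel \<Otimes>\<^sub>M lborel)"
    using N by (auto simp: null_sets_def)
  then have "AE p in lborel \<Otimes>\<^sub>M (lborel :: 'b measure). p \<notin> (UNIV :: 'a set) \<times> N"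
    by (rule AE_not_in)
  then show ?thesis
    unfolding lborel_prod by eventually_elim (use N(1) in auto)
qed

definition kernel_apply :: "(3 \<Rightarrow> 3 \<Rightarrow> 3 \<Rightarrow> real \<Rightarrow> real^3 \<Rightarrow> real) \<Rightarrow> real \<Rightarrow> real^3 \<Rightarrow> real^3^3 \<Rightarrow> real^3" where
  "kernel_apply k t z A = (\<chi> i. \<Sum>j\<in>UNIV. \<Sum>l\<in>UNIV. A $ j $ l * k i j l t z)"

definition duhamel_integrand ::
    "(3 \<Rightarrow> 3 \<Rightarrow> 3 \<Rightarrow> real \<Rightarrow> real^3 \<Rightarrow> real) \<Rightarrow> (real \<Rightarrow> real^3 \<Rightarrow> real^3^3) \<Rightarrow> real \<Rightarrow> real^3 \<Rightarrow> real \<times> (real^3) \<Rightarrow> real^3" where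
  "duhamel_integrand k M t x p = (if 0 \<le> fst p \<and> fst p < t
     then kernel_apply k (t - fst p) (snd p - x) (M (fst p) (snd p)) else 0)"

text \<open>A single integral over space-time, so that its bounds can be integrated in either order:
  time first leads to the Riesz potential, space first to the maximal function.\<close>

definition duhamel ::
    "(3 \<Rightarrow> 3 \<Rightarrow> 3 \<Rightarrow> real \<Rightarrow> real^3 \<Rightarrow> real) \<Rightarrow> (real \<Rightarrow> real^3 \<Rightarrow> real^3^3) \<Rightarrow> real \<Rightarrow> real^3 \<Rightarrow> real^3" where
  "duhamel k M t x = (LINT p|lborel. duhamel_integrand k M t x p)"

text \<open>The size of the kernel on the times between \<open>r\<close> and \<open>t\<close>.
  Existence uses \<open>r = 0\<close>, uniqueness a short slot.\<close>

definition slot_kernel :: "real \<Rightarrow> real \<Rightarrow> real^3 \<Rightarrow> real \<times> (real^3) \<Rightarrow> ennreal" where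
  "slot_kernel r t x p = ennreal (time_kernel (t - fst p) (snd p - x)) * indicator {s. r \<le> s \<and> s < t} (fst p)"

lemma borel_measurable_slot_kernel [measurable]: "slot_kernel r t x \<in> borel_measurable borel"
  unfolding slot_kernel_def[abs_def] by measurable

lemma nn_integral_lborel_pair_snd:
  fixes f :: "'a::euclidean_space \<times> 'b::euclidean_space \<Rightarrow> ennreal"
  assumes [measurable]: "f \<in> borel_measurable borel"
  shows "(\<integral>\<^sup>+p. f p \<partial>lborel) = (\<integral>\<^sup>+y. \<integral>\<^sup>+s. f (s, y) \<partial>lborel \<partial>lborel)"
proof -
  have "f \<in> borel_measurable (lborel \<Otimes>\<^sub>M lborel)" by (simp add: lborel_prod)
  then show ?thesis
    by (simp add: lborel_pair.nn_integral_snd lborel_prod)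
qed

lemma nn_integral_lborel_pair_fst:
  fixes f :: "'a::euclidean_space \<times> 'b::euclidean_space \<Rightarrow> ennreal"
  assumes [measurable]: "f \<in> borel_measurable borel"
  shows "(\<integral>\<^sup>+p. f p \<partial>lborel) = (\<integral>\<^sup>+s. \<integral>\<^sup>+y. f (s, y) \<partial>lborel \<partial>lborel)"
proof -
  have "f \<in> borel_measurable (lborel \<Otimes>\<^sub>M lborel)" by (simp add: lborel_prod)
  then show ?thesis
    by (simp add: lborel.nn_integral_fst lborel_prod)
qed

text \<open>Time is integrated first, over the whole half line after reversing it; hence the bound
  is independent of the slot.\<close>

lemma slot_kernel_riesz_le:
  assumes [measurable]: "g \<in> borel_measurable borel"
  shows "(\<integral>\<^sup>+p. slot_kernel r t x p * g (snd p) \<partial>lborel) \<le> 2 * riesz g x"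
proof -
  have "(\<integral>\<^sup>+p. slot_kernel r t x p * g (snd p) \<partial>lborel)
      = (\<integral>\<^sup>+y. \<integral>\<^sup>+s. slot_kernel r t x (s, y) * g y \<partial>lborel \<partial>lborel)"
    by (subst nn_integral_lborel_pair_snd) auto
  also have "\<dots> = (\<integral>\<^sup>+y. g y * (\<integral>\<^sup>+s. slot_kernel r t x (s, y) \<partial>lborel) \<partial>lborel)"
    by (intro nn_integral_cong) (simp add: nn_integral_cmult[symmetric] mult.commute)
  also have "\<dots> \<le> (\<integral>\<^sup>+y. 2 * (g y * ennreal (1 / (norm (y - x))\<^sup>2)) \<partial>lborel)"
  proof (rule nn_integral_mono_AE)
    show "AE y in lborel. g y * (\<integral>\<^sup>+s. slot_kernel r t x (s, y) \<partial>lborel) \<le> 2 * (g y * ennreal (1 / (norm (y - x))\<^sup>2))"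
      using AE_lborel_singleton[of x]
    proof eventually_elim
      case (elim y)
      have "(\<integral>\<^sup>+s. slot_kernel r t x (s, y) \<partial>lborel)
         = ennreal \<bar>- 1\<bar> * (\<integral>\<^sup>+s. slot_kernel r t x (t + (- 1) * s, y) \<partial>lborel)"
        by (rule nn_integral_real_affine) auto
      also have "\<dots> \<le> (\<integral>\<^sup>+s. ennreal (time_kernel s (y - x)) * indicator {0<..} s \<partial>lborel)"
        by (simp, intro nn_integral_mono) (auto simp: slot_kernel_def indicator_def)
      also have "\<dots> \<le> ennreal (2 / (norm (y - x))\<^sup>2)"
        using elim by (intro time_kernel_integral_le) simp
      also have "\<dots> = 2 * ennreal (1 / (norm (y - x))\<^sup>2)"
        using ennreal_mult[of 2 "1 / (norm (y - x))\<^sup>2"] by simp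
      finally show ?case
        by (metis mult.left_commute mult_left_mono zero_le)
    qed
  qed
  also have "\<dots> = 2 * riesz g x"
    unfolding riesz_def by (rule nn_integral_cmult) measurable
  finally show ?thesis .
qed

lemma nn_integral_inverse_sqrt:
  assumes "r \<le> t"
  shows "(\<integral>\<^sup>+s. ennreal (1 / sqrt (t - s)) * indicator {s. r \<le> s \<and> s < t} s \<partial>lborel) \<le> ennreal (2 * sqrt (t - r))"
proof -
  have "((\<lambda>x. x powr (- 1 / 2)) has_integral ((t - r) powr (- 1 / 2 + 1) / (- 1 / 2 + 1))) {0..t - r}"
    using assms by (intro has_integral_powr_from_0) auto
  then have "(\<integral>\<^sup>+s. ennreal (s powr (- 1 / 2)) * indicator {0..t - r} s \<partial>lborel)
      = ennreal ((t - r) powr (- 1 / 2 + 1) / (- 1 / 2 + 1))"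
    by (intro nn_integral_has_integral_lebesgue') auto
  also have "(t - r) powr (- 1 / 2 + 1) / (- 1 / 2 + 1) = 2 * sqrt (t - r)"
    using assms by (simp add: powr_half_sqrt)
  finally have *: "(\<integral>\<^sup>+s. ennreal (s powr (- 1 / 2)) * indicator {0..t - r} s \<partial>lborel) = ennreal (2 * sqrt (t - r))" .
  have "(\<integral>\<^sup>+s. ennreal (1 / sqrt (t - s)) * indicator {s. r \<le> s \<and> s < t} s \<partial>lborel)
     = ennreal \<bar>- 1\<bar> * (\<integral>\<^sup>+s. ennreal (1 / sqrt (t - (t + (- 1) * s))) * indicator {s. r \<le> s \<and> s < t} (t + (- 1) * s) \<partial>lborel)"
    by (rule nn_integral_real_affine) auto
  also have "\<dots> \<le> (\<integral>\<^sup>+s. ennreal (s powr (- 1 / 2)) * indicator {0..t - r} s \<partial>lborel)"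
    by (simp, intro nn_integral_mono)
       (auto simp: indicator_def powr_minus_divide powr_half_sqrt)
  finally show ?thesis using * by simp
qed

text \<open>Space is integrated first: the time s costs 1 / sqrt (t - s), which integrates over the
  slot to 2 sqrt (t - r). This is the source of smallness for short slots.\<close>

lemma slot_kernel_maximal_le:
  assumes [measurable]: "g \<in> borel_measurable borel" and rt: "r \<le> t"
  shows "(\<integral>\<^sup>+p. slot_kernel r t x p * g (snd p) \<partial>lborel)
    \<le> ennreal (64 * unit_ball_vol 3 * sqrt (t - r)) * maximal g x"
proof -
  have "(\<integral>\<^sup>+p. slot_kernel r t x p * g (snd p) \<partial>lborel)
      = (\<integral>\<^sup>+s. \<integral>\<^sup>+y. slot_kernel r t x (s, y) * g y \<partial>lborel \<partial>lborel)"
    by (subst nn_integral_lborel_pair_fst) auto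
  also have "\<dots> \<le> (\<integral>\<^sup>+s. ennreal (32 * unit_ball_vol 3) * maximal g x * (ennreal (1 / sqrt (t - s)) * indicator {s. r \<le> s \<and> s < t} s) \<partial>lborel)"
  proof (intro nn_integral_mono)
    fix s :: real
    show "(\<integral>\<^sup>+y. slot_kernel r t x (s, y) * g y \<partial>lborel)
      \<le> ennreal (32 * unit_ball_vol 3) * maximal g x * (ennreal (1 / sqrt (t - s)) * indicator {s. r \<le> s \<and> s < t} s)"
    proof (cases "r \<le> s \<and> s < t")
      case True
      then have "(\<integral>\<^sup>+y. slot_kernel r t x (s, y) * g y \<partial>lborel) = (\<integral>\<^sup>+y. g y * ennreal (time_kernel (t - s) (y - x)) \<partial>lborel)"
        by (simp add: slot_kernel_def mult.commute)
      also have "\<dots> \<le> ennreal (32 * unit_ball_vol 3 / sqrt (t - s)) * maximal g x"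
        using True by (intro time_kernel_convolution_le) auto
      also have "ennreal (32 * unit_ball_vol 3 / sqrt (t - s)) = ennreal (32 * unit_ball_vol 3) * ennreal (1 / sqrt (t - s))"
        using True by (subst ennreal_mult[symmetric]) auto
      finally show ?thesis using True by (simp add: mult_ac)
    next
      case False
      then show ?thesis by (simp add: slot_kernel_def)
    qed
  qed
  also have "\<dots> = ennreal (32 * unit_ball_vol 3) * maximal g x * (\<integral>\<^sup>+s. ennreal (1 / sqrt (t - s)) * indicator {s. r \<le> s \<and> s < t} s \<partial>lborel)"
    by (rule nn_integral_cmult) measurable
  also have "\<dots> \<le> ennreal (32 * unit_ball_vol 3) * maximal g x * ennreal (2 * sqrt (t - r))"
    by (intro mult_left_mono nn_integral_inverse_sqrt rt) auto
  also have "\<dots> = ennreal (32 * unit_ball_vol 3) * ennreal (2 * sqrt (t - r)) * maximal g x"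
    by (simp add: mult_ac)
  also have "ennreal (32 * unit_ball_vol 3) * ennreal (2 * sqrt (t - r)) = ennreal (64 * unit_ball_vol 3 * sqrt (t - r))"
    using rt by (subst ennreal_mult[symmetric]) (auto simp: mult_ac)
  finally show ?thesis .
qed

text \<open>The heat kernel gradient, which acts on the force, and the Oseen kernel, which acts on
  the quadratic term, obey the same size bound and are treated together.\<close>

locale duhamel_kernel =
  fixes k :: "3 \<Rightarrow> 3 \<Rightarrow> 3 \<Rightarrow> real \<Rightarrow> real^3 \<Rightarrow> real" and K :: real
  assumes measurable_k: "\<And>i j l. (\<lambda>p. k i j l (fst p) (snd p)) \<in> borel_measurable borel"
    and K: "0 < K" and k_bound: "\<And>i j l t z. 0 < t \<Longrightarrow> \<bar>k i j l t z\<bar> \<le> K * time_kernel t z"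
begin

lemma measurable_k_comp [measurable]:
  assumes [measurable]: "f \<in> borel_measurable N" "g \<in> borel_measurable N"
  shows "(\<lambda>x. k i j l (f x) (g x)) \<in> borel_measurable N"
proof -
  have "(\<lambda>x. (f x, g x)) \<in> N \<rightarrow>\<^sub>M borel" by (simp add: borel_prod[symmetric])
  from measurable_compose[OF this measurable_k] show ?thesis by simp
qed

lemma measurable_kernel_apply [measurable]:
  assumes [measurable]: "f \<in> borel_measurable N" "g \<in> borel_measurable N" "h \<in> borel_measurable N"
  shows "(\<lambda>x. kernel_apply k (f x) (g x) (h x)) \<in> borel_measurable N"
  unfolding kernel_apply_def by (rule borel_measurable_vec) (simp, measurable)

text \<open>The norm is bounded by the sum of the components, and 27 counts the index
  triples.\<close>

lemma norm_kernel_apply_le: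
  assumes t: "0 < t"
  shows "norm (kernel_apply k t z A) \<le> 27 * K * (time_kernel t z * norm A)"
proof -
  have e: "\<bar>A $ j $ l * k i j l t z\<bar> \<le> norm A * (K * time_kernel t z)" for i j l
    unfolding abs_mult
  proof (intro mult_mono k_bound[OF t])
    have "\<bar>A $ j $ l\<bar> \<le> norm (A $ j)" by (rule component_le_norm_cart)
    also have "\<dots> \<le> norm A" by (rule Finite_Cartesian_Product.norm_nth_le)
    finally show "\<bar>A $ j $ l\<bar> \<le> norm A" .
  qed auto
  have "norm (kernel_apply k t z A) \<le> (\<Sum>i\<in>UNIV. \<bar>kernel_apply k t z A $ i\<bar>)"
    by (rule norm_le_l1_cart)
  also have "\<dots> \<le> (\<Sum>i\<in>(UNIV :: 3 set). \<Sum>j\<in>(UNIV :: 3 set). \<Sum>l\<in>(UNIV :: 3 set). norm A * (K * time_kernel t z))"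
    unfolding kernel_apply_def vec_lambda_beta
    by (intro sum_mono order_trans[OF sum_abs] order_trans[OF sum_abs sum_mono] e)
  also have "\<dots> = 27 * K * (time_kernel t z * norm A)"
    by simp
  finally show ?thesis .
qed

lemma measurable_duhamel_integrand [measurable]:
  assumes [measurable]: "case_prod M \<in> borel_measurable borel"
  shows "duhamel_integrand k M t x \<in> borel_measurable borel"
proof -
  have [measurable]: "(\<lambda>p. M (fst p) (snd p)) \<in> borel_measurable borel"
    using assms by (simp add: split_beta')
  show ?thesis unfolding duhamel_integrand_def[abs_def] by measurable
qed

lemma measurable_duhamel:
  assumes [measurable]: "case_prod M \<in> borel_measurable borel"
  shows "case_prod (duhamel k M) \<in> borel_measurable borel"
proof -
  have [measurable]: "(\<lambda>p. M (fst p) (snd p)) \<in> borel_measurable borel"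
    using assms by (simp add: split_beta')
  have "(\<lambda>q. M (fst (snd q)) (snd (snd q))) \<in> borel_measurable (borel \<Otimes>\<^sub>M borel)"
    by (rule measurable_compose[OF measurable_snd]) simp
  note [measurable] = this
  have "(\<lambda>tx. LINT p|lborel. duhamel_integrand k M (fst tx) (snd tx) p) \<in> borel_measurable (borel :: (real \<times> (real^3)) measure)"
    by (rule lborel.borel_measurable_lebesgue_integral)
       (unfold duhamel_integrand_def split_beta', measurable)
  then show ?thesis by (simp add: duhamel_def split_beta')
qed

lemma norm_duhamel_integrand_le:
  "ennreal (norm (duhamel_integrand k M t x p))
    \<le> ennreal (27 * K) * (slot_kernel 0 t x p * ennreal (norm (M (fst p) (snd p))))"
proof (cases "0 \<le> fst p \<and> fst p < t")
  case True
  then have "ennreal (norm (duhamel_integrand k M t x p))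
      \<le> ennreal (27 * K * (time_kernel (t - fst p) (snd p - x) * norm (M (fst p) (snd p))))"
    unfolding duhamel_integrand_def by (auto intro!: ennreal_leI norm_kernel_apply_le)
  also have "\<dots> = ennreal (27 * K) * (slot_kernel 0 t x p * ennreal (norm (M (fst p) (snd p))))"
    using True K by (simp add: slot_kernel_def ennreal_mult)
  finally show ?thesis .
qed (auto simp: duhamel_integrand_def)

text \<open>No integrability is required, since a Bochner integral that does not exist has the value
  0.\<close>

lemma norm_duhamel_le_nn_integral:
  "ennreal (norm (duhamel k M t x)) \<le> (\<integral>\<^sup>+p. ennreal (norm (duhamel_integrand k M t x p)) \<partial>lborel)"
proof (cases "integrable lborel (duhamel_integrand k M t x)")
  case True
  then show ?thesis unfolding duhamel_def by (rule integral_norm_bound_ennreal)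
next
  case False
  then show ?thesis by (simp add: duhamel_def not_integrable_integral_eq)
qed

lemma nn_integral_duhamel_integrand_le:
  assumes [measurable]: "g \<in> borel_measurable borel"
    and M: "AE p in lborel. 0 \<le> fst p \<and> fst p < t \<longrightarrow> ennreal (norm (M (fst p) (snd p))) \<le> g (snd p)"
  shows "(\<integral>\<^sup>+p. ennreal (norm (duhamel_integrand k M t x p)) \<partial>lborel) \<le> ennreal (54 * K) * riesz g x"
proof -
  have "(\<integral>\<^sup>+p. ennreal (norm (duhamel_integrand k M t x p)) \<partial>lborel)
     \<le> (\<integral>\<^sup>+p. ennreal (27 * K) * (slot_kernel 0 t x p * g (snd p)) \<partial>lborel)"
  proof (rule nn_integral_mono_AE)
    show "AE p in lborel. ennreal (norm (duhamel_integrand k M t x p)) \<le> ennreal (27 * K) * (slot_kernel 0 t x p * g (snd p))"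
      using M
    proof eventually_elim
      case (elim p)
      show ?case
      proof (cases "0 \<le> fst p \<and> fst p < t")
        case True
        then show ?thesis
          using elim by (intro order_trans[OF norm_duhamel_integrand_le] mult_left_mono) auto
      qed (auto simp: duhamel_integrand_def)
    qed
  qed
  also have "\<dots> = ennreal (27 * K) * (\<integral>\<^sup>+p. slot_kernel 0 t x p * g (snd p) \<partial>lborel)"
    by (rule nn_integral_cmult) measurable
  also have "\<dots> \<le> ennreal (27 * K) * (2 * riesz g x)"
    by (intro mult_left_mono slot_kernel_riesz_le) auto
  also have "\<dots> = ennreal (54 * K) * riesz g x"
    using K ennreal_mult_assoc[of "27 * K" 2 "riesz g x"] by simp
  finally show ?thesis .
qed

lemma integrable_duhamel_integrand:
  assumes [measurable]: "case_prod M \<in> borel_measurable borel" "g \<in> borel_measurable borel"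
    and M: "AE p in lborel. 0 \<le> fst p \<and> fst p < t \<longrightarrow> ennreal (norm (M (fst p) (snd p))) \<le> g (snd p)"
    and fin: "riesz g x < top"
  shows "integrable lborel (duhamel_integrand k M t x)"
proof (rule integrableI_bounded)
  have "(\<integral>\<^sup>+p. ennreal (norm (duhamel_integrand k M t x p)) \<partial>lborel) \<le> ennreal (54 * K) * riesz g x"
    using M by (intro nn_integral_duhamel_integrand_le) auto
  also have "\<dots> < \<infinity>" using fin by (simp add: ennreal_mult_less_top)
  finally show "(\<integral>\<^sup>+p. ennreal (norm (duhamel_integrand k M t x p)) \<partial>lborel) < \<infinity>" .
qed measurable

lemma norm_duhamel_le:
  assumes "g \<in> borel_measurable borel"
    and "AE p in lborel. 0 \<le> fst p \<and> fst p < t \<longrightarrow> ennreal (norm (M (fst p) (snd p))) \<le> g (snd p)"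
  shows "ennreal (norm (duhamel k M t x)) \<le> ennreal (54 * K) * riesz g x"
  using norm_duhamel_le_nn_integral nn_integral_duhamel_integrand_le[OF assms] by (rule order_trans)

lemma kernel_apply_diff: "kernel_apply k t z (A - B) = kernel_apply k t z A - kernel_apply k t z B"
  by (simp add: kernel_apply_def vec_eq_iff left_diff_distrib sum_subtractf)

lemma duhamel_diff:
  assumes "integrable lborel (duhamel_integrand k M t x)" "integrable lborel (duhamel_integrand k N t x)"
  shows "duhamel k M t x - duhamel k N t x = duhamel k (\<lambda>s y. M s y - N s y) t x"
proof -
  have "duhamel_integrand k (\<lambda>s y. M s y - N s y) t x p = duhamel_integrand k M t x p - duhamel_integrand k N t x p" for p
    by (simp add: duhamel_integrand_def kernel_apply_diff)
  then show ?thesis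
    using assms by (simp add: duhamel_def Bochner_Integration.integral_diff)
qed

end

lemma duhamel_kernel_oseen: "duhamel_kernel oseen_kernel 368640"
  by unfold_locales (auto intro: oseen_kernel_bound)

lemma duhamel_kernel_heat: "duhamel_kernel (\<lambda>i j k t z. of_bool (i = j) * heat_grad k t z) 368640"
proof
  fix i j l :: 3 and t :: real and z :: "real^3"
  assume t: "0 < t"
  have "\<bar>of_bool (i = j) * heat_grad l t z\<bar> \<le> \<bar>heat_grad l t z\<bar>" by auto
  also have "\<dots> \<le> 368640 * time_kernel t z"
    using heat_grad_bound[OF t, of l z] time_kernel_nonneg[of t z] t by linarith
  finally show "\<bar>of_bool (i = j) * heat_grad l t z\<bar> \<le> 368640 * time_kernel t z" .
qed auto

section \<open>Monotone limits of powers and potentials\<close>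

lemma epowr_SUP_le:
  assumes r: "0 < r"
  shows "(SUP n. c n) epowr r \<le> (SUP n. c n epowr r)"
proof -
  have "c n \<le> (SUP n. c n epowr r) epowr (1 / r)" for n
  proof -
    have "c n = (c n epowr r) epowr (1 / r)" using r by (simp add: epowr_epowr)
    also have "\<dots> \<le> (SUP n. c n epowr r) epowr (1 / r)"
      using r by (intro epowr_mono SUP_upper) auto
    finally show ?thesis .
  qed
  then have "(SUP n. c n) epowr r \<le> ((SUP n. c n epowr r) epowr (1 / r)) epowr r"
    using r by (intro epowr_mono SUP_least) auto
  then show ?thesis using r by (simp add: epowr_epowr)
qed

lemma riesz_cmult:
  assumes [measurable]: "f \<in> borel_measurable borel"
  shows "riesz (\<lambda>y. c * f y) x = c * riesz f x"
  unfolding riesz_def by (subst nn_integral_cmult[symmetric]) (auto simp: mult.assoc)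

lemma riesz_add:
  assumes [measurable]: "f \<in> borel_measurable borel" "g \<in> borel_measurable borel"
  shows "riesz (\<lambda>y. f y + g y) x = riesz f x + riesz g x"
  unfolding riesz_def by (subst nn_integral_add[symmetric]) (auto simp: distrib_right)

lemma riesz_SUP_le:
  assumes [measurable]: "\<And>n. f n \<in> borel_measurable borel" and inc: "\<And>y. incseq (\<lambda>n. f n y)"
  shows "riesz (\<lambda>y. SUP n. f n y) x \<le> (SUP n. riesz (f n) x)"
proof -
  have "riesz (\<lambda>y. SUP n. f n y) x = (\<integral>\<^sup>+y. (SUP n. f n y * ennreal (1 / (norm (y - x))\<^sup>2)) \<partial>lborel)"
    unfolding riesz_def by (simp add: SUP_mult_right_ennreal)
  also have "\<dots> = (SUP n. riesz (f n) x)"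
    unfolding riesz_def using inc
    by (intro nn_integral_monotone_convergence_SUP)
       (auto simp: incseq_def le_fun_def intro!: mult_right_mono)
  finally show ?thesis by simp
qed

section \<open>Picard iteration\<close>

text \<open>For \<open>\<mu> > 0\<close> this says that the Luxemburg norm of \<open>f\<close> is at most \<open>\<mu>\<close>.\<close>

definition small :: "('a::euclidean_space \<Rightarrow> real) \<Rightarrow> real \<Rightarrow> ('a \<Rightarrow> ennreal) \<Rightarrow> bool" where
  "small q \<mu> f \<longleftrightarrow> modular q (\<lambda>x. ennreal (1 / \<mu>) * f x) \<le> 1"

lemma small_mono:
  assumes "small q \<mu> g" "\<And>x. f x \<le> g x" "0 < \<mu>" "\<mu> \<le> \<nu>" "\<And>x. 0 \<le> q x"
  shows "small q \<nu> f"
proof -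
  have "modular q (\<lambda>x. ennreal (1 / \<nu>) * f x) \<le> modular q (\<lambda>x. ennreal (1 / \<mu>) * g x)"
    using assms by (intro modular_mono mult_mono ennreal_leI frac_le) auto
  then show ?thesis using assms(1) by (simp add: small_def)
qed

lemma small_cmult:
  assumes "small q \<mu> f" "0 < c" "0 < \<mu>"
  shows "small q (c * \<mu>) (\<lambda>x. ennreal c * f x)"
proof -
  have "ennreal (1 / (c * \<mu>)) * (ennreal c * f x) = ennreal (1 / \<mu>) * f x" for x
    using assms by (subst ennreal_mult_assoc) auto
  then show ?thesis using assms(1) by (simp add: small_def)
qed

text \<open>A substitute for the triangle inequality: divided by \<open>\<mu>\<close>, each summand
  is a quarter of its normalized version, so the sum is at most half the larger one. As exponents
  are at least 1, this half comes out of the power and compensates the sum of two modulars.\<close>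

lemma small_add:
  assumes [measurable]: "f \<in> borel_measurable borel" "g \<in> borel_measurable borel" "q \<in> borel_measurable borel"
    and f: "small q (\<mu> / 4) f" and g: "small q (\<mu> / 4) g" and \<mu>: "0 < \<mu>" and q: "\<And>x. 1 \<le> q x"
  shows "small q \<mu> (\<lambda>x. f x + g x)"
proof -
  have half: "ennreal (1 / 2) \<le> 1"
    using ennreal_leI[of "1 / 2" 1] by (simp only: ennreal_1)
  let ?f = "\<lambda>x. ennreal (1 / (\<mu> / 4)) * f x" and ?g = "\<lambda>x. ennreal (1 / (\<mu> / 4)) * g x"
  have "modular q (\<lambda>x. ennreal (1 / \<mu>) * (f x + g x)) \<le>
      (\<integral>\<^sup>+x. ennreal (1 / 2) * (?f x epowr q x + ?g x epowr q x) \<partial>lborel)"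
    unfolding modular_def
  proof (intro nn_integral_mono)
    fix x
    let ?m = "max (?f x) (?g x)"
    have "ennreal (1 / \<mu>) * f x = ennreal (1 / 4) * ?f x" "ennreal (1 / \<mu>) * g x = ennreal (1 / 4) * ?g x"
      using \<mu> by (simp_all add: ennreal_mult_assoc)
    then have "ennreal (1 / \<mu>) * (f x + g x) \<le> ennreal (1 / 4) * ?m + ennreal (1 / 4) * ?m"
      unfolding distrib_left by (auto intro!: add_mono mult_left_mono simp del: ennreal_1)
    also have "\<dots> = ennreal (1 / 2) * ?m"
      unfolding distrib_right[symmetric] by (subst ennreal_plus[symmetric]) auto
    finally have "(ennreal (1 / \<mu>) * (f x + g x)) epowr q x \<le> (ennreal (1 / 2) * ?m) epowr q x"
      by (rule epowr_mono) (use q[of x] in auto)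
    also have "\<dots> = ennreal (1 / 2) epowr q x * ?m epowr q x"
      by (rule epowr_mult)
    also have "\<dots> \<le> ennreal (1 / 2) epowr 1 * (?f x epowr q x + ?g x epowr q x)"
      using q[of x] half by (intro mult_mono epowr_antimono_exponent) (auto simp: max_def)
    finally show "(ennreal (1 / \<mu>) * (f x + g x)) epowr q x \<le> ennreal (1 / 2) * (?f x epowr q x + ?g x epowr q x)"
      by simp
  qed
  also have "\<dots> = ennreal (1 / 2) * (modular q ?f + modular q ?g)"
    unfolding modular_def by (subst nn_integral_cmult, measurable, subst nn_integral_add, auto)
  also have "\<dots> \<le> ennreal (1 / 2) * (1 + 1)"
    using f g unfolding small_def by (intro mult_left_mono add_mono) auto
  also have "\<dots> = ennreal (1 / 2 * 2)"
    by (subst ennreal_mult) auto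
  finally show ?thesis by (simp add: small_def)
qed

text \<open>Closedness of the ball under increasing limits takes the place of completeness.\<close>

lemma small_SUP:
  assumes [measurable]: "\<And>n. f n \<in> borel_measurable borel" "q \<in> borel_measurable borel"
    and inc: "\<And>x. incseq (\<lambda>n. f n x)" and q: "\<And>x. 0 < q x" and s: "\<And>n. small q \<mu> (f n)"
  shows "small q \<mu> (\<lambda>x. SUP n. f n x)"
proof -
  have "modular q (\<lambda>x. ennreal (1 / \<mu>) * (SUP n. f n x)) \<le> (\<integral>\<^sup>+x. (SUP n. (ennreal (1 / \<mu>) * f n x) epowr q x) \<partial>lborel)"
    unfolding modular_def using q by (intro nn_integral_mono) (simp add: SUP_mult_left_ennreal epowr_SUP_le)
  also have "\<dots> = (SUP n. modular q (\<lambda>x. ennreal (1 / \<mu>) * f n x))"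
    unfolding modular_def using inc q
    by (intro nn_integral_monotone_convergence_SUP)
       (auto simp: incseq_def le_fun_def less_imp_le intro!: epowr_mono mult_left_mono)
  also have "\<dots> \<le> 1" using s unfolding small_def by (intro SUP_least) auto
  finally show ?thesis by (simp add: small_def)
qed

context duhamel_kernel
begin

text \<open>From \<open>\<bar>u \<otimes> u - v \<otimes> v\<bar> \<le> \<bar>u - v\<bar> (\<bar>u\<bar> + \<bar>v\<bar>) \<le> (h - g) (h + g)\<close>, written without subtraction of extended numbers.\<close>

lemma duhamel_square_diff:
  assumes [measurable]: "case_prod u \<in> borel_measurable borel" "case_prod v \<in> borel_measurable borel"
    "g \<in> borel_measurable borel" "h \<in> borel_measurable borel"
    and v: "\<And>s y. ennreal (norm (v s y)) \<le> g y"
    and uv: "\<And>s y. ennreal (norm (u s y - v s y)) + g y \<le> h y"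
    and fin: "riesz (\<lambda>y. h y * h y) x < top"
  shows "ennreal (norm (duhamel k (\<lambda>s y. tensor (u s y) (u s y)) t x - duhamel k (\<lambda>s y. tensor (v s y) (v s y)) t x))
    + ennreal (54 * K) * riesz (\<lambda>y. g y * g y) x \<le> ennreal (54 * K) * riesz (\<lambda>y. h y * h y) x"
proof -
  have [measurable]: "(\<lambda>p. u (fst p) (snd p)) \<in> borel_measurable borel" "(\<lambda>p. v (fst p) (snd p)) \<in> borel_measurable borel"
    using assms(1,2) by (simp_all add: split_beta')
  have meas: "case_prod (\<lambda>s y. tensor (u s y) (u s y)) \<in> borel_measurable borel"
     "case_prod (\<lambda>s y. tensor (v s y) (v s y)) \<in> borel_measurable borel"
    by (simp_all add: split_beta')
  have gh: "g y \<le> h y" for y using uv[of 0 y] by (rule order_trans[rotated]) simp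
  have u: "ennreal (norm (u s y)) \<le> h y" for s y
  proof -
    have "ennreal (norm (u s y)) \<le> ennreal (norm (u s y - v s y) + norm (v s y))"
      using norm_triangle_ineq[of "u s y - v s y" "v s y"] by (intro ennreal_leI) simp
    also have "\<dots> \<le> ennreal (norm (u s y - v s y)) + g y"
      using v by (simp add: add_left_mono)
    also have "\<dots> \<le> h y" by (rule uv)
    finally show ?thesis .
  qed
  define m where "m y = h y * h y - g y * g y" for y
  have [measurable]: "m \<in> borel_measurable borel" unfolding m_def[abs_def] by measurable
  have mg: "m y + g y * g y = h y * h y" for y
    unfolding m_def using gh by (intro diff_add_cancel_ennreal mult_mono) auto
  have dm: "ennreal (norm (tensor (u s y) (u s y) - tensor (v s y) (v s y))) \<le> m y" for s y
  proof -
    let ?d = "ennreal (norm (u s y - v s y))"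
    have "ennreal (norm (tensor (u s y) (u s y) - tensor (v s y) (v s y))) \<le> ?d * (ennreal (norm (u s y)) + ennreal (norm (v s y)))"
      using norm_tensor_diff_le[of "u s y" "v s y"] by (simp add: ennreal_leI flip: ennreal_mult ennreal_plus)
    also have "\<dots> \<le> ?d * (h y + g y)"
      by (intro mult_left_mono add_mono u v) auto
    finally have le: "ennreal (norm (tensor (u s y) (u s y) - tensor (v s y) (v s y))) \<le> ?d * (h y + g y)" .
    show ?thesis
    \<comment> \<open>The cancellation below needs \<open>g y * g y\<close> finite. Where it is
      infinite, the convention \<open>top - top = top\<close> makes \<open>m y\<close> a trivial
      bound.\<close>
    proof (cases "g y * g y = top")
      case True
      then have "m y = top" using gh[of y] mg[of y] unfolding m_def
        by (metis ennreal_top_minus mult_mono top.extremum_uniqueI zero_le)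
      then show ?thesis by simp
    next
      case False
      have "?d * (h y + g y) + g y * g y = ?d * h y + (?d + g y) * g y"
        by (simp add: algebra_simps)
      also have "\<dots> \<le> ?d * h y + h y * g y"
        using uv by (intro add_left_mono mult_right_mono) auto
      also have "\<dots> = (?d + g y) * h y" by (simp add: algebra_simps)
      also have "\<dots> \<le> h y * h y" using uv by (intro mult_right_mono) auto
      finally have "?d * (h y + g y) + g y * g y \<le> m y + g y * g y" by (simp add: mg)
      then have "?d * (h y + g y) \<le> m y"
        using False by (simp add: ennreal_add_left_cancel_le add.commute[of _ "g y * g y"])
      then show ?thesis using le by simp
    qed
  qed
  have int: "integrable lborel (duhamel_integrand k (\<lambda>s y. tensor (u s y) (u s y)) t x)"
      "integrable lborel (duhamel_integrand k (\<lambda>s y. tensor (v s y) (v s y)) t x)"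
    using u order_trans[OF v gh] fin
    by (auto intro!: integrable_duhamel_integrand[where g="\<lambda>y. h y * h y"] meas AE_I2 mult_mono
        simp: norm_tensor ennreal_mult intro: order_trans)
  have "ennreal (norm (duhamel k (\<lambda>s y. tensor (u s y) (u s y)) t x - duhamel k (\<lambda>s y. tensor (v s y) (v s y)) t x))
      \<le> ennreal (54 * K) * riesz m x"
    unfolding duhamel_diff[OF int] using dm by (intro norm_duhamel_le) auto
  then have "ennreal (norm (duhamel k (\<lambda>s y. tensor (u s y) (u s y)) t x - duhamel k (\<lambda>s y. tensor (v s y) (v s y)) t x))
    + ennreal (54 * K) * riesz (\<lambda>y. g y * g y) x \<le> ennreal (54 * K) * riesz m x + ennreal (54 * K) * riesz (\<lambda>y. g y * g y) x"
    by (rule add_right_mono)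
  also have "\<dots> = ennreal (54 * K) * riesz (\<lambda>y. m y + g y * g y) x"
    by (subst riesz_add) (auto simp: distrib_left)
  finally show ?thesis by (simp add: mg)
qed

end

locale picard = duhamel_kernel +
  fixes a :: "real \<Rightarrow> real^3 \<Rightarrow> real^3" and E :: "real^3 \<Rightarrow> ennreal"
  assumes measurable_a [measurable]: "case_prod a \<in> borel_measurable borel"
    and measurable_E [measurable]: "E \<in> borel_measurable borel"
    and a_le: "\<And>t x. ennreal (norm (a t x)) \<le> E x"
begin

text \<open>\<open>G\<close> is the Picard iteration for the scalar equation of the majorants. The step \<open>G (Suc n) - G n\<close> dominates the corresponding step of the iteration for the velocity field, so no contraction estimate is needed.\<close>

primrec G :: "nat \<Rightarrow> real^3 \<Rightarrow> ennreal" where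
  "G 0 = (\<lambda>x. 0)"
| "G (Suc n) = (\<lambda>x. E x + ennreal (54 * K) * riesz (\<lambda>y. G n y * G n y) x)"

definition Gsup :: "real^3 \<Rightarrow> ennreal" where
  "Gsup x = (SUP n. G n x)"

text \<open>The iterates are cut off where the majorant is infinite, so that they converge at every
  point and the limit is measurable without discarding a null set.\<close>

primrec U :: "nat \<Rightarrow> real \<Rightarrow> real^3 \<Rightarrow> real^3" where
  "U 0 = (\<lambda>t x. 0)"
| "U (Suc n) = (\<lambda>t x. if Gsup x < top then a t x + duhamel k (\<lambda>s y. tensor (U n s y) (U n s y)) t x else 0)"

lemma measurable_G [measurable]: "G n \<in> borel_measurable borel"
  by (induction n) auto

lemma measurable_Gsup [measurable]: "Gsup \<in> borel_measurable borel"
  unfolding Gsup_def[abs_def] by measurable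

lemma G_le_Suc: "G n x \<le> G (Suc n) x"
proof (induction n arbitrary: x)
  case (Suc n)
  have "riesz (\<lambda>y. G n y * G n y) x \<le> riesz (\<lambda>y. G (Suc n) y * G (Suc n) y) x"
    by (intro riesz_mono mult_mono Suc) auto
  then show ?case by (simp add: add_left_mono mult_left_mono)
qed simp

lemma incseq_G: "incseq (\<lambda>n. G n x)"
  by (rule incseq_SucI) (rule G_le_Suc)

lemma G_le_Gsup: "G n x \<le> Gsup x"
  unfolding Gsup_def by (rule SUP_upper) simp

text \<open>Monotone convergence. The inequality suffices: it shows that the potential of
  \<open>Gsup\<close> squared is finite wherever \<open>Gsup\<close> is, and it bounds the
  iterates.\<close>

lemma Gsup_fixed_point: "E x + ennreal (54 * K) * riesz (\<lambda>y. Gsup y * Gsup y) x \<le> Gsup x"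
proof -
  have "Gsup y * Gsup y \<le> (SUP n. G n y * G n y)" for y
  proof -
    have "Gsup y * Gsup y = (SUP n. G n y) * Gsup y"
      by (simp add: Gsup_def)
    also have "\<dots> = (SUP n. G n y * Gsup y)"
      by (simp add: SUP_mult_right_ennreal)
    also have "\<dots> \<le> (SUP n. G n y * G n y)"
    proof (rule SUP_least)
      fix n
      have "G n y * Gsup y = (SUP m. G n y * G m y)"
        by (simp add: Gsup_def SUP_mult_left_ennreal)
      also have "\<dots> \<le> (SUP n. G n y * G n y)"
      proof (rule SUP_least)
        fix m
        have "G n y * G m y \<le> G (max n m) y * G (max n m) y"
          using incseq_G[of y] by (intro mult_mono) (auto simp: incseq_def)
        also have "\<dots> \<le> (SUP n. G n y * G n y)" by (rule SUP_upper) simp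
        finally show "G n y * G m y \<le> (SUP n. G n y * G n y)" .
      qed
      finally show "G n y * Gsup y \<le> (SUP n. G n y * G n y)" .
    qed
    finally show ?thesis .
  qed
  then have "riesz (\<lambda>y. Gsup y * Gsup y) x \<le> riesz (\<lambda>y. SUP n. G n y * G n y) x"
    by (rule riesz_mono)
  also have "\<dots> \<le> (SUP n. riesz (\<lambda>y. G n y * G n y) x)"
  proof (rule riesz_SUP_le)
    show "incseq (\<lambda>n. G n y * G n y)" for y
      using incseq_G[of y] by (auto simp: incseq_def intro!: mult_mono)
  qed measurable
  finally have "E x + ennreal (54 * K) * riesz (\<lambda>y. Gsup y * Gsup y) x
      \<le> E x + ennreal (54 * K) * (SUP n. riesz (\<lambda>y. G n y * G n y) x)"
    by (intro add_left_mono mult_left_mono) auto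
  also have "\<dots> = (SUP n. G (Suc n) x)"
    by (simp add: SUP_mult_left_ennreal ennreal_SUP_add_right)
  also have "\<dots> \<le> Gsup x"
    by (intro SUP_least G_le_Gsup)
  finally show ?thesis .
qed

lemma measurable_U [measurable]: "case_prod (U n) \<in> borel_measurable borel"
proof (induction n)
  case 0
  then show ?case by (simp add: split_beta')
next
  case (Suc n)
  have [measurable]: "(\<lambda>p. U n (fst p) (snd p)) \<in> borel_measurable borel"
    using Suc by (simp add: split_beta')
  have "case_prod (duhamel k (\<lambda>s y. tensor (U n s y) (U n s y))) \<in> borel_measurable borel"
    by (rule measurable_duhamel) (simp add: split_beta')
  then have [measurable]: "(\<lambda>p. duhamel k (\<lambda>s y. tensor (U n s y) (U n s y)) (fst p) (snd p)) \<in> borel_measurable borel"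
    by (simp add: split_beta')
  have [measurable]: "(\<lambda>p. a (fst p) (snd p)) \<in> borel_measurable borel"
    using measurable_a by (simp add: split_beta')
  show ?case by (simp add: split_beta')
qed

lemma riesz_Gsup_finite: "Gsup x < top \<Longrightarrow> riesz (\<lambda>y. Gsup y * Gsup y) x < top"
proof -
  assume x: "Gsup x < top"
  have "ennreal (54 * K) * riesz (\<lambda>y. Gsup y * Gsup y) x \<le> E x + ennreal (54 * K) * riesz (\<lambda>y. Gsup y * Gsup y) x"
    by (rule add_increasing) auto
  also have "\<dots> \<le> Gsup x" by (rule Gsup_fixed_point)
  also note x
  finally show ?thesis using K by (auto simp: ennreal_mult_less_top ennreal_eq_0_iff)
qed

lemma riesz_G_finite: "Gsup x < top \<Longrightarrow> riesz (\<lambda>y. G n y * G n y) x < top"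
  by (rule order.strict_trans1[OF riesz_mono riesz_Gsup_finite]) (auto intro!: mult_mono G_le_Gsup)

lemma norm_U_le: "ennreal (norm (U n t x)) \<le> G n x"
proof (induction n arbitrary: t x)
  case (Suc n)
  have "ennreal (norm (a t x + duhamel k (\<lambda>s y. tensor (U n s y) (U n s y)) t x))
      \<le> ennreal (norm (a t x) + norm (duhamel k (\<lambda>s y. tensor (U n s y) (U n s y)) t x))"
    by (intro ennreal_leI norm_triangle_ineq)
  also have "\<dots> \<le> E x + ennreal (54 * K) * riesz (\<lambda>y. G n y * G n y) x"
    using Suc by (auto intro!: add_mono a_le norm_duhamel_le AE_I2 mult_mono simp: norm_tensor ennreal_mult)
  finally show ?case by simp
qed simp

lemma U_step: "ennreal (norm (U (Suc n) t x - U n t x)) + G n x \<le> G (Suc n) x"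
proof (induction n arbitrary: t x)
  case 0
  then show ?case using norm_U_le[of 1 t x] by simp
next
  case (Suc n)
  show ?case
  proof (cases "Gsup x < top")
    case True
    have "ennreal (norm (duhamel k (\<lambda>s y. tensor (U (Suc n) s y) (U (Suc n) s y)) t x - duhamel k (\<lambda>s y. tensor (U n s y) (U n s y)) t x))
      + ennreal (54 * K) * riesz (\<lambda>y. G n y * G n y) x \<le> ennreal (54 * K) * riesz (\<lambda>y. G (Suc n) y * G (Suc n) y) x"
      by (rule duhamel_square_diff[OF measurable_U measurable_U measurable_G measurable_G norm_U_le Suc riesz_G_finite[OF True]])
    then have "E x + (ennreal (norm (duhamel k (\<lambda>s y. tensor (U (Suc n) s y) (U (Suc n) s y)) t x - duhamel k (\<lambda>s y. tensor (U n s y) (U n s y)) t x))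
      + ennreal (54 * K) * riesz (\<lambda>y. G n y * G n y) x) \<le> E x + ennreal (54 * K) * riesz (\<lambda>y. G (Suc n) y * G (Suc n) y) x"
      by (rule add_left_mono)
    moreover have "U (Suc (Suc n)) t x - U (Suc n) t x = duhamel k (\<lambda>s y. tensor (U (Suc n) s y) (U (Suc n) s y)) t x - duhamel k (\<lambda>s y. tensor (U n s y) (U n s y)) t x"
      using True by simp
    ultimately show ?thesis
      by (simp only: G.simps add.left_commute)
  next
    case False
    then show ?thesis using G_le_Suc[of "Suc n" x] by (simp only: U.simps) simp
  qed
qed

lemma U_diff:
  assumes "n \<le> m"
  shows "ennreal (norm (U m t x - U n t x)) + G n x \<le> G m x"
  using assms
proof (induction m rule: dec_induct)
  case (step m)
  have "ennreal (norm (U (Suc m) t x - U n t x)) + G n x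
      \<le> ennreal (norm (U (Suc m) t x - U m t x) + norm (U m t x - U n t x)) + G n x"
    using norm_triangle_ineq[of "U (Suc m) t x - U m t x" "U m t x - U n t x"]
    by (intro add_right_mono ennreal_leI) simp
  also have "\<dots> = ennreal (norm (U (Suc m) t x - U m t x)) + (ennreal (norm (U m t x - U n t x)) + G n x)"
    by (simp add: add.assoc)
  also have "\<dots> \<le> ennreal (norm (U (Suc m) t x - U m t x)) + G m x"
    by (intro add_left_mono step.IH)
  also have "\<dots> \<le> G (Suc m) x" by (rule U_step)
  finally show ?case .
qed simp

lemma convergent_of_majorant:
  assumes g: "g \<longlonglongrightarrow> l" and le: "\<And>n. ennreal (norm (w - f n)) + g n \<le> (l::ennreal)" and l: "l < top"
  shows "f \<longlonglongrightarrow> (w :: real^3)"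
proof -
  have "(\<lambda>n. l - g n) \<longlonglongrightarrow> l - l"
    using l by (intro tendsto_diff_ennreal tendsto_const g) auto
  then have "(\<lambda>n. l - g n) \<longlonglongrightarrow> 0" using l by (simp add: top.not_eq_extremum)
  moreover have "ennreal (norm (w - f n)) \<le> l - g n" for n
    using le[of n] by (simp add: ennreal_le_minus_iff add.commute)
  ultimately have "(\<lambda>n. ennreal (norm (w - f n))) \<longlonglongrightarrow> 0"
    by (intro tendsto_sandwich[OF _ _ tendsto_const \<open>(\<lambda>n. l - g n) \<longlonglongrightarrow> 0\<close>]) auto
  then have "(\<lambda>n. norm (w - f n)) \<longlonglongrightarrow> 0"
    by (subst (asm) ennreal_0[symmetric], subst (asm) tendsto_ennreal_iff) auto
  then have "(\<lambda>n. w - (w - f n)) \<longlonglongrightarrow> w - 0"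
    by (intro tendsto_diff tendsto_const) (simp add: tendsto_norm_zero_iff)
  then show ?thesis by simp
qed

lemma G_tendsto: "(\<lambda>n. G n x) \<longlonglongrightarrow> Gsup x"
  unfolding Gsup_def by (rule LIMSEQ_SUP[OF incseq_G])

text \<open>Distances between iterates are bounded by distances between the majorants, which form a
  convergent real sequence where \<open>Gsup\<close> is finite. Elsewhere all iterates
  vanish.\<close>

lemma U_Cauchy: "Cauchy (\<lambda>n. U n t x)"
proof (cases "Gsup x < top")
  case True
  have fin: "G n x < top" for n using G_le_Gsup[of n x] True by (rule order.strict_trans1)
  define \<gamma> where "\<gamma> n = enn2real (G n x)" for n
  have G: "G n x = ennreal (\<gamma> n)" "0 \<le> \<gamma> n" for n using fin[of n] by (auto simp: \<gamma>_def)
  have "(\<lambda>n. ennreal (\<gamma> n)) \<longlonglongrightarrow> ennreal (enn2real (Gsup x))"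
    using G_tendsto[of x] True by (simp add: G(1)[symmetric])
  then have "\<gamma> \<longlonglongrightarrow> enn2real (Gsup x)"
    using G(2) by (subst (asm) tendsto_ennreal_iff) auto
  then have "Cauchy \<gamma>" by (intro LIMSEQ_imp_Cauchy)
  moreover have "dist (U m t x) (U n t x) \<le> dist (\<gamma> m) (\<gamma> n)" for m n
  proof -
    have *: "norm (U m t x - U n t x) \<le> \<gamma> m - \<gamma> n" if "n \<le> m" for m n
      using U_diff[OF that, of t x] G by (simp flip: ennreal_plus)
    show ?thesis
      using *[of n m] *[of m n] by (cases "n \<le> m") (auto simp: dist_norm norm_minus_commute)
  qed
  ultimately show ?thesis
    unfolding Cauchy_def by (meson order.strict_trans1)
next
  case False
  then have "U n t x = 0" for n by (cases n) auto
  then show ?thesis by (simp add: convergent_Cauchy convergent_const)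
qed

text \<open>The distance of the limit to the iterate \<open>U n\<close> plus \<open>G n\<close> is
  at most \<open>Gsup\<close>; feeding this into \<open>duhamel_square_diff\<close> shows that the
  next iterate tends to the right-hand side as well, and limits are unique.\<close>

theorem picard_solution:
  "\<exists>u. case_prod u \<in> borel_measurable borel \<and> (\<forall>t x. ennreal (norm (u t x)) \<le> Gsup x) \<and>
     (\<forall>t x. Gsup x < top \<longrightarrow> u t x = a t x + duhamel k (\<lambda>s y. tensor (u s y) (u s y)) t x)"
proof -
  define u where "u t x = lim (\<lambda>n. U n t x)" for t x
  have lim: "(\<lambda>n. U n t x) \<longlonglongrightarrow> u t x" for t x
    unfolding u_def using U_Cauchy[of t x] by (simp add: Cauchy_convergent_iff convergent_LIMSEQ_iff)
  have [measurable]: "case_prod u \<in> borel_measurable borel"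
  proof (rule borel_measurable_LIMSEQ_metric)
    show "(\<lambda>n. case_prod (U n) p) \<longlonglongrightarrow> case_prod u p" for p
      using lim by (cases p) simp
  qed measurable
  have diff: "ennreal (norm (u t x - U n t x)) + G n x \<le> Gsup x" for n t x
  proof (rule tendsto_upperbound)
    show "(\<lambda>m. ennreal (norm (U m t x - U n t x)) + G n x) \<longlonglongrightarrow> ennreal (norm (u t x - U n t x)) + G n x"
      by (intro tendsto_intros lim)
    show "\<forall>\<^sub>F m in sequentially. ennreal (norm (U m t x - U n t x)) + G n x \<le> Gsup x"
      using eventually_ge_at_top[of n] by eventually_elim (metis U_diff G_le_Gsup order_trans)
  qed simp
  have "ennreal (norm (u t x)) \<le> Gsup x" for t x
    using diff[of t x 0] by simp
  moreover have "u t x = a t x + duhamel k (\<lambda>s y. tensor (u s y) (u s y)) t x" if x: "Gsup x < top" for t x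
  proof (rule LIMSEQ_unique)
    show "(\<lambda>n. U (Suc n) t x) \<longlonglongrightarrow> u t x"
      using lim by (rule LIMSEQ_Suc)
    show "(\<lambda>n. U (Suc n) t x) \<longlonglongrightarrow> a t x + duhamel k (\<lambda>s y. tensor (u s y) (u s y)) t x"
    proof (rule convergent_of_majorant[OF LIMSEQ_Suc[OF G_tendsto] _ x])
      fix n
      have "ennreal (norm (duhamel k (\<lambda>s y. tensor (u s y) (u s y)) t x - duhamel k (\<lambda>s y. tensor (U n s y) (U n s y)) t x))
        + ennreal (54 * K) * riesz (\<lambda>y. G n y * G n y) x \<le> ennreal (54 * K) * riesz (\<lambda>y. Gsup y * Gsup y) x"
        by (rule duhamel_square_diff[OF _ measurable_U measurable_G measurable_Gsup norm_U_le diff riesz_Gsup_finite[OF x]]) measurable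
      then have "E x + (ennreal (norm (duhamel k (\<lambda>s y. tensor (u s y) (u s y)) t x - duhamel k (\<lambda>s y. tensor (U n s y) (U n s y)) t x))
        + ennreal (54 * K) * riesz (\<lambda>y. G n y * G n y) x) \<le> E x + ennreal (54 * K) * riesz (\<lambda>y. Gsup y * Gsup y) x"
        by (rule add_left_mono)
      also have "\<dots> \<le> Gsup x" by (rule Gsup_fixed_point)
      finally show "ennreal (norm (a t x + duhamel k (\<lambda>s y. tensor (u s y) (u s y)) t x - U (Suc n) t x)) + G (Suc n) x \<le> Gsup x"
        using x by (simp add: add.left_commute)
    qed
  qed
  ultimately show ?thesis
    by (intro exI[of _ u]) auto
qed

text \<open>The ball of radius \<open>\<mu>\<close> is invariant under the scalar iteration:
  normalized by \<open>\<mu>\<close>, the square has modulars at most 1 with halved exponents, so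
  the quadratic term has size 54 K A \<open>\<mu>\<close> times \<open>\<mu>\<close>. This is at
  most a quarter of \<open>\<mu>\<close>, because 216 = 4 * 54.\<close>

lemma small_Gsup:
  assumes [measurable]: "p \<in> borel_measurable borel" and p: "\<And>x. 1 \<le> p x"
    and A: "1 \<le> A" "\<And>f. f \<in> borel_measurable borel \<Longrightarrow> modular (\<lambda>x. p x / 2) f \<le> 1 \<Longrightarrow>
      modular (\<lambda>_. 3 / 2) f \<le> 1 \<Longrightarrow> modular p (\<lambda>x. ennreal (1 / A) * riesz f x) \<le> 1"
    and B: "1 \<le> B" "\<And>f. f \<in> borel_measurable borel \<Longrightarrow>
      modular (\<lambda>_. 3 / 2) f \<le> 1 \<Longrightarrow> modular (\<lambda>_. 3) (\<lambda>x. ennreal (1 / B) * riesz f x) \<le> 1"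
    and \<mu>: "0 < \<mu>" "216 * K * A * \<mu> \<le> 1" "216 * K * B * \<mu> \<le> 1"
    and E: "small p (\<mu> / 4) E" "small (\<lambda>_. 3) (\<mu> / 4) E"
  shows "small p \<mu> Gsup" "small (\<lambda>_. 3) \<mu> Gsup"
proof -
  have p0: "0 \<le> p x" "0 < p x" for x using p[of x] by linarith+
  have riesz_small: "small p (\<mu> / 4) (\<lambda>x. ennreal (54 * K) * riesz (\<lambda>y. g y * g y) x)"
      "small (\<lambda>_. 3) (\<mu> / 4) (\<lambda>x. ennreal (54 * K) * riesz (\<lambda>y. g y * g y) x)"
    if [measurable]: "g \<in> borel_measurable borel" and g: "small p \<mu> g" "small (\<lambda>_. 3) \<mu> g" for g
  proof -
    define f where "f y = ennreal (1 / \<mu>\<^sup>2) * (g y * g y)" for y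
    have [measurable]: "f \<in> borel_measurable borel" unfolding f_def[abs_def] by measurable
    have f: "f y = (ennreal (1 / \<mu>) * g y) epowr 2" for y
      using \<mu>(1) by (simp add: f_def epowr_2 power2_eq_square ennreal_mult[of "1 / \<mu>" "1 / \<mu>", simplified] mult_ac)
    have "modular (\<lambda>x. p x / 2) f = modular p (\<lambda>x. ennreal (1 / \<mu>) * g x)"
      "modular (\<lambda>x. 3 / 2) f = modular (\<lambda>_. 3) (\<lambda>x. ennreal (1 / \<mu>) * g x)"
      by (simp_all add: modular_def f epowr_epowr)
    then have m: "modular (\<lambda>x. p x / 2) f \<le> 1" "modular (\<lambda>x. 3 / 2) f \<le> 1"
      using g by (simp_all add: small_def)
    have r: "riesz f x = ennreal (1 / \<mu>\<^sup>2) * riesz (\<lambda>y. g y * g y) x" for x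
      unfolding f_def[abs_def] by (rule riesz_cmult) measurable
    have e: "ennreal (1 / C) * riesz f x = ennreal (1 / (54 * K * C * \<mu>\<^sup>2)) * (ennreal (54 * K) * riesz (\<lambda>y. g y * g y) x)"
      if "1 \<le> C" for C x
      unfolding r using that \<mu> K by (subst (1 2) ennreal_mult_assoc) auto
    have 1: "small p (54 * K * A * \<mu>\<^sup>2) (\<lambda>x. ennreal (54 * K) * riesz (\<lambda>y. g y * g y) x)"
      using A(2)[OF _ m] by (simp add: small_def e[OF A(1)])
    have 2: "small (\<lambda>_. 3) (54 * K * B * \<mu>\<^sup>2) (\<lambda>x. ennreal (54 * K) * riesz (\<lambda>y. g y * g y) x)"
      using B(2)[OF _ m(2)] by (simp add: small_def e[OF B(1)])
    have 3: "54 * K * C * \<mu>\<^sup>2 \<le> \<mu> / 4" if "216 * K * C * \<mu> \<le> 1" for C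
    proof -
      have "54 * K * C * \<mu>\<^sup>2 = (216 * K * C * \<mu>) * (\<mu> / 4)" by (simp add: power2_eq_square)
      also have "\<dots> \<le> 1 * (\<mu> / 4)" using that \<mu>(1) by (intro mult_right_mono) auto
      finally show ?thesis by simp
    qed
    show "small p (\<mu> / 4) (\<lambda>x. ennreal (54 * K) * riesz (\<lambda>y. g y * g y) x)"
      using A(1) \<mu> K p0 by (intro small_mono[OF 1 _ _ 3]) auto
    show "small (\<lambda>_. 3) (\<mu> / 4) (\<lambda>x. ennreal (54 * K) * riesz (\<lambda>y. g y * g y) x)"
      using B(1) \<mu> K by (intro small_mono[OF 2 _ _ 3]) auto
  qed
  have G: "small p \<mu> (G n) \<and> small (\<lambda>_. 3) \<mu> (G n)" for n
  proof (induction n)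
    case 0
    then show ?case by (simp add: small_def modular_def)
  next
    case (Suc n)
    then have "small p (\<mu> / 4) (\<lambda>x. ennreal (54 * K) * riesz (\<lambda>y. G n y * G n y) x)"
      "small (\<lambda>_. 3) (\<mu> / 4) (\<lambda>x. ennreal (54 * K) * riesz (\<lambda>y. G n y * G n y) x)"
      by (auto intro!: riesz_small)
    then show ?case
      using E p \<mu>(1) unfolding G.simps by (auto intro!: small_add)
  qed
  show "small p \<mu> Gsup" "small (\<lambda>_. 3) \<mu> Gsup"
    unfolding Gsup_def[abs_def] using G p0 incseq_G by (auto intro!: small_SUP)
qed

end

section \<open>Uniqueness\<close>

lemma modular_cmult_const:
  assumes [measurable]: "f \<in> borel_measurable borel" and "0 \<le> c"
  shows "modular (\<lambda>_. r) (\<lambda>x. ennreal c * f x) = ennreal (c powr r) * modular (\<lambda>_. r) f"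
  unfolding modular_def epowr_mult using assms(2)
  by (subst nn_integral_cmult[symmetric]) (auto simp: epowr_ennreal)

text \<open>For constant exponents the modular is homogeneous, which turns the unit ball statement
  \<open>modular_riesz\<close> into the norm inequality from L^(3/2) to L^3.\<close>

lemma modular_riesz_cube:
  "\<exists>A\<ge>1. \<forall>f\<in>borel_measurable borel. \<forall>\<nu>>0. modular (\<lambda>_. 3 / 2) f \<le> ennreal (\<nu> powr (3 / 2)) \<longrightarrow>
     modular (\<lambda>_. 3) (riesz f) \<le> ennreal ((A * \<nu>) powr 3)"
proof -
  have "log_exponent (\<lambda>x::real^3. 3 / 2) (3 / 2) (3 / 2) 0 (3 / 2)" by (rule log_exponent_const) simp
  from modular_riesz[of "\<lambda>_. 3", simplified, OF this] obtain A where A: "1 \<le> A"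
    "\<And>f. f \<in> borel_measurable borel \<Longrightarrow> modular (\<lambda>_. 3 / 2) f \<le> 1 \<Longrightarrow> modular (\<lambda>_. 3) (\<lambda>x. ennreal (1 / A) * riesz f x) \<le> 1"
    by auto
  show ?thesis
  proof (intro exI[of _ A] conjI ballI allI impI A(1))
    fix f :: "real^3 \<Rightarrow> ennreal" and \<nu> :: real
    assume [measurable]: "f \<in> borel_measurable borel" and \<nu>: "0 < \<nu>"
      and f: "modular (\<lambda>_. 3 / 2) f \<le> ennreal (\<nu> powr (3 / 2))"
    have "modular (\<lambda>_. 3 / 2) (\<lambda>x. ennreal (1 / \<nu>) * f x) = ennreal ((1 / \<nu>) powr (3 / 2)) * modular (\<lambda>_. 3 / 2) f"
      using \<nu> by (intro modular_cmult_const) auto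
    also have "\<dots> \<le> ennreal ((1 / \<nu>) powr (3 / 2)) * ennreal (\<nu> powr (3 / 2))"
      by (intro mult_left_mono f) auto
    also have "\<dots> = 1"
      using \<nu> by (subst ennreal_mult[symmetric]) (auto simp flip: powr_mult)
    finally have "modular (\<lambda>_. 3) (\<lambda>x. ennreal (1 / A) * riesz (\<lambda>x. ennreal (1 / \<nu>) * f x) x) \<le> 1"
      by (intro A(2)) auto
    moreover have "ennreal (1 / A) * riesz (\<lambda>x. ennreal (1 / \<nu>) * f x) x = ennreal (1 / (A * \<nu>)) * riesz f x" for x
      using A(1) \<nu> by (subst riesz_cmult) (auto simp: ennreal_mult_assoc)
    ultimately have m: "ennreal ((1 / (A * \<nu>)) powr 3) * modular (\<lambda>_. 3) (riesz f) \<le> 1"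
      using A(1) \<nu> modular_cmult_const[of "riesz f" "1 / (A * \<nu>)" 3] by simp
    have "modular (\<lambda>_. 3) (riesz f) = ennreal ((A * \<nu>) powr 3) * (ennreal ((1 / (A * \<nu>)) powr 3) * modular (\<lambda>_. 3) (riesz f))"
    proof -
      have "(A * \<nu>) powr 3 * (1 / (A * \<nu>)) powr 3 = 1"
        using A(1) \<nu> by (subst powr_mult[symmetric]) auto
      then show ?thesis
        by (subst ennreal_mult_assoc) auto
    qed
    also have "\<dots> \<le> ennreal ((A * \<nu>) powr 3) * 1"
      by (intro mult_left_mono m) auto
    finally show "modular (\<lambda>_. 3) (riesz f) \<le> ennreal ((A * \<nu>) powr 3)" by simp
  qed
qed

text \<open>Hoelder with exponents \<open>3, 3\<close>, reduced to \<open>ab \<le> (a\<^sup>2 + b\<^sup>2) / 2\<close> by normalizing both factors.\<close>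

lemma modular_product_le:
  fixes f g :: "'a::euclidean_space \<Rightarrow> ennreal"
  assumes [measurable]: "f \<in> borel_measurable borel" "g \<in> borel_measurable borel"
    and f: "modular (\<lambda>_. 3) f \<le> ennreal (\<omega> powr 3)" and g: "modular (\<lambda>_. 3) g \<le> ennreal (\<epsilon> powr 3)"
    and pos: "0 < \<omega>" "0 < \<epsilon>"
  shows "modular (\<lambda>_. 3 / 2) (\<lambda>x. f x * g x) \<le> ennreal ((\<omega> * \<epsilon>) powr (3 / 2))"
proof -
  have half_sq: "a * b \<le> ennreal (1 / 2) * (a epowr 2 + b epowr 2)" for a b :: ennreal
  proof (cases "a = top \<or> b = top")
    case True
    then show ?thesis
      by (auto simp: ennreal_mult_top ennreal_mult_eq_top_iff)
  next
    case False
    then obtain s t where "a = ennreal s" "b = ennreal t" "0 \<le> s" "0 \<le> t"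
      by (cases a; cases b) auto
    moreover from this have "a epowr 2 = ennreal (s\<^sup>2)" "b epowr 2 = ennreal (t\<^sup>2)"
      by (simp_all add: epowr_numeral ennreal_power)
    moreover have "ennreal (s * t) \<le> ennreal (1 / 2 * (s\<^sup>2 + t\<^sup>2))"
      using sum_squares_bound[of s t] by (intro ennreal_leI) simp
    moreover have "ennreal (1 / 2 * (s\<^sup>2 + t\<^sup>2)) = ennreal (1 / 2) * (ennreal (s\<^sup>2) + ennreal (t\<^sup>2))"
      by (subst ennreal_mult) (simp_all add: ennreal_plus del: ennreal_1)
    ultimately show ?thesis
      by (simp only: ennreal_mult)
  qed
  let ?c = "ennreal ((\<omega> * \<epsilon>) powr (3 / 2))"
  let ?f = "\<lambda>x. ennreal (1 / \<omega>) * f x" and ?g = "\<lambda>x. ennreal (1 / \<epsilon>) * g x"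
  have norm1: "modular (\<lambda>_. 3) (\<lambda>x. ennreal (1 / c) * h x) \<le> 1"
    if [measurable]: "h \<in> borel_measurable borel" and "modular (\<lambda>_. 3) h \<le> ennreal (c powr 3)" "0 < c" for c and h :: "'a \<Rightarrow> ennreal"
  proof -
    have "modular (\<lambda>_. 3) (\<lambda>x. ennreal (1 / c) * h x) \<le> ennreal ((1 / c) powr 3) * ennreal (c powr 3)"
      using that by (subst modular_cmult_const) (auto intro!: mult_left_mono)
    also have "\<dots> = 1"
    proof -
      have "(1 / c) powr 3 * c powr 3 = 1" using that(3) by (subst powr_mult[symmetric]) auto
      then show ?thesis by (subst ennreal_mult[symmetric]) auto
    qed
    finally show ?thesis .
  qed
  have "modular (\<lambda>_. 3 / 2) (\<lambda>x. f x * g x) \<le> (\<integral>\<^sup>+x. ?c * (ennreal (1 / 2) * (?f x epowr 3 + ?g x epowr 3)) \<partial>lborel)"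
    unfolding modular_def
  proof (intro nn_integral_mono)
    fix x
    have "f x * g x = ennreal (\<omega> * \<epsilon>) * (?f x * ?g x)"
    proof -
      have "ennreal (\<omega> * \<epsilon>) * (?f x * ?g x) = ennreal \<omega> * (ennreal (1 / \<omega>) * f x) * (ennreal \<epsilon> * (ennreal (1 / \<epsilon>) * g x))"
        using pos by (simp add: ennreal_mult mult_ac)
      also have "\<dots> = f x * g x" using pos by (simp add: ennreal_mult_assoc)
      finally show ?thesis by simp
    qed
    then have "(f x * g x) epowr (3 / 2) = ?c * (?f x epowr (3 / 2) * ?g x epowr (3 / 2))"
      using pos by (simp only: epowr_mult epowr_ennreal[OF less_imp_le[OF mult_pos_pos[OF pos]]])
    also have "\<dots> \<le> ?c * (ennreal (1 / 2) * ((?f x epowr (3 / 2)) epowr 2 + (?g x epowr (3 / 2)) epowr 2))"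
      by (intro mult_left_mono half_sq) auto
    finally show "(f x * g x) epowr (3 / 2) \<le> ?c * (ennreal (1 / 2) * (?f x epowr 3 + ?g x epowr 3))"
      unfolding epowr_epowr by simp
  qed
  also have "\<dots> = ?c * (ennreal (1 / 2) * (modular (\<lambda>_. 3) ?f + modular (\<lambda>_. 3) ?g))"
    unfolding modular_def by (subst nn_integral_cmult, measurable, subst nn_integral_cmult, measurable, subst nn_integral_add, auto)
  also have "\<dots> \<le> ?c * (ennreal (1 / 2) * (1 + 1))"
    using f g pos by (intro mult_left_mono add_mono norm1) auto
  also have "ennreal (1 / 2) * (1 + 1) = 1"
    using ennreal_mult[of "1 / 2" 2] by simp
  finally show ?thesis by simp
qed

text \<open>Absolute continuity of the integral. The level depends on \<open>S\<close> itself and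
  not merely on its norm, and so will the length of the time slots.\<close>

lemma modular_tail_small:
  fixes S :: "'a::euclidean_space \<Rightarrow> ennreal"
  assumes [measurable]: "S \<in> borel_measurable borel" and fin: "modular (\<lambda>_. 3) S < top" and e: "0 < e"
  shows "\<exists>m::nat. modular (\<lambda>_. 3) (\<lambda>y. S y * indicator {y. ennreal (real m) < S y} y) \<le> ennreal e"
proof -
  have "AE y in lborel. S y epowr 3 \<noteq> \<infinity>"
    using fin by (intro nn_integral_PInf_AE) (auto simp: modular_def)
  then have S: "AE y in lborel. S y < top" by (auto simp: less_top)
  have "(\<lambda>m. \<integral>\<^sup>+y. (S y * indicator {y. ennreal (real m) < S y} y) epowr 3 \<partial>lborel) \<longlonglongrightarrow> (\<integral>\<^sup>+y. 0 \<partial>(lborel :: 'a measure))"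
  proof (rule nn_integral_dominated_convergence[where w="\<lambda>y. S y epowr 3"])
    show "AE y in lborel. (S y * indicator {y. ennreal (real m) < S y} y) epowr 3 \<le> S y epowr 3" for m
      by (intro AE_I2 epowr_mono) (auto simp: indicator_def)
    show "(\<integral>\<^sup>+y. S y epowr 3 \<partial>lborel) < \<infinity>" using fin by (simp add: modular_def)
    show "AE y in lborel. (\<lambda>m. (S y * indicator {y. ennreal (real m) < S y} y) epowr 3) \<longlonglongrightarrow> 0"
      using S
    proof eventually_elim
      case (elim y)
      then obtain s where s: "S y = ennreal s" "0 \<le> s" by (cases "S y") auto
      obtain N :: nat where N: "s \<le> real N" using real_arch_simple by blast
      have "\<forall>\<^sub>F m in sequentially. 0 = (S y * indicator {y. ennreal (real m) < S y} y) epowr 3"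
        using eventually_ge_at_top[of N]
      proof eventually_elim
        case (elim m)
        then have "\<not> ennreal (real m) < S y" using s N by (simp add: ennreal_less_iff)
        then show ?case by simp
      qed
      then show ?case by (rule tendsto_eventually[OF eventually_mono]) simp
    qed
  qed auto
  then have "(\<lambda>m. modular (\<lambda>_. 3) (\<lambda>y. S y * indicator {y. ennreal (real m) < S y} y)) \<longlonglongrightarrow> 0"
    by (simp add: modular_def)
  then have "\<forall>\<^sub>F m in sequentially. modular (\<lambda>_. 3) (\<lambda>y. S y * indicator {y. ennreal (real m) < S y} y) < ennreal e"
    using e by (intro order_tendstoD) auto
  then show ?thesis
    by (auto simp: eventually_sequentially intro: less_imp_le)
qed

text \<open>Hence, for almost every \<open>x\<close>, the Duhamel integrals of all fields dominated
  by \<open>S\<close> converge at all times simultaneously.\<close>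

lemma AE_riesz_square_finite:
  assumes [measurable]: "S \<in> borel_measurable borel" and fin: "modular (\<lambda>_. 3) S < top"
  shows "AE x in lborel. riesz (\<lambda>y. S y * S y) x < top"
proof -
  obtain A where A: "\<And>f \<nu>. f \<in> borel_measurable borel \<Longrightarrow> 0 < \<nu> \<Longrightarrow> modular (\<lambda>_. 3 / 2) f \<le> ennreal (\<nu> powr (3 / 2)) \<Longrightarrow>
     modular (\<lambda>_. 3) (riesz f) \<le> ennreal ((A * \<nu>) powr 3)"
    using modular_riesz_cube by metis
  have "modular (\<lambda>_. 3 / 2) (\<lambda>y. S y * S y) = modular (\<lambda>_. 3) S"
    by (simp add: modular_def epowr_epowr flip: epowr_2)
  moreover obtain c where c: "modular (\<lambda>_. 3) S = ennreal c" "0 \<le> c" using fin by (cases "modular (\<lambda>_. 3) S") auto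
  moreover have "c \<le> ((c + 1) powr (2 / 3)) powr (3 / 2)"
    using c(2) by (simp add: powr_powr)
  ultimately have "modular (\<lambda>_. 3) (riesz (\<lambda>y. S y * S y)) \<le> ennreal ((A * ((c + 1) powr (2 / 3))) powr 3)"
    by (intro A) (auto intro: ennreal_leI)
  then have "modular (\<lambda>_. 3) (riesz (\<lambda>y. S y * S y)) < top"
    by (rule order.strict_trans1) simp
  then have "AE x in lborel. riesz (\<lambda>y. S y * S y) x epowr 3 \<noteq> \<infinity>"
    by (intro nn_integral_PInf_AE) (auto simp: modular_def)
  then show ?thesis by (auto simp: less_top)
qed

context duhamel_kernel
begin

text \<open>A bound on a time slot of length \<open>\<delta>\<^sup>2\<close>: the part of the solutions above the level \<open>m\<close> enters through the Riesz potential, the part below it through the maximal function with a factor of order \<open>m \<delta>\<close>.\<close>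

definition slot_majorant :: "real \<Rightarrow> (real^3 \<Rightarrow> ennreal) \<Rightarrow> (real^3 \<Rightarrow> ennreal) \<Rightarrow> real^3 \<Rightarrow> ennreal" where
  "slot_majorant c S W x = ennreal (54 * K) * riesz (\<lambda>y. W y * S y) x + ennreal c * maximal W x"

lemma measurable_slot_majorant [measurable]:
  assumes [measurable]: "S \<in> borel_measurable borel" "W \<in> borel_measurable borel"
  shows "slot_majorant c S W \<in> borel_measurable borel"
  unfolding slot_majorant_def[abs_def] by measurable

text \<open>Before \<open>r\<close> the fields agree, so only the slot contributes. There the
  difference of the tensors is at most W (S1 + m): the part with S1 is integrated over time first,
  the bounded part over space first. The constant is 1728 = 27 * 64.\<close>

lemma norm_difference_le_slot_majorant:
  assumes [measurable]: "case_prod u \<in> borel_measurable borel" "case_prod v \<in> borel_measurable borel"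
    "S \<in> borel_measurable borel" "S1 \<in> borel_measurable borel" "W \<in> borel_measurable borel"
    and S: "\<And>s y. ennreal (norm (u s y)) + ennreal (norm (v s y)) \<le> S y"
    and S1: "\<And>y. S y \<le> S1 y + ennreal m" and m: "0 \<le> m"
    and before: "AE p in lborel. 0 \<le> fst p \<and> fst p < r \<and> fst p < t \<longrightarrow> u (fst p) (snd p) = v (fst p) (snd p)"
    and slot: "AE p in lborel. r \<le> fst p \<and> fst p < t \<longrightarrow> ennreal (norm (u (fst p) (snd p) - v (fst p) (snd p))) \<le> W (snd p)"
    and t: "r \<le> t" "t \<le> r + \<delta>\<^sup>2" and r: "0 \<le> r" and \<delta>: "0 \<le> \<delta>"
    and fin: "riesz (\<lambda>y. S y * S y) x < top"
  shows "ennreal (norm (duhamel k (\<lambda>s y. tensor (u s y) (u s y)) t x - duhamel k (\<lambda>s y. tensor (v s y) (v s y)) t x))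
     \<le> slot_majorant (1728 * unit_ball_vol 3 * K * m * \<delta>) S1 W x"
proof -
  have [measurable]: "(\<lambda>p. u (fst p) (snd p)) \<in> borel_measurable borel" "(\<lambda>p. v (fst p) (snd p)) \<in> borel_measurable borel"
    using assms(1,2) by (simp_all add: split_beta')
  have meas: "case_prod (\<lambda>s y. tensor (u s y) (u s y)) \<in> borel_measurable borel"
     "case_prod (\<lambda>s y. tensor (v s y) (v s y)) \<in> borel_measurable borel"
    by (simp_all add: split_beta')
  have uS: "ennreal (norm (u s y)) \<le> S y" and vS: "ennreal (norm (v s y)) \<le> S y" for s y
    using order_trans[OF add_increasing2 S[of s y]] order_trans[OF add_increasing S[of s y]] by auto
  have int: "integrable lborel (duhamel_integrand k (\<lambda>s y. tensor (u s y) (u s y)) t x)"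
      "integrable lborel (duhamel_integrand k (\<lambda>s y. tensor (v s y) (v s y)) t x)"
    using uS vS fin
    by (auto intro!: integrable_duhamel_integrand[where g="\<lambda>y. S y * S y"] meas AE_I2 mult_mono
        simp: norm_tensor ennreal_mult intro: order_trans)
  let ?M = "\<lambda>s y. tensor (u s y) (u s y) - tensor (v s y) (v s y)"
  have "ennreal (norm (duhamel k (\<lambda>s y. tensor (u s y) (u s y)) t x - duhamel k (\<lambda>s y. tensor (v s y) (v s y)) t x))
      \<le> (\<integral>\<^sup>+p. ennreal (norm (duhamel_integrand k ?M t x p)) \<partial>lborel)"
    unfolding duhamel_diff[OF int] by (rule norm_duhamel_le_nn_integral)
  also have "\<dots> \<le> (\<integral>\<^sup>+p. ennreal (27 * K) * (slot_kernel r t x p * (W (snd p) * S1 (snd p))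
      + ennreal m * (slot_kernel r t x p * W (snd p))) \<partial>lborel)"
  proof (rule nn_integral_mono_AE)
    show "AE p in lborel. ennreal (norm (duhamel_integrand k ?M t x p)) \<le> ennreal (27 * K) *
      (slot_kernel r t x p * (W (snd p) * S1 (snd p)) + ennreal m * (slot_kernel r t x p * W (snd p)))"
      using before slot
    proof eventually_elim
      case (elim p)
      let ?u = "u (fst p) (snd p)" and ?v = "v (fst p) (snd p)"
      consider "fst p < 0 \<or> t \<le> fst p" | "0 \<le> fst p" "fst p < t" "fst p < r" | "r \<le> fst p" "fst p < t" by linarith
      then show ?case
      proof cases
        case 1
        then show ?thesis by (auto simp: duhamel_integrand_def)
      next
        case 2
        then show ?thesis using elim(1) by (simp add: duhamel_integrand_def kernel_apply_def zero_vec_def[symmetric])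
      next
        case 3
        have "ennreal (norm (?M (fst p) (snd p))) \<le> ennreal (norm (?u - ?v)) * (ennreal (norm ?u) + ennreal (norm ?v))"
          using norm_tensor_diff_le[of ?u ?v] by (simp add: ennreal_leI flip: ennreal_mult ennreal_plus)
        also have "\<dots> \<le> W (snd p) * (S1 (snd p) + ennreal m)"
          using elim(2) 3 by (intro mult_mono order_trans[OF S S1]) auto
        finally have "ennreal (norm (?M (fst p) (snd p))) \<le> W (snd p) * (S1 (snd p) + ennreal m)" .
        then have "ennreal (27 * K) * (slot_kernel 0 t x p * ennreal (norm (?M (fst p) (snd p)))) \<le>
            ennreal (27 * K) * (slot_kernel 0 t x p * (W (snd p) * (S1 (snd p) + ennreal m)))"
          by (intro mult_left_mono) auto
        moreover have "slot_kernel 0 t x p = slot_kernel r t x p"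
          using 3 r by (simp add: slot_kernel_def)
        ultimately have "ennreal (norm (duhamel_integrand k ?M t x p)) \<le>
            ennreal (27 * K) * (slot_kernel r t x p * (W (snd p) * (S1 (snd p) + ennreal m)))"
          using norm_duhamel_integrand_le[of ?M t x p] by simp
        then show ?thesis by (simp add: distrib_left mult_ac)
      qed
    qed
  qed
  also have "\<dots> = ennreal (27 * K) * ((\<integral>\<^sup>+p. slot_kernel r t x p * (W (snd p) * S1 (snd p)) \<partial>lborel)
      + ennreal m * (\<integral>\<^sup>+p. slot_kernel r t x p * W (snd p) \<partial>lborel))"
    by (subst nn_integral_cmult, measurable, subst nn_integral_add, measurable, subst nn_integral_cmult, measurable)
  also have "\<dots> \<le> ennreal (27 * K) * (2 * riesz (\<lambda>y. W y * S1 y) x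
      + ennreal m * (ennreal (64 * unit_ball_vol 3 * \<delta>) * maximal W x))"
  proof (intro mult_left_mono add_mono)
    show "(\<integral>\<^sup>+p. slot_kernel r t x p * (W (snd p) * S1 (snd p)) \<partial>lborel) \<le> 2 * riesz (\<lambda>y. W y * S1 y) x"
      by (rule slot_kernel_riesz_le) measurable
    have "sqrt (t - r) \<le> \<delta>" using t \<delta> by (intro real_le_lsqrt) auto
    then have "ennreal (64 * unit_ball_vol 3 * sqrt (t - r)) * maximal W x \<le> ennreal (64 * unit_ball_vol 3 * \<delta>) * maximal W x"
      by (intro mult_right_mono ennreal_leI mult_left_mono) auto
    then show "(\<integral>\<^sup>+p. slot_kernel r t x p * W (snd p) \<partial>lborel) \<le> ennreal (64 * unit_ball_vol 3 * \<delta>) * maximal W x"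
      using slot_kernel_maximal_le[of W r t x] t by (auto intro: order_trans)
  qed auto
  also have "\<dots> = slot_majorant (1728 * unit_ball_vol 3 * K * m * \<delta>) S1 W x"
  proof -
    have "ennreal (27 * K) * (2 * R) = ennreal (54 * K) * R" for R
      using K ennreal_mult_assoc[of "27 * K" 2 R] by simp
    moreover have "ennreal (27 * K) * (ennreal m * (ennreal (64 * unit_ball_vol 3 * \<delta>) * R))
        = ennreal (1728 * unit_ball_vol 3 * K * m * \<delta>) * R" for R
      using K m \<delta> by (simp add: ennreal_mult_assoc) (simp add: mult_ac)
    ultimately show ?thesis by (simp add: slot_majorant_def distrib_left)
  qed
  finally show ?thesis .
qed

text \<open>The order of the choices matters: the level m makes the tail small against the constant
  of the Riesz potential, and only then is the slot made short, depending on m. The result is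
  uniform in \<open>W\<close>, so the map halves the L^3 bound of every \<open>W\<close>.\<close>

lemma slot_majorant_contraction:
  fixes S :: "real^3 \<Rightarrow> ennreal"
  assumes [measurable]: "S \<in> borel_measurable borel" and fin: "modular (\<lambda>_. 3) S < top"
  shows "\<exists>m \<delta>. 0 \<le> m \<and> 0 < \<delta> \<and> (\<forall>W\<in>borel_measurable borel. \<forall>\<omega>>0. modular (\<lambda>_. 3) W \<le> ennreal (\<omega> powr 3) \<longrightarrow>
     modular (\<lambda>_. 3) (slot_majorant (1728 * unit_ball_vol 3 * K * m * \<delta>) (\<lambda>y. S y * indicator {y. ennreal m < S y} y) W)
       \<le> ennreal ((\<omega> / 2) powr 3))"
proof -
  obtain A where A: "1 \<le> A" "\<And>f \<nu>. f \<in> borel_measurable borel \<Longrightarrow> 0 < \<nu> \<Longrightarrow> modular (\<lambda>_. 3 / 2) f \<le> ennreal (\<nu> powr (3 / 2)) \<Longrightarrow>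
     modular (\<lambda>_. 3) (riesz f) \<le> ennreal ((A * \<nu>) powr 3)"
    using modular_riesz_cube by metis
  obtain D where D: "0 < D" "\<And>f::real^3 \<Rightarrow> ennreal. f \<in> borel_measurable borel \<Longrightarrow>
      (\<integral>\<^sup>+x. maximal f x epowr 3 \<partial>lborel) \<le> ennreal D * (\<integral>\<^sup>+x. f x epowr 3 \<partial>lborel)"
    using maximal_strong_type[of 3, where 'a="real^3"] by auto
  \<comment> \<open>With this value the potential term has L^3 norm at most
    \<open>\<omega> / 8\<close>.\<close>
  define \<epsilon> where "\<epsilon> = 1 / (8 * (54 * K) * A)"
  have \<epsilon>: "0 < \<epsilon>" using K A(1) by (simp add: \<epsilon>_def)
  obtain m :: nat where m: "modular (\<lambda>_. 3) (\<lambda>y. S y * indicator {y. ennreal (real m) < S y} y) \<le> ennreal (\<epsilon> powr 3)"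
    using modular_tail_small[OF assms, of "\<epsilon> powr 3"] \<epsilon> by auto
  define b where "b = 1728 * unit_ball_vol 3 * K * real m"
  have b: "0 \<le> b" using K by (simp add: b_def)
  \<comment> \<open>Then \<open>b * \<delta>\<close> is at most 1 / (8 (D + 1)), which makes the
    maximal term at most \<open>\<omega> / 8\<close> as well; \<open>b + 1\<close> avoids a division
    by 0.\<close>
  define \<delta> where "\<delta> = 1 / (8 * (b + 1) * (D + 1))"
  have \<delta>: "0 < \<delta>" using b D(1) by (simp add: \<delta>_def)
  have cD: "(b * \<delta>) powr 3 * D \<le> (1 / 8) powr 3"
  proof -
    have "b * \<delta> \<le> 1 / 8 * (1 / (D + 1))"
    proof -
      have "b * \<delta> = b / (b + 1) * (1 / 8 * (1 / (D + 1)))" by (simp add: \<delta>_def algebra_simps)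
      also have "\<dots> \<le> 1 * (1 / 8 * (1 / (D + 1)))"
        using b D(1) by (intro mult_right_mono) auto
      finally show ?thesis by simp
    qed
    then have "(b * \<delta>) powr 3 \<le> (1 / 8 * (1 / (D + 1))) powr 3"
      using b \<delta> by (intro powr_mono2) auto
    also have "\<dots> = (1 / 8) powr 3 * (1 / (D + 1)) powr 3" by (rule powr_mult)
    finally have "(b * \<delta>) powr 3 * D \<le> (1 / 8) powr 3 * ((1 / (D + 1)) powr 3 * D)"
      using D(1) by (simp add: mult_right_mono flip: mult.assoc)
    also have "(1 / (D + 1)) powr 3 * D \<le> (1 / (D + 1)) powr 1 * D"
      using D(1) by (intro mult_right_mono powr_mono') auto
    also have "\<dots> \<le> 1" using D(1) by simp
    finally show ?thesis by (simp add: mult_left_mono)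
  qed
  define S1 where "S1 y = S y * indicator {y. ennreal (real m) < S y} y" for y
  have [measurable]: "S1 \<in> borel_measurable borel" unfolding S1_def[abs_def] by measurable
  have "modular (\<lambda>_. 3) (slot_majorant (b * \<delta>) S1 W) \<le> ennreal ((\<omega> / 2) powr 3)"
    if [measurable]: "W \<in> borel_measurable borel" and \<omega>: "0 < \<omega>" and W: "modular (\<lambda>_. 3) W \<le> ennreal (\<omega> powr 3)" for W \<omega>
  proof -
    have "modular (\<lambda>_. 3 / 2) (\<lambda>y. W y * S1 y) \<le> ennreal ((\<omega> * \<epsilon>) powr (3 / 2))"
      using W m \<omega> \<epsilon> by (intro modular_product_le) (auto simp: S1_def[abs_def])
    then have R: "modular (\<lambda>_. 3) (riesz (\<lambda>y. W y * S1 y)) \<le> ennreal ((A * (\<omega> * \<epsilon>)) powr 3)"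
      using \<omega> \<epsilon> by (intro A(2)) auto
    have M: "modular (\<lambda>_. 3) (maximal W) \<le> ennreal D * ennreal (\<omega> powr 3)"
    proof -
      have "modular (\<lambda>_. 3) (maximal W) \<le> ennreal D * modular (\<lambda>_. 3) W"
        unfolding modular_def by (intro D(2)) measurable
      also have "\<dots> \<le> ennreal D * ennreal (\<omega> powr 3)"
        by (intro mult_left_mono W) auto
      finally show ?thesis .
    qed
    have "modular (\<lambda>_. 3) (slot_majorant (b * \<delta>) S1 W) \<le>
        (\<integral>\<^sup>+x. ennreal (2 powr 3) * ((ennreal (54 * K) * riesz (\<lambda>y. W y * S1 y) x) epowr 3 + (ennreal (b * \<delta>) * maximal W x) epowr 3) \<partial>lborel)"
      unfolding modular_def slot_majorant_def by (intro nn_integral_mono epowr_add_le) simp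
    also have "\<dots> = ennreal (2 powr 3) * (modular (\<lambda>_. 3) (\<lambda>x. ennreal (54 * K) * riesz (\<lambda>y. W y * S1 y) x)
        + modular (\<lambda>_. 3) (\<lambda>x. ennreal (b * \<delta>) * maximal W x))"
      unfolding modular_def by (subst nn_integral_cmult, measurable, subst nn_integral_add, auto)
    also have "\<dots> = ennreal (2 powr 3) * (ennreal ((54 * K) powr 3) * modular (\<lambda>_. 3) (riesz (\<lambda>y. W y * S1 y))
        + ennreal ((b * \<delta>) powr 3) * modular (\<lambda>_. 3) (maximal W))"
      using K b \<delta> by (subst (1 2) modular_cmult_const) auto
    also have "\<dots> \<le> ennreal (2 powr 3) * (ennreal ((54 * K) powr 3) * ennreal ((A * (\<omega> * \<epsilon>)) powr 3)
        + ennreal ((b * \<delta>) powr 3) * (ennreal D * ennreal (\<omega> powr 3)))"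
      by (intro mult_left_mono add_mono R M) auto
    also have "\<dots> = ennreal (2 powr 3 * ((54 * K) powr 3 * (A * (\<omega> * \<epsilon>)) powr 3 + (b * \<delta>) powr 3 * (D * \<omega> powr 3)))"
      using D(1) by (simp add: ennreal_mult ennreal_plus)
    also have "\<dots> \<le> ennreal ((\<omega> / 2) powr 3)"
    proof (intro ennreal_leI)
      have "(54 * K) powr 3 * (A * (\<omega> * \<epsilon>)) powr 3 = (54 * K * (A * (\<omega> * \<epsilon>))) powr 3" by (rule powr_mult[symmetric])
      also have "54 * K * (A * (\<omega> * \<epsilon>)) = 1 / 8 * \<omega>" using K A(1) by (simp add: \<epsilon>_def)
      also have "(1 / 8 * \<omega>) powr 3 = (1 / 8) powr 3 * \<omega> powr 3" by (rule powr_mult)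
      finally have 1: "(54 * K) powr 3 * (A * (\<omega> * \<epsilon>)) powr 3 = (1 / 8) powr 3 * \<omega> powr 3" .
      have 2: "(b * \<delta>) powr 3 * (D * \<omega> powr 3) \<le> (1 / 8) powr 3 * \<omega> powr 3"
        using mult_right_mono[OF cD, of "\<omega> powr 3"] by (simp add: mult.assoc)
      have 3: "(\<omega> / 2) powr 3 = \<omega> powr 3 / 8"
        using powr_divide[of \<omega> 2 3] by (simp add: powr_numeral)
      have 4: "(1 / 8 :: real) powr 3 = 1 / 512" "(2 :: real) powr 3 = 8" by (simp_all add: powr_numeral power_divide)
      \<comment> \<open>Each of the two terms is at most 1/512 of the cube of
        \<open>\<omega>\<close>, and 8 * (2/512) = 1/32 lies below the required 1/8.\<close>
      show "2 powr 3 * ((54 * K) powr 3 * (A * (\<omega> * \<epsilon>)) powr 3 + (b * \<delta>) powr 3 * (D * \<omega> powr 3)) \<le> (\<omega> / 2) powr 3"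
        using 1 2 unfolding 3 4 by (simp) (smt (verit) powr_ge_zero)
    qed
    finally show ?thesis .
  qed
  then show ?thesis
    using \<delta> by (intro exI[of _ "real m"] exI[of _ \<delta>]) (auto simp: b_def S1_def[abs_def])
qed

text \<open>Induction over slots of fixed length. Within a slot the difference is bounded
  successively by \<open>S\<close>, by its image under the contracting map, and so on; these bounds
  are functions of x alone whose L^3 norms halve, so their infimum vanishes almost
  everywhere.\<close>

theorem duhamel_unique:
  fixes T :: ereal
  assumes [measurable]: "case_prod u \<in> borel_measurable borel" "case_prod v \<in> borel_measurable borel"
    "S \<in> borel_measurable borel"
    and fin: "modular (\<lambda>_. 3) S < top"
    and S: "\<And>s y. ennreal (norm (u s y)) + ennreal (norm (v s y)) \<le> S y"
    and u: "AE p in lborel. fst p \<in> time_interval T \<longrightarrow>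
      u (fst p) (snd p) = a (fst p) (snd p) + duhamel k (\<lambda>s y. tensor (u s y) (u s y)) (fst p) (snd p)"
    and v: "AE p in lborel. fst p \<in> time_interval T \<longrightarrow>
      v (fst p) (snd p) = a (fst p) (snd p) + duhamel k (\<lambda>s y. tensor (v s y) (v s y)) (fst p) (snd p)"
  shows "AE p in lborel. fst p \<in> time_interval T \<longrightarrow> u (fst p) (snd p) = v (fst p) (snd p)"
proof -
  have [measurable]: "(\<lambda>p. u (fst p) (snd p)) \<in> borel_measurable borel" "(\<lambda>p. v (fst p) (snd p)) \<in> borel_measurable borel"
    using assms(1,2) by (simp_all add: split_beta')
  obtain m \<delta> where m\<delta>: "0 \<le> m \<and> 0 < \<delta> \<and> (\<forall>W\<in>borel_measurable borel. \<forall>\<omega>>0. modular (\<lambda>_. 3) W \<le> ennreal (\<omega> powr 3) \<longrightarrow>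
     modular (\<lambda>_. 3) (slot_majorant (1728 * unit_ball_vol 3 * K * m * \<delta>) (\<lambda>y. S y * indicator {y. ennreal m < S y} y) W)
       \<le> ennreal ((\<omega> / 2) powr 3))"
    using slot_majorant_contraction[OF assms(3) fin] by blast
  then have m: "0 \<le> m" and \<delta>: "0 < \<delta>" by blast+
  have contr: "modular (\<lambda>_. 3) (slot_majorant (1728 * unit_ball_vol 3 * K * m * \<delta>) (\<lambda>y. S y * indicator {y. ennreal m < S y} y) W)
       \<le> ennreal ((\<omega> / 2) powr 3)"
    if "W \<in> borel_measurable borel" "0 < \<omega>" "modular (\<lambda>_. 3) W \<le> ennreal (\<omega> powr 3)" for W \<omega>
    using m\<delta> that by blast
  define S1 where "S1 y = S y * indicator {y. ennreal m < S y} y" for y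
  have [measurable]: "S1 \<in> borel_measurable borel" unfolding S1_def[abs_def] by measurable
  have S1: "S y \<le> S1 y + ennreal m" for y by (auto simp: S1_def indicator_def not_less)
  define \<Phi> where "\<Phi> = slot_majorant (1728 * unit_ball_vol 3 * K * m * \<delta>) S1"
  have [measurable]: "\<Phi> W \<in> borel_measurable borel" if [measurable]: "W \<in> borel_measurable borel" for W
    unfolding \<Phi>_def by measurable
  define W where "W n = (\<Phi> ^^ n) S" for n
  have W_Suc: "W 0 = S" "W (Suc n) = \<Phi> (W n)" for n by (auto simp: W_def)
  have W_meas [measurable]: "W n \<in> borel_measurable borel" for n
    by (induction n) (auto simp: W_Suc)
  obtain c where c: "modular (\<lambda>_. 3) S = ennreal c" "0 \<le> c" using fin by (cases "modular (\<lambda>_. 3) S") auto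
  \<comment> \<open>Using \<open>c + 1\<close> instead of \<open>c\<close> keeps the bound positive,
    as the contraction lemma asks.\<close>
  define \<omega> where "\<omega> = (c + 1) powr (1 / 3)"
  have \<omega>: "0 < \<omega>" "\<omega> powr 3 = c + 1" using c(2) by (auto simp: \<omega>_def powr_powr)
  have W_bound: "modular (\<lambda>_. 3) (W n) \<le> ennreal ((\<omega> / 2 ^ n) powr 3)" for n
  proof (induction n)
    case 0
    then show ?case using c \<omega> by (simp add: W_Suc ennreal_leI)
  next
    case (Suc n)
    have "modular (\<lambda>_. 3) (\<Phi> (W n)) \<le> ennreal ((\<omega> / 2 ^ n / 2) powr 3)"
      unfolding \<Phi>_def S1_def[abs_def] using \<omega>(1) Suc by (intro contr) auto
    then show ?case by (simp add: W_Suc mult.commute)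
  qed
  have W_inf: "AE y in lborel. (INF n. W n y) = 0"
  proof -
    have "modular (\<lambda>_. 3) (\<lambda>y. INF n. W n y) \<le> ennreal ((\<omega> / 2 ^ n) powr 3)" for n
      by (rule order_trans[OF modular_mono W_bound[of n]]) (auto intro: INF_lower)
    moreover have "(\<lambda>n. (\<omega> / 2 ^ n) powr 3) \<longlonglongrightarrow> 0"
    proof -
      have "(\<lambda>n. (\<omega> * (1 / 2) ^ n) ^ 3) \<longlonglongrightarrow> (\<omega> * 0) ^ 3"
        by (intro tendsto_intros LIMSEQ_realpow_zero) auto
      moreover have "(\<omega> / 2 ^ n) powr 3 = (\<omega> * (1 / 2) ^ n) ^ 3" for n
        using \<omega>(1) powr_numeral[of "\<omega> / 2 ^ n" "num.Bit1 num.One"] by (simp add: power_one_over)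
      ultimately show ?thesis by simp
    qed
    then have "(\<lambda>n. ennreal ((\<omega> / 2 ^ n) powr 3)) \<longlonglongrightarrow> ennreal 0"
      by (intro tendsto_ennrealI)
    ultimately have "modular (\<lambda>_. 3) (\<lambda>y. INF n. W n y) \<le> ennreal 0"
      by (intro LIMSEQ_le_const[of _ "ennreal 0"]) auto
    then have "(\<integral>\<^sup>+y. (INF n. W n y) epowr 3 \<partial>lborel) = 0" by (simp add: modular_def)
    then show ?thesis by (subst (asm) nn_integral_0_iff_AE) auto
  qed
  have rS: "AE p in (lborel :: (real \<times> (real^3)) measure). riesz (\<lambda>y. S y * S y) (snd p) < top"
    using AE_riesz_square_finite[OF assms(3) fin] by (rule AE_lborel_snd)
  have down: "0 \<le> s \<Longrightarrow> s < t \<Longrightarrow> t \<in> time_interval T \<Longrightarrow> s \<in> time_interval T" for s t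
    by (auto simp: time_interval_def intro: less_trans[of "ereal s" "ereal t"])
  have before: "AE p in lborel. fst p \<in> time_interval T \<and> fst p < real n * \<delta>\<^sup>2 \<longrightarrow> u (fst p) (snd p) = v (fst p) (snd p)" for n
  proof (induction n)
    case 0
    show ?case by (intro AE_I2) (auto simp: time_interval_def)
  next
    case (Suc n)
    note prev = Suc.IH
    let ?r = "real n * \<delta>\<^sup>2"
    have slot: "AE p in lborel. fst p \<in> time_interval T \<and> ?r \<le> fst p \<and> fst p < ?r + \<delta>\<^sup>2 \<longrightarrow>
        ennreal (norm (u (fst p) (snd p) - v (fst p) (snd p))) \<le> W j (snd p)" for j
    proof (induction j)
      case 0
      have "ennreal (norm (u s y - v s y)) \<le> S y" for s y
        using order_trans[OF ennreal_leI[OF norm_triangle_ineq4[of "u s y" "v s y"]]] S[of s y] by simp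
      then show ?case by (simp add: W_Suc)
    next
      case (Suc j)
      show ?case
        using u v rS
      proof eventually_elim
        case (elim p)
        show ?case
        proof (intro impI)
          assume p: "fst p \<in> time_interval T \<and> ?r \<le> fst p \<and> fst p < ?r + \<delta>\<^sup>2"
          have "ennreal (norm (duhamel k (\<lambda>s y. tensor (u s y) (u s y)) (fst p) (snd p) - duhamel k (\<lambda>s y. tensor (v s y) (v s y)) (fst p) (snd p)))
             \<le> \<Phi> (W j) (snd p)"
            unfolding \<Phi>_def
          proof (rule norm_difference_le_slot_majorant[where S=S and r="?r"])
            show "AE q in lborel. 0 \<le> fst q \<and> fst q < ?r \<and> fst q < fst p \<longrightarrow> u (fst q) (snd q) = v (fst q) (snd q)"
              using prev
            proof eventually_elim
              case (elim q)
              then show ?case using p down[of "fst q" "fst p"] by auto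
            qed
            show "AE q in lborel. ?r \<le> fst q \<and> fst q < fst p \<longrightarrow> ennreal (norm (u (fst q) (snd q) - v (fst q) (snd q))) \<le> W j (snd q)"
              using Suc.IH
            proof eventually_elim
              case (elim q)
              have "0 \<le> fst q" if "?r \<le> fst q"
                by (rule order_trans[OF _ that]) simp
              then show ?case using elim p down[of "fst q" "fst p"] by auto
            qed
          qed (use S S1 m p \<delta> elim in auto)
          then show "ennreal (norm (u (fst p) (snd p) - v (fst p) (snd p))) \<le> W (Suc j) (snd p)"
            using elim p by (simp add: W_Suc)
        qed
      qed
    qed
    \<comment> \<open>The exceptional sets of the countably many bounds are united, so that the
      infimum over j can be taken at a fixed point.\<close>
    have "AE p in lborel. \<forall>j. fst p \<in> time_interval T \<and> ?r \<le> fst p \<and> fst p < ?r + \<delta>\<^sup>2 \<longrightarrow>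
        ennreal (norm (u (fst p) (snd p) - v (fst p) (snd p))) \<le> W j (snd p)"
      using slot by (subst AE_all_countable) auto
    with prev AE_lborel_snd[OF W_inf] show ?case
    proof eventually_elim
      case (elim p)
      show ?case
      proof (intro impI)
        assume p: "fst p \<in> time_interval T \<and> fst p < real (Suc n) * \<delta>\<^sup>2"
        show "u (fst p) (snd p) = v (fst p) (snd p)"
        proof (cases "fst p < ?r")
          case False
          then have "ennreal (norm (u (fst p) (snd p) - v (fst p) (snd p))) \<le> W j (snd p)" for j
            using elim p by (simp add: distrib_right)
          then have "ennreal (norm (u (fst p) (snd p) - v (fst p) (snd p))) \<le> (INF n. W n (snd p))"
            by (intro INF_greatest)
          then show ?thesis using elim by simp
        qed (use elim p in auto)
      qed
    qed
  qed
  have "AE p in lborel. \<forall>n. fst p \<in> time_interval T \<and> fst p < real n * \<delta>\<^sup>2 \<longrightarrow> u (fst p) (snd p) = v (fst p) (snd p)"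
    using before by (subst AE_all_countable) auto
  then show ?thesis
  proof eventually_elim
    case (elim p)
    obtain n :: nat where "fst p < real n * \<delta>\<^sup>2" using reals_Archimedean3[of "\<delta>\<^sup>2"] \<delta> by auto
    then show ?case using elim by auto
  qed
qed

end

section \<open>From Lebesgue measurable fields to Borel fields\<close>

lemma lebesgue_measurable_AE_cong:
  fixes f g :: "'a::euclidean_space \<Rightarrow> 'b::topological_space"
  assumes f: "f \<in> borel_measurable lebesgue" and ae: "AE x in lebesgue. f x = g x"
  shows "g \<in> borel_measurable lebesgue"
proof (rule measurableI)
  fix A :: "'b set" assume A: "A \<in> sets borel"
  show "g -` A \<inter> space lebesgue \<in> sets lebesgue"
  proof (rule completion.in_sets_AE)
    show "AE x in lebesgue. x \<in> f -` A \<inter> space lebesgue \<longleftrightarrow> x \<in> g -` A \<inter> space lebesgue"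
      using ae by eventually_elim auto
    show "f -` A \<inter> space lebesgue \<in> sets lebesgue" using f A by (rule measurable_sets)
  qed simp
qed simp

text \<open>Measurability need not be assumed: by completeness it holds for both functions or for
  neither, and in the latter case both integrals have the default value 0.\<close>

lemma integral_lebesgue_cong_AE:
  fixes f g :: "'a::euclidean_space \<Rightarrow> 'b::euclidean_space"
  assumes ae: "AE x in lebesgue. f x = g x"
  shows "integral\<^sup>L lebesgue f = integral\<^sup>L lebesgue g"
proof (cases "f \<in> borel_measurable lebesgue")
  case True
  then show ?thesis
    using lebesgue_measurable_AE_cong[OF True ae] ae by (intro integral_cong_AE)
next
  case False
  have ae': "AE x in lebesgue. g x = f x" using ae by eventually_elim simp
  have "g \<notin> borel_measurable lebesgue"
    using False lebesgue_measurable_AE_cong[OF _ ae'] by blast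
  then have "\<not> integrable lebesgue f" "\<not> integrable lebesgue g"
    using False borel_measurable_integrable by blast+
  then show ?thesis by (simp add: not_integrable_integral_eq)
qed

lemma lebesgue_borel_version:
  fixes f :: "'a::euclidean_space \<Rightarrow> 'b::euclidean_space"
  assumes f: "f \<in> borel_measurable lebesgue"
  shows "\<exists>g\<in>borel_measurable borel. AE x in lborel. f x = g x"
proof -
  have "\<exists>g\<in>borel_measurable lborel. AE x in lborel. f x \<bullet> b = g x" for b
  proof (rule completion_ex_borel_measurable_real)
    have "(\<lambda>v. v \<bullet> b) \<in> borel_measurable borel" by measurable
    from measurable_compose[OF f this] show "(\<lambda>x. f x \<bullet> b) \<in> borel_measurable lebesgue" .
  qed
  then obtain g where g: "\<And>b. g b \<in> borel_measurable lborel" "\<And>b. AE x in lborel. f x \<bullet> b = g b x"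
    by metis
  have [measurable]: "g b \<in> borel_measurable borel" for b using g(1)[of b] by simp
  have "AE x in lborel. \<forall>b\<in>Basis. f x \<bullet> b = g b x"
    using g(2) by (intro AE_finite_allI) auto
  then have "AE x in lborel. f x = (\<Sum>b\<in>Basis. g b x *\<^sub>R b)"
  proof eventually_elim
    case (elim x)
    then show ?case
      by (subst euclidean_representation[of "f x", symmetric]) (rule sum.cong; simp)
  qed
  then show ?thesis
    by (intro bexI[of _ "\<lambda>x. \<Sum>b\<in>Basis. g b x *\<^sub>R b"]) auto
qed

lemma sets_lborel_pair:
  "sets (lborel \<Otimes>\<^sub>M lborel) = sets (borel :: ('a::euclidean_space \<times> 'b::euclidean_space) measure)"
  unfolding lborel_prod by (rule sets_lborel)

lemma AE_lborel_pair_fst: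
  assumes "AE p in (lborel :: ('a::euclidean_space \<times> 'b::euclidean_space) measure). P p"
  shows "AE s in lborel. AE y in lborel. P (s, y)"
  using assms unfolding lborel_prod[symmetric] by (rule lborel_pair.AE_pair)

text \<open>Exchanging the two quantifiers requires a measurable set, hence the passage to a Borel
  null set containing the exceptional points.\<close>

lemma AE_lborel_pair_snd:
  assumes "AE p in (lborel :: ('a::euclidean_space \<times> 'b::euclidean_space) measure). P p"
  shows "AE y in lborel. AE s in lborel. P (s, y)"
proof -
  obtain N where N: "{p. \<not> P p} \<subseteq> N" "N \<in> sets borel" "emeasure lborel N = 0"
    using assms by (auto elim!: AE_E)
  then have "AE p in lborel. p \<notin> N" by (intro AE_not_in) (auto simp: null_sets_def)
  then have "AE s in lborel. AE y in lborel. (s, y) \<notin> N" by (rule AE_lborel_pair_fst)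
  moreover have "{x \<in> space (lborel \<Otimes>\<^sub>M lborel). (fst x, snd x) \<notin> N} \<in> sets (lborel \<Otimes>\<^sub>M lborel)"
    unfolding sets_lborel_pair using N(2) by (simp add: space_pair_measure Collect_neg_eq)
  ultimately have "AE y in lborel. AE s in lborel. (s, y) \<notin> N"
    using lborel_pair.AE_commute[of "\<lambda>s y. (s, y) \<notin> N"] by simp
  then show ?thesis
    by eventually_elim (use N(1) in \<open>auto elim!: eventually_mono\<close>)
qed

lemma AE_lborel_pairI_snd:
  fixes P :: "'a::euclidean_space \<times> 'b::euclidean_space \<Rightarrow> bool"
  assumes "{p. P p} \<in> sets borel" "AE y in lborel. AE s in lborel. P (s, y)"
  shows "AE p in lborel. P p"
proof -
  have 1: "{x \<in> space (lborel \<Otimes>\<^sub>M lborel). P (fst x, snd x)} \<in> sets (lborel \<Otimes>\<^sub>M lborel)"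
    unfolding sets_lborel_pair using assms(1) by (simp add: space_pair_measure)
  have "AE s in lborel. AE y in lborel. P (s, y)"
    using lborel_pair.AE_commute[OF 1] assms(2) by simp
  then have "AE p in lborel \<Otimes>\<^sub>M lborel. P p"
    using 1 by (intro lborel_pair.AE_pair_measure) auto
  then show ?thesis unfolding lborel_prod .
qed

lemma time_interval_borel [measurable]: "time_interval T \<in> sets borel"
proof -
  have "time_interval T = {t. 0 \<le> t} \<inter> {t. ereal t < T}" by (auto simp: time_interval_def)
  then show ?thesis by simp
qed

lemma space_time_AE_iff:
  "(AE p in (space_time T :: (real \<times> 'a::euclidean_space) measure). P p) \<longleftrightarrow> (AE p in lborel. fst p \<in> time_interval T \<longrightarrow> P p)"
proof -
  have "time_interval T \<times> (UNIV :: 'a set) \<in> sets lborel"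
    using time_interval_borel[of T] by (simp add: borel_Times)
  then have "time_interval T \<times> (UNIV :: 'a set) \<in> sets lebesgue" by (rule sets_completionI_sets)
  then show ?thesis
    by (subst AE_restrict_space_iff) (auto simp: AE_completion_iff mem_Times_iff)
qed

lemma time_AE_iff:
  "(AE t in lebesgue_on (time_interval T). P t) \<longleftrightarrow> (AE t in lborel. t \<in> time_interval T \<longrightarrow> P t)"
  by (subst AE_restrict_space_iff) (auto simp: AE_completion_iff intro: sets_completionI_sets)

text \<open>The Duhamel estimates need a Borel field that is dominated at every point by a function
  of x alone. Extension by 0 in time, a Borel version and a cut-off achieve this without changing
  the field outside a null set.\<close>

lemma time_regularization:
  fixes g :: "real \<Rightarrow> 'a::euclidean_space \<Rightarrow> 'b::euclidean_space"
  assumes g: "g \<in> mixed_time_space p q T"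
  shows "\<exists>h \<Phi>. case_prod h \<in> borel_measurable borel \<and> \<Phi> \<in> borel_measurable borel \<and> (\<forall>x. 0 \<le> \<Phi> x) \<and>
    (\<forall>t x. norm (h t x) \<le> \<Phi> x) \<and>
    (AE p in lborel. fst p \<in> time_interval T \<longrightarrow> g (fst p) (snd p) = h (fst p) (snd p)) \<and>
    (AE x in lborel. norm (real_of_ereal (time_sup_norm T g x)) = \<Phi> x)"
proof -
  let ?I = "time_interval T"
  let ?S = "?I \<times> (UNIV :: 'a set)"
  have S: "?S \<in> sets lebesgue"
    using time_interval_borel[of T] by (intro sets_completionI_sets) (simp add: borel_Times)
  have g1: "(\<lambda>(t, x). g t x) \<in> borel_measurable (lebesgue_on ?S)"
    and g2: "AE x in lebesgue. time_sup_norm T g x < \<infinity>"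
    and g3: "(\<lambda>x. real_of_ereal (time_sup_norm T g x)) \<in> borel_measurable lebesgue"
    using g by (auto simp: mixed_time_space_def mixed_space_def)
  define g0 where "g0 p = (if p \<in> ?S then (\<lambda>(t, x). g t x) p else 0)" for p
  have "g0 \<in> borel_measurable lebesgue"
    unfolding g0_def[abs_def] by (subst borel_measurable_if[OF S]) (rule g1)
  then obtain h0 where h0 [measurable]: "h0 \<in> borel_measurable borel" and h0_eq: "AE p in lborel. g0 p = h0 p"
    using lebesgue_borel_version by blast
  obtain \<Phi>0 where [measurable]: "\<Phi>0 \<in> borel_measurable borel"
    and \<Phi>0: "AE x in lborel. real_of_ereal (time_sup_norm T g x) = \<Phi>0 x"
    using lebesgue_borel_version[OF g3] by blast
  define \<Phi> where "\<Phi> x = \<bar>\<Phi>0 x\<bar>" for x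
  have [measurable]: "\<Phi> \<in> borel_measurable borel" unfolding \<Phi>_def[abs_def] by measurable
  have fin: "AE x in lborel. time_sup_norm T g x < \<infinity>" using g2 by (simp add: AE_completion_iff)
  have "AE x in lborel. AE t in lborel. norm (h0 (t, x)) \<le> \<Phi> x"
    using AE_lborel_pair_snd[OF h0_eq] fin \<Phi>0
  proof eventually_elim
    case (elim x)
    have "AE t in lebesgue_on ?I. ereal (norm (g t x)) \<le> time_sup_norm T g x"
      unfolding time_sup_norm_def by (rule esssup_AE)
    then have "AE t in lborel. t \<in> ?I \<longrightarrow> ereal (norm (g t x)) \<le> time_sup_norm T g x"
      by (simp add: time_AE_iff)
    with elim(1) show ?case
    proof eventually_elim
      fix t assume t: "g0 (t, x) = h0 (t, x)" "t \<in> ?I \<longrightarrow> ereal (norm (g t x)) \<le> time_sup_norm T g x"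
      show "norm (h0 (t, x)) \<le> \<Phi> x"
      proof (cases "t \<in> ?I")
        case True
        then have le: "ereal (norm (g t x)) \<le> time_sup_norm T g x" using t by simp
        then obtain r where r: "time_sup_norm T g x = ereal r"
          using elim(2) by (cases "time_sup_norm T g x") auto
        then have "norm (g t x) \<le> \<bar>r\<bar>" using le by simp
        then show ?thesis using t(1) True elim(3) r by (simp add: g0_def \<Phi>_def)
      next
        case False
        then show ?thesis using t(1) by (simp add: g0_def \<Phi>_def flip: t(1))
      qed
    qed
  qed
  then have bound: "AE p in lborel. norm (h0 p) \<le> \<Phi> (snd p)"
    by (intro AE_lborel_pairI_snd) auto
  \<comment> \<open>By \<open>bound\<close> the cut-off acts only on a null set, but it makes the
    domination by \<open>\<Phi>\<close> hold everywhere.\<close>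
  define h where "h t x = (if norm (h0 (t, x)) \<le> \<Phi> x then h0 (t, x) else 0)" for t x
  have "(\<lambda>p. if norm (h0 p) \<le> \<Phi> (snd p) then h0 p else 0) \<in> borel_measurable borel" by measurable
  then have 1: "case_prod h \<in> borel_measurable borel" by (simp add: h_def split_beta')
  have 2: "norm (h t x) \<le> \<Phi> x" "0 \<le> \<Phi> x" for t x by (auto simp: h_def \<Phi>_def)
  have 3: "AE p in lborel. fst p \<in> ?I \<longrightarrow> g (fst p) (snd p) = h (fst p) (snd p)"
    using h0_eq bound by eventually_elim (auto simp: g0_def h_def split_beta mem_Times_iff)
  have 4: "AE x in lborel. norm (real_of_ereal (time_sup_norm T g x)) = \<Phi> x"
    using \<Phi>0 by eventually_elim (simp add: \<Phi>_def)
  show ?thesis using 1 2 3 4 by (intro exI[of _ h] exI[of _ \<Phi>]) auto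
qed

section \<open>Luxemburg and Lebesgue norms in terms of modulars\<close>

lemma luxemburg_modular_eq:
  assumes "AE x in lborel. norm (f x) = \<Phi> x" "0 < l"
  shows "(\<integral>\<^sup>+x. ennreal (norm (f x /\<^sub>R l) powr p x) \<partial>lebesgue) = modular p (\<lambda>x. ennreal (1 / l) * ennreal (\<Phi> x))"
  unfolding nn_integral_completion modular_def
proof (rule nn_integral_cong_AE)
  show "AE x in lborel. ennreal (norm (f x /\<^sub>R l) powr p x) = (ennreal (1 / l) * ennreal (\<Phi> x)) epowr p x"
    using assms(1)
  proof eventually_elim
    case (elim x)
    have "ennreal (1 / l) * ennreal (\<Phi> x) = ennreal (norm (f x /\<^sub>R l))"
      using assms(2) by (simp add: elim[symmetric] divide_inverse mult.commute flip: ennreal_mult)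
    then show ?case by (simp only: epowr_ennreal[OF norm_ge_zero])
  qed
qed

text \<open>The strict inequality supplies an admissible scaling below \<open>\<mu>\<close> without
  knowing that the infimum is attained.\<close>

lemma small_of_luxemburg_norm:
  assumes f: "AE x in lborel. norm (f x) = \<Phi> x" and le: "luxemburg_norm p f < ennreal \<mu>" and p: "\<And>x. 0 \<le> p x"
  shows "small p \<mu> (\<lambda>x. ennreal (\<Phi> x))"
proof -
  obtain l where l: "0 < l" "(\<integral>\<^sup>+x. ennreal (norm (f x /\<^sub>R l) powr p x) \<partial>lebesgue) \<le> 1" "ennreal l < ennreal \<mu>"
    using le unfolding luxemburg_norm_def INF_less_iff by auto
  then have "small p l (\<lambda>x. ennreal (\<Phi> x))"
    using luxemburg_modular_eq[OF f l(1)] by (simp add: small_def)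
  then show ?thesis
    using l p by (rule_tac small_mono) (auto simp: ennreal_less_iff)
qed

lemma luxemburg_norm_finite:
  assumes f: "AE x in lborel. norm (f x) = \<Phi> x" and s: "small p \<mu> (\<lambda>x. ennreal (\<Phi> x))" and \<mu>: "0 < \<mu>"
  shows "luxemburg_norm p f < \<infinity>"
proof -
  have "luxemburg_norm p f \<le> ennreal \<mu>"
    unfolding luxemburg_norm_def
    using luxemburg_modular_eq[OF f \<mu>, of p] s \<mu> by (intro INF_lower) (simp add: small_def)
  then show ?thesis by (rule order.strict_trans1) simp
qed

lemma Lq_integral_eq:
  assumes "AE x in lborel. norm (f x) = \<Phi> x"
  shows "(\<integral>\<^sup>+x. ennreal (norm (f x) powr q) \<partial>lebesgue) = modular (\<lambda>_. q) (\<lambda>x. ennreal (\<Phi> x))"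
  unfolding nn_integral_completion modular_def
proof (rule nn_integral_cong_AE)
  show "AE x in lborel. ennreal (norm (f x) powr q) = ennreal (\<Phi> x) epowr q"
    using assms by eventually_elim (simp add: epowr_ennreal flip: epowr_ennreal, metis epowr_ennreal norm_ge_zero)
qed

lemma small_const_iff:
  assumes [measurable]: "f \<in> borel_measurable borel" and \<mu>: "0 < \<mu>"
  shows "small (\<lambda>_. q) \<mu> f \<longleftrightarrow> modular (\<lambda>_. q) f \<le> ennreal (\<mu> powr q)"
proof -
  have e: "modular (\<lambda>_. q) (\<lambda>x. ennreal (1 / \<mu>) * f x) = ennreal ((1 / \<mu>) powr q) * modular (\<lambda>_. q) f"
    using \<mu> by (intro modular_cmult_const) auto
  have c: "\<mu> powr q * (1 / \<mu>) powr q = 1" "(1 / \<mu>) powr q * \<mu> powr q = 1"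
    using \<mu> by (simp_all flip: powr_mult)
  show ?thesis
    unfolding small_def e
  proof
    assume "ennreal ((1 / \<mu>) powr q) * modular (\<lambda>_. q) f \<le> 1"
    then have "ennreal (\<mu> powr q) * (ennreal ((1 / \<mu>) powr q) * modular (\<lambda>_. q) f) \<le> ennreal (\<mu> powr q) * 1"
      by (rule mult_left_mono) simp
    then show "modular (\<lambda>_. q) f \<le> ennreal (\<mu> powr q)" by (simp add: ennreal_mult_assoc c)
  next
    assume "modular (\<lambda>_. q) f \<le> ennreal (\<mu> powr q)"
    then have "ennreal ((1 / \<mu>) powr q) * modular (\<lambda>_. q) f \<le> ennreal ((1 / \<mu>) powr q) * ennreal (\<mu> powr q)"
      by (rule mult_left_mono) simp
    then show "ennreal ((1 / \<mu>) powr q) * modular (\<lambda>_. q) f \<le> 1" by (simp add: c flip: ennreal_mult)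
  qed
qed

lemma small_of_Lq_norm:
  assumes f: "AE x in lborel. norm (f x) = \<Phi> x" and [measurable]: "\<Phi> \<in> borel_measurable borel"
    and le: "Lq_norm q f < ennreal \<mu>" and q: "0 < q" and \<mu>: "0 < \<mu>"
  shows "small (\<lambda>_. q) \<mu> (\<lambda>x. ennreal (\<Phi> x))"
proof -
  define N where "N = modular (\<lambda>_. q) (\<lambda>x. ennreal (\<Phi> x))"
  have le': "(if N = \<infinity> then \<infinity> else ennreal (enn2real N powr (1 / q))) < ennreal \<mu>"
    using le unfolding Lq_norm_def Let_def Lq_integral_eq[OF f] N_def .
  then have N: "N < top" by (auto simp: less_top split: if_splits)
  then have "enn2real N powr (1 / q) < \<mu>" using le' by (simp add: ennreal_less_iff less_top[symmetric])
  then have "(enn2real N powr (1 / q)) powr q \<le> \<mu> powr q"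
    using q by (intro powr_mono2) auto
  then have "enn2real N \<le> \<mu> powr q" using q by (simp add: powr_powr)
  then have "ennreal (enn2real N) \<le> ennreal (\<mu> powr q)" by (rule ennreal_leI)
  then have "N \<le> ennreal (\<mu> powr q)" using N by simp
  then show ?thesis
    using \<mu> by (subst small_const_iff) (auto simp: N_def)
qed

lemma Lq_norm_finite:
  assumes f: "AE x in lborel. norm (f x) = \<Phi> x" and [measurable]: "\<Phi> \<in> borel_measurable borel"
    and s: "small (\<lambda>_. q) \<mu> (\<lambda>x. ennreal (\<Phi> x))" and \<mu>: "0 < \<mu>"
  shows "Lq_norm q f < \<infinity>"
proof -
  have "modular (\<lambda>_. q) (\<lambda>x. ennreal (\<Phi> x)) \<le> ennreal (\<mu> powr q)"
    using s \<mu> by (simp add: small_const_iff)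
  then have "modular (\<lambda>_. q) (\<lambda>x. ennreal (\<Phi> x)) \<noteq> \<infinity>" by (auto simp: top_unique)
  then show ?thesis by (simp add: Lq_norm_def Let_def Lq_integral_eq[OF f])
qed

lemma modular_finite_of_Lq_norm:
  assumes f: "AE x in lborel. norm (f x) = \<Phi> x" and "Lq_norm q f < \<infinity>"
  shows "modular (\<lambda>_. q) (\<lambda>x. ennreal (\<Phi> x)) < top"
  using assms(2) by (auto simp: Lq_norm_def Let_def Lq_integral_eq[OF f] less_top split: if_splits)

context duhamel_kernel
begin

lemma time_integral_kernel_conv:
  assumes op: "\<And>s N. 0 < s \<Longrightarrow> op s N x = - kernel_conv k s N x"
    and [measurable]: "case_prod M' \<in> borel_measurable borel" "g \<in> borel_measurable borel"
    and M: "AE p in lborel. 0 \<le> fst p \<and> fst p < t \<longrightarrow> M (fst p) (snd p) = M' (fst p) (snd p)"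
    and M': "\<And>s y. ennreal (norm (M' s y)) \<le> g y"
    and fin: "riesz g x < top"
  shows "(LINT s:{0..t}|lebesgue. op (t - s) (M s) x) = - duhamel k M' t x"
proof -
  have [measurable]: "(\<lambda>p. M' (fst p) (snd p)) \<in> borel_measurable borel"
    using assms(2) by (simp add: split_beta')
  have int: "integrable lborel (duhamel_integrand k M' t x)"
    using M' fin by (intro integrable_duhamel_integrand[where g=g]) auto
  have meas: "duhamel_integrand k M' t x \<in> borel_measurable (lborel \<Otimes>\<^sub>M lborel)"
    by (simp add: lborel_prod)
  have int': "integrable (lborel \<Otimes>\<^sub>M lborel) (duhamel_integrand k M' t x)"
    using int by (simp add: lborel_prod)
  have "AE s in lebesgue. indicator {0..t} s *\<^sub>R op (t - s) (M s) x = - (LINT y|lborel. duhamel_integrand k M' t x (s, y))"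
    unfolding AE_completion_iff
    using AE_lborel_pair_fst[OF M] lborel_pair.AE_integrable_fst'[OF int'] AE_lborel_singleton[of t]
  proof eventually_elim
    case (elim s)
    show ?case
    proof (cases "0 \<le> s \<and> s < t")
      case False
      then show ?thesis using elim(3) by (auto simp: indicator_def duhamel_integrand_def)
    next
      case s: True
      have "kernel_conv k (t - s) (M s) x $ i = (LINT y|lborel. duhamel_integrand k M' t x (s, y)) $ i" for i
      proof -
        have "kernel_conv k (t - s) (M s) x $ i = (LINT y|lebesgue. (\<Sum>j\<in>UNIV. \<Sum>l\<in>UNIV. M s y $ j $ l * k i j l (t - s) (y - x)))"
          by (simp add: kernel_conv_def)
        also have "\<dots> = (LINT y|lebesgue. duhamel_integrand k M' t x (s, y) $ i)"
        proof (rule integral_lebesgue_cong_AE)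
          show "AE y in lebesgue. (\<Sum>j\<in>UNIV. \<Sum>l\<in>UNIV. M s y $ j $ l * k i j l (t - s) (y - x)) = duhamel_integrand k M' t x (s, y) $ i"
            unfolding AE_completion_iff using elim(1)
            by eventually_elim (use s in \<open>simp add: duhamel_integrand_def kernel_apply_def\<close>)
        qed
        also have "\<dots> = (LINT y|lborel. duhamel_integrand k M' t x (s, y) $ i)"
          using elim(2) by (intro integral_completion) (auto dest: borel_measurable_integrable)
        also have "\<dots> = (LINT y|lborel. duhamel_integrand k M' t x (s, y)) $ i"
          using elim(2) by (rule integral_bounded_linear[OF bounded_linear_vec_nth])
        finally show ?thesis .
      qed
      then have "kernel_conv k (t - s) (M s) x = (LINT y|lborel. duhamel_integrand k M' t x (s, y))"
        by (simp add: vec_eq_iff)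
      then show ?thesis using s op[of "t - s" "M s"] by simp
    qed
  qed
  then have "(LINT s:{0..t}|lebesgue. op (t - s) (M s) x) = (LINT s|lebesgue. - (LINT y|lborel. duhamel_integrand k M' t x (s, y)))"
    unfolding set_lebesgue_integral_def by (rule integral_lebesgue_cong_AE)
  also have "\<dots> = (LINT s|lborel. - (LINT y|lborel. duhamel_integrand k M' t x (s, y)))"
  proof (rule integral_completion)
    have "(\<lambda>s. LINT y|lborel. duhamel_integrand k M' t x (s, y)) \<in> borel_measurable lborel"
      using meas by (intro lborel.borel_measurable_lebesgue_integral) (simp add: split_beta')
    then show "(\<lambda>s. - (LINT y|lborel. duhamel_integrand k M' t x (s, y))) \<in> borel_measurable lborel"
      by measurable
  qed
  also have "\<dots> = - (LINT s|lborel. LINT y|lborel. duhamel_integrand k M' t x (s, y))"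
    by simp
  also have "(LINT s|lborel. LINT y|lborel. duhamel_integrand k M' t x (s, y)) = duhamel k M' t x"
    using lborel_pair.integral_fst'[OF int'] by (simp add: duhamel_def lborel_prod)
  finally show ?thesis .
qed

end

section \<open>The essential supremum in time\<close>

lemma time_sup_norm_le:
  fixes u :: "real \<Rightarrow> 'a::euclidean_space \<Rightarrow> 'b::euclidean_space"
  assumes [measurable]: "case_prod u \<in> borel_measurable borel"
  shows "time_sup_norm T u x \<le> z \<longleftrightarrow> (AE t in lborel. t \<in> time_interval T \<longrightarrow> ereal (norm (u t x)) \<le> z)"
proof -
  have "(\<lambda>t. (t, x)) \<in> borel_measurable borel" by (intro borel_measurable_continuous_onI continuous_intros)
  from measurable_compose[OF this assms] have [measurable]: "(\<lambda>t. u t x) \<in> borel_measurable borel" by simp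
  have m: "(\<lambda>t. ereal (norm (u t x))) \<in> borel_measurable (lebesgue_on (time_interval T))"
    by (intro measurable_restrict_space1 measurable_completion) measurable
  show ?thesis
    unfolding time_sup_norm_def time_AE_iff[symmetric]
    using m esssup_AE[where M="lebesgue_on (time_interval T)" and f="\<lambda>t. ereal (norm (u t x))"]
    by (auto intro!: esssup_I elim!: eventually_mono intro: order_trans)
qed

text \<open>A sublevel set consists of the points over which the section of a Borel set has measure
  0, and the measure of sections is measurable by Tonelli's theorem.\<close>

lemma borel_measurable_time_sup_norm:
  fixes u :: "real \<Rightarrow> 'a::euclidean_space \<Rightarrow> 'b::euclidean_space"
  assumes [measurable]: "case_prod u \<in> borel_measurable borel"
  shows "time_sup_norm T u \<in> borel_measurable borel"
  unfolding borel_measurable_iff_Iic_ereal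
proof
  fix z
  have [measurable]: "(\<lambda>p. u (fst p) (snd p)) \<in> borel_measurable borel"
    using assms by (simp add: split_beta')
  have [measurable]: "(\<lambda>t. u t x) \<in> borel_measurable borel" for x
  proof -
    have "(\<lambda>t. (t, x)) \<in> borel_measurable borel" by (intro borel_measurable_continuous_onI continuous_intros)
    from measurable_compose[OF this assms] show ?thesis by simp
  qed
  have [measurable]: "(\<lambda>q. u (snd q) (fst q)) \<in> borel_measurable borel"
  proof -
    have "(\<lambda>q::'a \<times> real. (snd q, fst q)) \<in> borel_measurable borel"
      by (intro borel_measurable_continuous_onI continuous_intros)
    from measurable_compose[OF this assms] show ?thesis by simp
  qed
  define B where "B = {q. snd q \<in> time_interval T \<and> z < ereal (norm (u (snd q) (fst q)))}"
  have [measurable]: "B \<in> sets borel" unfolding B_def by measurable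
  have "(\<lambda>x. \<integral>\<^sup>+t. indicator B (x, t) \<partial>(lborel :: real measure)) \<in> borel_measurable borel"
  proof (rule lborel.borel_measurable_nn_integral)
    have "sets (borel \<Otimes>\<^sub>M lborel) = sets (borel :: ('a \<times> real) measure)"
      unfolding borel_prod[symmetric] by (intro sets_pair_measure_cong) auto
    then have "B \<in> sets (borel \<Otimes>\<^sub>M lborel)" by simp
    then show "(\<lambda>(x, t). indicator B (x, t)) \<in> borel_measurable (borel \<Otimes>\<^sub>M lborel)"
      by simp
  qed
  then have "{x. (\<integral>\<^sup>+t. indicator B (x, t) \<partial>(lborel :: real measure)) = 0} \<in> sets borel" by measurable
  moreover have "time_sup_norm T u x \<le> z \<longleftrightarrow> (\<integral>\<^sup>+t. indicator B (x, t) \<partial>(lborel :: real measure)) = 0" for x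
  proof -
    have "(\<lambda>t. indicator B (x, t) :: ennreal) \<in> borel_measurable lborel"
      unfolding B_def by measurable
    then show ?thesis
      by (subst nn_integral_0_iff_AE) (auto simp: time_sup_norm_le[OF assms] B_def indicator_def not_less intro!: arg_cong2[where f=eventually])
  qed
  ultimately show "time_sup_norm T u -` {..z} \<inter> space borel \<in> sets borel"
    by (simp add: vimage_def)
qed

text \<open>Positivity of T matters: over a time interval of measure 0 the essential supremum would
  be minus infinity.\<close>

lemma time_sup_norm_nonneg:
  fixes u :: "real \<Rightarrow> 'a::euclidean_space \<Rightarrow> 'b::euclidean_space"
  assumes u: "case_prod u \<in> borel_measurable borel" and T: "0 < T"
  shows "0 \<le> time_sup_norm T u x"
proof (rule ccontr)
  assume neg: "\<not> 0 \<le> time_sup_norm T u x"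
  have "AE t in lborel. t \<in> time_interval T \<longrightarrow> ereal (norm (u t x)) \<le> time_sup_norm T u x"
    using time_sup_norm_le[OF u, of T x "time_sup_norm T u x"] by simp
  then have ae: "AE t in lborel. t \<notin> time_interval T"
  proof eventually_elim
    case (elim t)
    have "0 \<le> ereal (norm (u t x))" by simp
    then show ?case using elim neg order_trans[of 0 "ereal (norm (u t x))" "time_sup_norm T u x"] by blast
  qed
  obtain c where c: "0 < c" "ereal c < T"
    using ereal_dense2[OF T] by (auto simp: zero_ereal_def)
  have "AE t in lborel. t \<notin> {0..c}"
    using ae
  proof eventually_elim
    case (elim t)
    then show ?case
      using c order.strict_trans1[of "ereal t" "ereal c" T] by (auto simp: time_interval_def)
  qed
  then have "emeasure lborel {0..c} = 0"
    by (subst (asm) AE_iff_measurable[of "{0..c}"]) auto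
  then show False using c(1) by simp
qed

lemma mixed_time_spaceI:
  fixes u :: "real \<Rightarrow> 'a::euclidean_space \<Rightarrow> 'b::euclidean_space"
  assumes u: "case_prod u \<in> borel_measurable borel" and [measurable]: "G \<in> borel_measurable borel" and T: "0 < T"
    and G: "\<And>t x. ennreal (norm (u t x)) \<le> G x"
    and p: "\<And>x. 0 \<le> p x" and q: "0 < q" and \<mu>: "0 < \<mu>" and s: "small p \<mu> G" "small (\<lambda>_. q) \<mu> G"
  shows "u \<in> mixed_time_space p q T"
proof -
  define \<Phi> where "\<Phi> x = norm (real_of_ereal (time_sup_norm T u x))" for x
  note [measurable] = borel_measurable_time_sup_norm[OF u]
  have [measurable]: "\<Phi> \<in> borel_measurable borel" unfolding \<Phi>_def[abs_def] by measurable
  have le: "time_sup_norm T u x \<le> enn2ereal (G x)" for x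
  proof -
    have "ereal (norm (u t x)) \<le> enn2ereal (G x)" for t
      using G[of t x] by (simp add: less_eq_ennreal.rep_eq)
    then show ?thesis by (simp add: time_sup_norm_le[OF u])
  qed
  have \<Phi>G: "ennreal (\<Phi> x) \<le> G x" for x
  proof (cases "G x")
    case (real r)
    then have "time_sup_norm T u x \<le> ereal r" using le[of x] by simp
    moreover have "0 \<le> time_sup_norm T u x" by (rule time_sup_norm_nonneg[OF u T])
    ultimately have "\<Phi> x \<le> r" unfolding \<Phi>_def by (cases "time_sup_norm T u x") auto
    then show ?thesis using real by (simp add: ennreal_leI)
  qed simp
  have "AE x in lborel. G x < top"
  proof -
    have "modular (\<lambda>_. q) G \<le> ennreal (\<mu> powr q)" using s(2) \<mu> by (simp add: small_const_iff)
    then have "modular (\<lambda>_. q) G < top" by (rule order.strict_trans1) simp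
    then have "AE x in lborel. G x epowr q \<noteq> \<infinity>"
      by (intro nn_integral_PInf_AE) (auto simp: modular_def)
    then show ?thesis by (auto simp: less_top)
  qed
  then have fin: "AE x in lebesgue. time_sup_norm T u x < \<infinity>"
    unfolding AE_completion_iff
  proof eventually_elim
    case (elim x)
    then show ?case using le[of x] by (cases "G x") (auto intro: order.strict_trans1)
  qed
  have \<Phi>s: "small p \<mu> (\<lambda>x. ennreal (\<Phi> x))" "small (\<lambda>_. q) \<mu> (\<lambda>x. ennreal (\<Phi> x))"
    using s \<Phi>G \<mu> p q by (auto intro: small_mono)
  have ae: "AE x in lborel. norm (real_of_ereal (time_sup_norm T u x)) = \<Phi> x" by (simp add: \<Phi>_def)
  have "(\<lambda>x. real_of_ereal (time_sup_norm T u x)) \<in> mixed_space p q"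
    unfolding mixed_space_def
    using luxemburg_norm_finite[OF ae \<Phi>s(1) \<mu>] Lq_norm_finite[OF ae _ \<Phi>s(2) \<mu>]
    by (auto intro!: measurable_completion)
  moreover have "(\<lambda>(t, x). u t x) \<in> borel_measurable (space_time T)"
    using u by (intro measurable_restrict_space1 measurable_completion) simp
  ultimately show ?thesis using fin by (simp add: mixed_time_space_def)
qed

section \<open>Mild solutions\<close>

lemma maximal_cmult:
  assumes [measurable]: "f \<in> borel_measurable borel"
  shows "maximal (\<lambda>y. c * f y) x = c * maximal f x"
proof -
  have "(\<integral>\<^sup>+y\<in>ball x r. c * f y \<partial>lborel) = c * (\<integral>\<^sup>+y\<in>ball x r. f y \<partial>lborel)" for r
  proof -
    have [measurable]: "ball x r \<in> sets borel" by simp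
    have "(\<lambda>y. f y * indicator (ball x r) y) \<in> borel_measurable lborel" by measurable
    then show ?thesis by (simp add: mult.assoc nn_integral_cmult)
  qed
  moreover have "{r \<in> \<rat>. 0 < (r::real)} \<noteq> {}" by (auto intro!: exI[of _ 1])
  ultimately show ?thesis
    unfolding maximal_def by (simp add: SUP_mult_left_ennreal ennreal_times_divide)
qed

lemma small_maximal:
  assumes A: "1 \<le> A" "\<And>f. f \<in> borel_measurable borel \<Longrightarrow> modular q f \<le> 1 \<Longrightarrow> modular q (\<lambda>x. ennreal (1 / A) * maximal f x) \<le> 1"
    and [measurable]: "f \<in> borel_measurable borel" and s: "small q \<nu> f" and \<nu>: "0 < \<nu>"
  shows "small q (A * \<nu>) (maximal f)"
proof -
  have "modular q (\<lambda>x. ennreal (1 / A) * maximal (\<lambda>y. ennreal (1 / \<nu>) * f y) x) \<le> 1"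
    using s by (intro A(2)) (auto simp: small_def)
  moreover have "ennreal (1 / A) * maximal (\<lambda>y. ennreal (1 / \<nu>) * f y) x = ennreal (1 / (A * \<nu>)) * maximal f x" for x
    using A(1) \<nu> by (subst maximal_cmult) (auto simp: ennreal_mult_assoc)
  ultimately show ?thesis by (simp add: small_def)
qed

lemma small_riesz:
  assumes A: "1 \<le> A" "\<And>f. f \<in> borel_measurable borel \<Longrightarrow> modular (\<lambda>x. p x / 2) f \<le> 1 \<Longrightarrow>
      modular (\<lambda>_. 3 / 2) f \<le> 1 \<Longrightarrow> modular p (\<lambda>x. ennreal (1 / A) * riesz f x) \<le> 1"
    and [measurable]: "f \<in> borel_measurable borel" and s: "small (\<lambda>x. p x / 2) \<nu> f" "small (\<lambda>_. 3 / 2) \<nu> f" and \<nu>: "0 < \<nu>"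
  shows "small p (A * \<nu>) (riesz f)"
proof -
  have "modular p (\<lambda>x. ennreal (1 / A) * riesz (\<lambda>y. ennreal (1 / \<nu>) * f y) x) \<le> 1"
    using s by (intro A(2)) (auto simp: small_def)
  moreover have "ennreal (1 / A) * riesz (\<lambda>y. ennreal (1 / \<nu>) * f y) x = ennreal (1 / (A * \<nu>)) * riesz f x" for x
    using A(1) \<nu> by (subst riesz_cmult) (auto simp: ennreal_mult_assoc)
  ultimately show ?thesis by (simp add: small_def)
qed

lemma AE_finite_of_modular:
  assumes [measurable]: "f \<in> borel_measurable borel" and "modular (\<lambda>_. q) f < top"
  shows "AE x in lborel. f x < top"
proof -
  have "AE x in lborel. f x epowr q \<noteq> \<infinity>"
    using assms(2) by (intro nn_integral_PInf_AE) (auto simp: modular_def)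
  then show ?thesis by (auto simp: less_top)
qed

lemma modular_finite_of_small:
  assumes [measurable]: "f \<in> borel_measurable borel" and "0 < \<mu>" "small (\<lambda>_. q) \<mu> f"
  shows "modular (\<lambda>_. q) f < top"
proof -
  have "modular (\<lambda>_. q) f \<le> ennreal (\<mu> powr q)"
    using assms(3) small_const_iff[OF assms(1,2)] by blast
  also have "\<dots> < top" by simp
  finally show ?thesis .
qed

lemma modular_add_finite:
  assumes [measurable]: "f \<in> borel_measurable borel" "g \<in> borel_measurable borel"
    and "modular (\<lambda>_. q) f < top" "modular (\<lambda>_. q) g < top" "0 \<le> q"
  shows "modular (\<lambda>_. q) (\<lambda>x. f x + g x) < top"
proof -
  have "modular (\<lambda>_. q) (\<lambda>x. f x + g x) \<le> (\<integral>\<^sup>+x. ennreal (2 powr q) * (f x epowr q + g x epowr q) \<partial>lborel)"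
    unfolding modular_def using assms(5) by (intro nn_integral_mono epowr_add_le)
  also have "\<dots> = ennreal (2 powr q) * (modular (\<lambda>_. q) f + modular (\<lambda>_. q) g)"
    unfolding modular_def by (subst nn_integral_cmult, measurable, subst nn_integral_add, auto)
  also have "\<dots> < top" using assms(3,4) by (simp add: ennreal_mult_less_top)
  finally show ?thesis .
qed

section \<open>Log-Hoelder continuous exponents\<close>

lemma isCont_of_log_bound:
  fixes g :: "'a::euclidean_space \<Rightarrow> real"
  assumes g: "\<And>x y. \<bar>g x - g y\<bar> \<le> C / ln (exp 1 + 1 / norm (x - y))"
  shows "isCont g x"
  unfolding continuous_at_eps_delta
proof (intro allI impI)
  fix e :: real assume e: "0 < e"
  have C: "0 \<le> C" using g[of x x] by simp
  \<comment> \<open>Within this distance the logarithm exceeds (C + 1) / e; the summand 1 keeps the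
    numerator positive also for C = 0.\<close>
  define d where "d = 1 / exp ((C + 1) / e)"
  have "dist (g y) (g x) < e" if y: "dist y x < d" for y
  proof (cases "y = x")
    case False
    then have n: "0 < norm (y - x)" "norm (y - x) < d" using y by (auto simp: dist_norm)
    have "exp ((C + 1) / e) = 1 / d" by (simp add: d_def)
    also have "\<dots> \<le> 1 / norm (y - x)" using n by (intro frac_le) auto
    also have "\<dots> < exp 1 + 1 / norm (y - x)" by simp
    finally have "(C + 1) / e < ln (exp 1 + 1 / norm (y - x))"
      using n by (subst ln_exp[symmetric], subst ln_less_cancel_iff) (auto simp: add_pos_pos)
    moreover have "0 < (C + 1) / e" using C e by simp
    ultimately have l: "0 < ln (exp 1 + 1 / norm (y - x))" "(C + 1) / e < ln (exp 1 + 1 / norm (y - x))"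
      by linarith+
    then have "C + 1 < e * ln (exp 1 + 1 / norm (y - x))"
      using e by (simp add: pos_divide_less_eq mult.commute)
    then have "C / ln (exp 1 + 1 / norm (y - x)) < e"
      using l(1) by (subst pos_divide_less_eq) auto
    then show ?thesis using g[of y x] by (simp add: dist_real_def)
  qed (use e in simp)
  moreover have "0 < d" by (simp add: d_def)
  ultimately show "\<exists>d>0. \<forall>x'. dist x' x < d \<longrightarrow> dist (g x') (g x) < e" by blast
qed

text \<open>The exponent is continuous, so its essential bounds hold at every point. The conditions
  pass from 1/p to p because |s - t| = s t |1/s - 1/t|, which costs the factor b^2, and the limit of
  1/p lies between 1/b and 1/a, so its reciprocal is an admissible value at infinity.\<close>

lemma log_exponent_of_variable_exponent:
  fixes p :: "'a::euclidean_space \<Rightarrow> real"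
  assumes p: "p \<in> log_variable_exponents" and inf: "2 < exponent_inf p" and sup: "exponent_sup p < \<infinity>"
  shows "\<exists>a b C L. 2 < a \<and> log_exponent p a b C L \<and> log_exponent (\<lambda>x. p x / 2) (a / 2) (b / 2) (C / 2) (L / 2)"
proof -
  from p obtain C L where p1: "\<And>x. 1 \<le> p x" and lim: "((\<lambda>x. 1 / p x) \<longlongrightarrow> L) at_infinity"
    and loc: "\<And>x y. \<bar>1 / p x - 1 / p y\<bar> \<le> C / ln (exp 1 + 1 / norm (x - y))"
    and dec: "\<And>x. \<bar>1 / p x - L\<bar> \<le> C / ln (exp 1 + norm x)"
    by (auto simp: log_variable_exponents_def variable_exponents_def)
  have p0: "0 < p x" for x using p1[of x] by linarith
  have cont: "continuous_on UNIV p"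
  proof -
    define g where "g x = 1 / p x" for x
    have g: "isCont g x" "g x \<noteq> 0" for x
      using isCont_of_log_bound[OF loc, of x] p0[of x] by (auto simp: g_def[abs_def])
    have "p = (\<lambda>x. inverse (g x))" by (simp add: g_def)
    moreover have "isCont (\<lambda>x. inverse (g x)) x" for x
      using g by (intro continuous_at_within_inverse)
    ultimately show ?thesis by (simp add: continuous_on_eq_continuous_at)
  qed
  obtain a where a: "2 < a" "ereal a < exponent_inf p"
    using ereal_dense2[OF inf] by auto
  obtain b where b: "exponent_sup p < ereal b"
    using ereal_dense2[OF sup] by auto
  have "AE x in lebesgue. x \<in> {x. a \<le> p x \<and> p x \<le> b}"
    using esssup_AE[where M=lebesgue and f="\<lambda>x. - ereal (p x)"] esssup_AE[where M=lebesgue and f="\<lambda>x. ereal (p x)"]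
  proof eventually_elim
    case (elim x)
    have "exponent_inf p \<le> ereal (p x)"
      using elim(1) unfolding exponent_inf_def by (metis ereal_minus_le_minus ereal_uminus_uminus)
    moreover have "ereal (p x) \<le> exponent_sup p" using elim(2) by (simp add: exponent_sup_def)
    ultimately have "ereal a \<le> ereal (p x)" "ereal (p x) \<le> ereal b"
      using order.strict_trans2[OF a(2)] order.strict_trans1[OF _ b] by (blast intro: less_imp_le)+
    then show ?case by simp
  qed
  moreover have "closed {x. a \<le> p x \<and> p x \<le> b}"
    using cont by (intro closed_Collect_conj closed_Collect_le continuous_intros) auto
  ultimately have ab: "a \<le> p x \<and> p x \<le> b" for x
    using mem_closed_if_AE_lebesgue by blast
  have b0: "0 < b" "a \<le> b" using ab[of 0] a by linarith+
  have Lb: "1 / b \<le> L" "L \<le> 1 / a"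
  proof -
    show "1 / b \<le> L"
      using ab p0 b0 by (intro tendsto_lowerbound[OF lim] always_eventually allI frac_le)
        (auto simp: trivial_limit_at_infinity)
    show "L \<le> 1 / a"
      using ab a by (intro tendsto_upperbound[OF lim] always_eventually allI frac_le)
        (auto simp: trivial_limit_at_infinity)
  qed
  then have L0: "0 < L" using b0 by (smt (verit) divide_pos_pos)
  have aL: "a \<le> 1 / L" using Lb(2) L0 a by (simp add: field_simps)
  have Lb': "1 / L \<le> b" using Lb(1) L0 b0 by (simp add: field_simps)
  have C0: "0 \<le> C" using loc[of 0 0] by simp
  have ln_pos: "0 < ln (exp 1 + r)" if "0 \<le> r" for r :: real
    using that by (intro ln_gt_zero) (smt (verit) exp_gt_one)
  have diff: "\<bar>s - t\<bar> \<le> b\<^sup>2 * \<bar>1 / s - 1 / t\<bar>" if "0 < s" "0 < t" "s \<le> b" "t \<le> b" for s t :: real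
  proof -
    have "\<bar>s - t\<bar> = s * t * \<bar>1 / s - 1 / t\<bar>"
    proof -
      have "s - t = - (s * t * (1 / s - 1 / t))" using that by (simp add: field_simps)
      then show ?thesis using that by (simp add: abs_mult)
    qed
    also have "\<dots> \<le> b\<^sup>2 * \<bar>1 / s - 1 / t\<bar>"
      unfolding power2_eq_square using that by (intro mult_right_mono mult_mono) auto
    finally show ?thesis .
  qed
  have loc': "\<bar>p x - p y\<bar> \<le> b\<^sup>2 * C / ln (exp 1 + 1 / norm (x - y))" for x y
    using order_trans[OF diff[of "p x" "p y"] mult_left_mono[OF loc[of x y]]] p0 ab by simp
  have dec': "\<bar>p x - 1 / L\<bar> \<le> b\<^sup>2 * C / ln (exp 1 + norm x)" for x
  proof -
    have "\<bar>p x - 1 / L\<bar> \<le> b\<^sup>2 * \<bar>1 / p x - 1 / (1 / L)\<bar>"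
      using p0 ab L0 Lb' by (intro diff) auto
    also have "\<dots> \<le> b\<^sup>2 * (C / ln (exp 1 + norm x))"
      using dec[of x] by (intro mult_left_mono) auto
    finally show ?thesis by simp
  qed
  have meas: "p \<in> borel_measurable borel" using cont by (rule borel_measurable_continuous_onI)
  have "log_exponent p a b (b\<^sup>2 * C) (1 / L)"
    using a ab aL loc' dec' meas by unfold_locales auto
  moreover have "log_exponent (\<lambda>x. p x / 2) (a / 2) (b / 2) (b\<^sup>2 * C / 2) (1 / L / 2)"
  proof
    show "\<bar>p x / 2 - p y / 2\<bar> \<le> b\<^sup>2 * C / 2 / ln (exp 1 + 1 / norm (x - y))" for x y
      using loc'[of x y] by (simp add: diff_divide_distrib[symmetric] field_simps)
    show "\<bar>p x / 2 - 1 / L / 2\<bar> \<le> b\<^sup>2 * C / 2 / ln (exp 1 + norm x)" for x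
    proof -
      have "\<bar>p x / 2 - 1 / L / 2\<bar> = \<bar>p x - 1 / L\<bar> / 2"
        by (simp only: diff_divide_distrib[symmetric] abs_divide abs_numeral)
      also have "\<dots> \<le> b\<^sup>2 * C / ln (exp 1 + norm x) / 2" using dec'[of x] by (intro divide_right_mono) auto
      finally show ?thesis by (simp add: mult.commute)
    qed
  qed (use a ab aL meas in auto)
  ultimately show ?thesis using a(1) by blast
qed

text \<open>The heat kernel is at most sqrt t times \<open>time_kernel\<close>, whose convolution
  costs 1 / sqrt t; the powers cancel and the bound is uniform in t. The constant is 3932160 =
  122880 * 32.\<close>

lemma heat_convolution_bound:
  assumes [measurable]: "g \<in> borel_measurable borel" and t: "0 < t"
  shows "ennreal (norm (LINT y|lborel. heat_kernel t (x - y) *\<^sub>R g y))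
    \<le> ennreal (3932160 * unit_ball_vol 3) * maximal (\<lambda>y. ennreal (norm (g y :: real^3))) x"
proof -
  have "ennreal (norm (LINT y|lborel. heat_kernel t (x - y) *\<^sub>R g y))
      \<le> (\<integral>\<^sup>+y. ennreal (norm (heat_kernel t (x - y) *\<^sub>R g y)) \<partial>lborel)"
  proof (cases "integrable lborel (\<lambda>y. heat_kernel t (x - y) *\<^sub>R g y)")
    case True
    then show ?thesis by (rule integral_norm_bound_ennreal)
  qed (simp add: not_integrable_integral_eq)
  also have "\<dots> \<le> (\<integral>\<^sup>+y. ennreal (122880 * sqrt t) * (ennreal (norm (g y)) * ennreal (time_kernel t (y - x))) \<partial>lborel)"
  proof (intro nn_integral_mono)
    fix y
    have "norm (heat_kernel t (x - y) *\<^sub>R g y) = heat_kernel t (y - x) * norm (g y)"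
      by (simp add: heat_kernel_nonneg heat_kernel_minus[of t x y])
    also have "\<dots> \<le> 122880 * (sqrt t * time_kernel t (y - x)) * norm (g y)"
      by (intro mult_right_mono heat_kernel_bound t) simp
    finally have "ennreal (norm (heat_kernel t (x - y) *\<^sub>R g y)) \<le> ennreal (122880 * sqrt t * (norm (g y) * time_kernel t (y - x)))"
      by (intro ennreal_leI) (simp add: mult_ac)
    also have "\<dots> = ennreal (122880 * sqrt t) * (ennreal (norm (g y)) * ennreal (time_kernel t (y - x)))"
      using t by (simp add: ennreal_mult)
    finally show "ennreal (norm (heat_kernel t (x - y) *\<^sub>R g y)) \<le> \<dots>" .
  qed
  also have "\<dots> = ennreal (122880 * sqrt t) * (\<integral>\<^sup>+y. ennreal (norm (g y)) * ennreal (time_kernel t (y - x)) \<partial>lborel)"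
    by (rule nn_integral_cmult) measurable
  also have "\<dots> \<le> ennreal (122880 * sqrt t) * (ennreal (32 * unit_ball_vol 3 / sqrt t) * maximal (\<lambda>y. ennreal (norm (g y))) x)"
    by (intro mult_left_mono time_kernel_convolution_le t) auto
  also have "\<dots> = ennreal (122880 * sqrt t * (32 * unit_ball_vol 3 / sqrt t)) * maximal (\<lambda>y. ennreal (norm (g y))) x"
    using t by (intro ennreal_mult_assoc) auto
  also have "122880 * sqrt t * (32 * unit_ball_vol 3 / sqrt t) = 3932160 * unit_ball_vol 3"
    using t by simp
  finally show ?thesis .
qed

lemma heat_conv_eq:
  assumes u0: "AE x in lborel. u0 x = g x" and [measurable]: "g \<in> borel_measurable borel"
  shows "heat_conv t u0 x = (LINT y|lborel. heat_kernel t (x - y) *\<^sub>R g y)"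
proof -
  have "heat_conv t u0 x = (LINT y|lebesgue. heat_kernel t (x - y) *\<^sub>R g y)"
    unfolding heat_conv_def
    using u0 by (intro integral_lebesgue_cong_AE) (auto simp: AE_completion_iff elim!: eventually_mono)
  also have "\<dots> = (LINT y|lborel. heat_kernel t (x - y) *\<^sub>R g y)"
    by (rule integral_completion) measurable
  finally show ?thesis .
qed

abbreviation heat_div_kernel :: "3 \<Rightarrow> 3 \<Rightarrow> 3 \<Rightarrow> real \<Rightarrow> real^3 \<Rightarrow> real" where
  "heat_div_kernel i j k t z \<equiv> of_bool (i = j) * heat_grad k t z"

interpretation heat: duhamel_kernel heat_div_kernel 368640
  by (rule duhamel_kernel_heat)

interpretation oseen: duhamel_kernel oseen_kernel 368640
  by (rule duhamel_kernel_oseen)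

text \<open>The minus sign is that of \<open>heat_conv_div_eq\<close>. The value 0 for nonpositive
  times lets one majorant serve for all real times.\<close>

definition linear_part :: "(real^3 \<Rightarrow> real^3) \<Rightarrow> (real \<Rightarrow> real^3 \<Rightarrow> real^3^3) \<Rightarrow> real \<Rightarrow> real^3 \<Rightarrow> real^3" where
  "linear_part g F t x = (if 0 < t then (LINT y|lborel. heat_kernel t (x - y) *\<^sub>R g y) - duhamel heat_div_kernel F t x else 0)"

text \<open>The right-hand side does not depend on the representatives chosen for the data and the
  velocity. What is excluded is the time 0 and the points where one of the two potentials is
  infinite.\<close>

lemma mild_right_side_eq:
  assumes u0: "AE x in lborel. u0 x = g x" and [measurable]: "g \<in> borel_measurable borel"
    and F: "AE p in lborel. fst p \<in> time_interval T \<longrightarrow> F (fst p) (snd p) = F' (fst p) (snd p)"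
    and F'[measurable]: "case_prod F' \<in> borel_measurable borel" "\<Phi> \<in> borel_measurable borel"
    and \<Phi>: "\<And>s y. ennreal (norm (F' s y)) \<le> \<Phi> y" "AE x in lborel. riesz \<Phi> x < top"
    and w: "AE p in lborel. fst p \<in> time_interval T \<longrightarrow> w (fst p) (snd p) = w' (fst p) (snd p)"
    and w'[measurable]: "case_prod w' \<in> borel_measurable borel" "G \<in> borel_measurable borel"
    and G: "\<And>s y. ennreal (norm (w' s y)) \<le> G y" "AE x in lborel. riesz (\<lambda>y. G y * G y) x < top"
  shows "AE p in lborel. fst p \<in> time_interval T \<longrightarrow>
     heat_conv (fst p) u0 (snd p)
       + (LINT s:{0..fst p}|lebesgue. heat_conv_div (fst p - s) (F s) (snd p))
       - (LINT s:{0..fst p}|lebesgue. heat_conv_leray_div (fst p - s) (\<lambda>y. tensor (w s y) (w s y)) (snd p))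
     = linear_part g F' (fst p) (snd p) + duhamel oseen_kernel (\<lambda>s y. tensor (w' s y) (w' s y)) (fst p) (snd p)"
proof -
  have [measurable]: "(\<lambda>p. w' (fst p) (snd p)) \<in> borel_measurable borel"
    using w'(1) by (simp add: split_beta')
  have "AE p in (lborel :: (real \<times> (real^3)) measure). fst p \<noteq> 0"
    by (rule AE_lborel_pairI_snd) (auto intro: AE_lborel_singleton)
  then show ?thesis
    using AE_lborel_snd[OF \<Phi>(2)] AE_lborel_snd[OF G(2)]
  proof eventually_elim
    case (elim p)
    show ?case
    proof
      assume p: "fst p \<in> time_interval T"
      then have t: "0 < fst p" using elim(1) by (simp add: time_interval_def)
      have down: "s \<in> time_interval T" if "0 \<le> s" "s < fst p" for s
        using p that by (auto simp: time_interval_def intro: less_trans[of "ereal s" "ereal (fst p)"])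
      have 1: "(LINT s:{0..fst p}|lebesgue. heat_conv_div (fst p - s) (F s) (snd p)) = - duhamel heat_div_kernel F' (fst p) (snd p)"
      proof (rule heat.time_integral_kernel_conv[where op=heat_conv_div, OF _ F' _ \<Phi>(1) elim(2)])
        show "heat_conv_div s N (snd p) = - kernel_conv heat_div_kernel s N (snd p)" if "0 < s" for s N
          using that by (rule heat_conv_div_eq)
        show "AE q in lborel. 0 \<le> fst q \<and> fst q < fst p \<longrightarrow> F (fst q) (snd q) = F' (fst q) (snd q)"
          using F by eventually_elim (use down in auto)
      qed
      have 2: "(LINT s:{0..fst p}|lebesgue. heat_conv_leray_div (fst p - s) (\<lambda>y. tensor (w s y) (w s y)) (snd p))
          = - duhamel oseen_kernel (\<lambda>s y. tensor (w' s y) (w' s y)) (fst p) (snd p)"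
      proof (rule oseen.time_integral_kernel_conv[where op=heat_conv_leray_div and M="\<lambda>s y. tensor (w s y) (w s y)" and g="\<lambda>y. G y * G y"])
        show "heat_conv_leray_div s N (snd p) = - kernel_conv oseen_kernel s N (snd p)" if "0 < s" for s N
          using that by (rule heat_conv_leray_div_eq)
        show "(\<lambda>(s, y). tensor (w' s y) (w' s y)) \<in> borel_measurable borel" by (simp add: split_beta')
        show "AE q in lborel. 0 \<le> fst q \<and> fst q < fst p \<longrightarrow> tensor (w (fst q) (snd q)) (w (fst q) (snd q)) = tensor (w' (fst q) (snd q)) (w' (fst q) (snd q))"
          using w by eventually_elim (use down in auto)
        show "ennreal (norm (tensor (w' s y) (w' s y))) \<le> G y * G y" for s y
          using G(1) by (auto simp: norm_tensor ennreal_mult intro!: mult_mono)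
      qed (use elim in auto)
      show "heat_conv (fst p) u0 (snd p)
       + (LINT s:{0..fst p}|lebesgue. heat_conv_div (fst p - s) (F s) (snd p))
       - (LINT s:{0..fst p}|lebesgue. heat_conv_leray_div (fst p - s) (\<lambda>y. tensor (w s y) (w s y)) (snd p))
     = linear_part g F' (fst p) (snd p) + duhamel oseen_kernel (\<lambda>s y. tensor (w' s y) (w' s y)) (fst p) (snd p)"
        unfolding 1 2 heat_conv_eq[OF u0 assms(2)] using t by (simp add: linear_part_def)
    qed
  qed
qed

theorem theorem1:
  fixes p :: "real^3 \<Rightarrow> real"
  assumes "p \<in> log_variable_exponents"
    and "2 < exponent_inf p" and "exponent_inf p \<le> exponent_sup p" and "exponent_sup p < \<infinity>"
  shows "\<exists>\<eta>::real. 0 < \<eta> \<and>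
    (\<forall>(T::ereal) (u0 :: real^3 \<Rightarrow> real^3) (F :: real \<Rightarrow> real^3 \<Rightarrow> real^3^3).
       0 < T \<longrightarrow>
       u0 \<in> mixed_space p 3 \<longrightarrow> div_free u0 \<longrightarrow>
       F \<in> mixed_time_space (\<lambda>x. p x / 2) (3 / 2) T \<longrightarrow> force_div_free T F \<longrightarrow>
       mixed_norm p 3 u0 + mixed_time_norm (\<lambda>x. p x / 2) (3 / 2) T F \<le> ennreal \<eta> \<longrightarrow>
       (\<exists>u. u \<in> mixed_time_space p 3 T \<and> mild_solution T u0 F u \<and>
          (\<forall>v. v \<in> mixed_time_space p 3 T \<and> mild_solution T u0 F v \<longrightarrow>
             (AE (t, x) in space_time T. v t x = u t x))))"
proof -
  obtain a b C L where a: "2 < a" and P: "log_exponent p a b C L"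
    and P2: "log_exponent (\<lambda>x. p x / 2) (a / 2) (b / 2) (C / 2) (L / 2)"
    using log_exponent_of_variable_exponent[OF assms(1,2,4)] by blast
  interpret P: log_exponent p a b C L by (rule P)
  have p1: "1 \<le> p x" "0 \<le> p x" for x using P.ab(1)[of x] a by linarith+
  obtain A1 where A1: "1 \<le> A1" "\<And>f. f \<in> borel_measurable borel \<Longrightarrow> modular p f \<le> 1 \<Longrightarrow>
      modular p (\<lambda>x. ennreal (1 / A1) * maximal f x) \<le> 1"
    using P.modular_maximal by blast
  obtain A2 where A2: "1 \<le> A2" "\<And>f::real^3 \<Rightarrow> ennreal. f \<in> borel_measurable borel \<Longrightarrow> modular (\<lambda>_. 3) f \<le> 1 \<Longrightarrow>
      modular (\<lambda>_. 3) (\<lambda>x. ennreal (1 / A2) * maximal f x) \<le> 1"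
    using log_exponent.modular_maximal[OF log_exponent_const[of 3], where 'a="real^3"] by auto
  obtain A3 where A3: "1 \<le> A3" "\<And>f. f \<in> borel_measurable borel \<Longrightarrow> modular (\<lambda>x. p x / 2) f \<le> 1 \<Longrightarrow>
      modular (\<lambda>_. 3 / 2) f \<le> 1 \<Longrightarrow> modular p (\<lambda>x. ennreal (1 / A3) * riesz f x) \<le> 1"
    using modular_riesz[OF P2] by blast
  obtain A4 where A4: "1 \<le> A4" "\<And>f. f \<in> borel_measurable borel \<Longrightarrow>
      modular (\<lambda>_. 3 / 2) f \<le> 1 \<Longrightarrow> modular (\<lambda>_. 3) (\<lambda>x. ennreal (1 / A4) * riesz f x) \<le> 1"
    using modular_riesz[of "\<lambda>_. 3", OF log_exponent_const[of "3 / 2"]] by auto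
  define K :: real where "K = 368640"
  define c where "c = 3932160 * unit_ball_vol 3"
  \<comment> \<open>The radius of the invariant ball in \<open>small_Gsup\<close>, small enough for
    the constants of both norms at once.\<close>
  define \<mu> where "\<mu> = 1 / (216 * K * (A3 + A4))"
  \<comment> \<open>A crude common bound for the constants of the initial datum and of the force in
    both norms.\<close>
  define D where "D = (c + 54 * K) * (A1 + A2 + A3 + A4)"
  \<comment> \<open>The iteration wants its inhomogeneity below a quarter of \<open>\<mu>\<close>,
    and by \<open>small_add\<close> each of its two summands below a quarter of that; hence
    16.\<close>
  define \<eta> where "\<eta> = \<mu> / (16 * D)"
  have K: "0 < K" by (simp add: K_def)
  have c: "0 < c" by (simp add: c_def)
  have \<mu>: "0 < \<mu>" "216 * K * A3 * \<mu> \<le> 1" "216 * K * A4 * \<mu> \<le> 1"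
    using A3(1) A4(1) K by (simp_all add: \<mu>_def)
  have D: "0 < D" using A1(1) A2(1) A3(1) A4(1) K c by (simp add: D_def)
  have \<eta>: "0 < \<eta>" using \<mu>(1) D by (simp add: \<eta>_def)
  have scale: "d * (A * \<eta>) \<le> \<mu> / 4 / 4" if "0 \<le> d" "d \<le> c + 54 * K" "0 \<le> A" "A \<le> A1 + A2 + A3 + A4" for d A
  proof -
    have "d * A \<le> D" unfolding D_def using that c K by (intro mult_mono) auto
    then have "d * A * \<eta> \<le> D * \<eta>" using \<eta> by (intro mult_right_mono) auto
    also have "D * \<eta> = \<mu> / 4 / 4" using D by (simp add: \<eta>_def)
    finally show ?thesis by (simp add: mult.assoc)
  qed
  show ?thesis
  proof (intro exI[of _ "\<eta> / 2"] conjI allI impI)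
    show "0 < \<eta> / 2" using \<eta> by simp
    fix T :: ereal and u0 :: "real^3 \<Rightarrow> real^3" and F :: "real \<Rightarrow> real^3 \<Rightarrow> real^3^3"
    assume T: "0 < T" and u0: "u0 \<in> mixed_space p 3" and F: "F \<in> mixed_time_space (\<lambda>x. p x / 2) (3 / 2) T"
      and le: "mixed_norm p 3 u0 + mixed_time_norm (\<lambda>x. p x / 2) (3 / 2) T F \<le> ennreal (\<eta> / 2)"
    have "u0 \<in> borel_measurable lebesgue" using u0 by (simp add: mixed_space_def)
    then obtain g where g [measurable]: "g \<in> borel_measurable borel" and u0_eq: "AE x in lborel. u0 x = g x"
      using lebesgue_borel_version by blast
    have g_norm: "AE x in lborel. norm (u0 x) = norm (g x)" using u0_eq by eventually_elim simp
    obtain F' \<Phi> where F' [measurable]: "case_prod F' \<in> borel_measurable borel" "\<Phi> \<in> borel_measurable borel"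
      and \<Phi>: "\<And>x. 0 \<le> \<Phi> x" "\<And>t x. norm (F' t x) \<le> \<Phi> x"
      and F_eq: "AE p in lborel. fst p \<in> time_interval T \<longrightarrow> F (fst p) (snd p) = F' (fst p) (snd p)"
      and \<Phi>_norm: "AE x in lborel. norm (real_of_ereal (time_sup_norm T F x)) = \<Phi> x"
      using time_regularization[OF F] by blast
    \<comment> \<open>Halving the constant turns the hypothesis into the strict inequalities needed
      to pass from norms to modulars.\<close>
    have lt: "ennreal (\<eta> / 2) < ennreal \<eta>" using \<eta> by (simp add: ennreal_less_iff)
    have le1: "mixed_norm p 3 u0 < ennreal \<eta>"
      using le lt by (meson add_increasing2 order.strict_trans1 order_trans order_refl zero_le le_add_same_cancel1)
    have le2: "mixed_time_norm (\<lambda>x. p x / 2) (3 / 2) T F < ennreal \<eta>"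
      using le lt by (meson add_increasing order.strict_trans1 order_trans order_refl zero_le)
    have g_small: "small p \<eta> (\<lambda>x. ennreal (norm (g x)))" "small (\<lambda>_. 3) \<eta> (\<lambda>x. ennreal (norm (g x)))"
    proof -
      show "small p \<eta> (\<lambda>x. ennreal (norm (g x)))"
        using le1 p1 by (intro small_of_luxemburg_norm[OF g_norm]) (auto simp: mixed_norm_def)
      show "small (\<lambda>_. 3) \<eta> (\<lambda>x. ennreal (norm (g x)))"
        using le1 \<eta> by (intro small_of_Lq_norm[OF g_norm]) (auto simp: mixed_norm_def)
    qed
    have \<Phi>_small: "small (\<lambda>x. p x / 2) \<eta> (\<lambda>x. ennreal (\<Phi> x))" "small (\<lambda>_. 3 / 2) \<eta> (\<lambda>x. ennreal (\<Phi> x))"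
    proof -
      show "small (\<lambda>x. p x / 2) \<eta> (\<lambda>x. ennreal (\<Phi> x))"
        using le2 p1 by (intro small_of_luxemburg_norm[OF \<Phi>_norm]) (auto simp: mixed_time_norm_def mixed_norm_def)
      show "small (\<lambda>_. 3 / 2) \<eta> (\<lambda>x. ennreal (\<Phi> x))"
        using le2 \<eta> by (intro small_of_Lq_norm[OF \<Phi>_norm]) (auto simp: mixed_time_norm_def mixed_norm_def)
    qed
    define E1 where "E1 x = ennreal c * maximal (\<lambda>y. ennreal (norm (g y))) x" for x
    define E2 where "E2 x = ennreal (54 * K) * riesz (\<lambda>y. ennreal (\<Phi> y)) x" for x
    have [measurable]: "E1 \<in> borel_measurable borel" "E2 \<in> borel_measurable borel"
      unfolding E1_def[abs_def] E2_def[abs_def] by measurable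
    have E1: "small p (\<mu> / 4 / 4) E1"
    proof (rule small_mono)
      show "small p (c * (A1 * \<eta>)) E1"
        unfolding E1_def[abs_def] using c A1(1) \<eta> small_maximal[OF A1 _ g_small(1) \<eta>]
        by (intro small_cmult) auto
      show "c * (A1 * \<eta>) \<le> \<mu> / 4 / 4"
        using A1(1) A2(1) A3(1) A4(1) c K by (intro scale) auto
    qed (use p1 c A1(1) \<eta> in auto)
    have E1': "small (\<lambda>_. 3) (\<mu> / 4 / 4) E1"
    proof (rule small_mono)
      show "small (\<lambda>_. 3) (c * (A2 * \<eta>)) E1"
        unfolding E1_def[abs_def] using c A2(1) \<eta> small_maximal[OF A2 _ g_small(2) \<eta>]
        by (intro small_cmult) auto
      show "c * (A2 * \<eta>) \<le> \<mu> / 4 / 4"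
        using A1(1) A2(1) A3(1) A4(1) c K by (intro scale) auto
    qed (use p1 c A2(1) \<eta> in auto)
    have E2: "small p (\<mu> / 4 / 4) E2"
    proof (rule small_mono)
      show "small p ((54 * K) * (A3 * \<eta>)) E2"
        unfolding E2_def[abs_def] using K A3(1) \<eta> small_riesz[OF A3 _ \<Phi>_small \<eta>]
        by (intro small_cmult) auto
      show "(54 * K) * (A3 * \<eta>) \<le> \<mu> / 4 / 4"
        using A1(1) A2(1) A3(1) A4(1) c K by (intro scale) auto
    qed (use p1 K A3(1) \<eta> in auto)
    have riesz_small: "small (\<lambda>_. 3) (A4 * \<eta>) (riesz (\<lambda>y. ennreal (\<Phi> y)))"
      using A4 \<Phi>_small(2) \<eta> by (intro small_riesz) auto
    have E2': "small (\<lambda>_. 3) (\<mu> / 4 / 4) E2"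
    proof (rule small_mono)
      show "small (\<lambda>_. 3) ((54 * K) * (A4 * \<eta>)) E2"
        unfolding E2_def[abs_def] using K A4(1) \<eta> riesz_small
        by (intro small_cmult) auto
      show "(54 * K) * (A4 * \<eta>) \<le> \<mu> / 4 / 4"
        using A1(1) A2(1) A3(1) A4(1) c K by (intro scale) auto
    qed (use p1 K A4(1) \<eta> in auto)
    define E where "E x = E1 x + E2 x" for x
    have E: "small p (\<mu> / 4) E" "small (\<lambda>_. 3) (\<mu> / 4) E"
      unfolding E_def[abs_def] using \<mu>(1) p1 by (auto intro!: small_add E1 E1' E2 E2')
    let ?a = "linear_part g F'"
    interpret picard oseen_kernel 368640 ?a E
    proof
      have [measurable]: "(\<lambda>p. duhamel heat_div_kernel F' (fst p) (snd p)) \<in> borel_measurable borel"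
        using heat.measurable_duhamel[OF F'(1)] by (simp add: split_beta')
      show "case_prod ?a \<in> borel_measurable borel"
        unfolding linear_part_def split_beta' by measurable
      show "E \<in> borel_measurable borel" unfolding E_def[abs_def] by measurable
      show "ennreal (norm (?a t x)) \<le> E x" for t x
      proof (cases "0 < t")
        case True
        have "ennreal (norm (?a t x)) \<le> ennreal (norm (LINT y|lborel. heat_kernel t (x - y) *\<^sub>R g y)) + ennreal (norm (duhamel heat_div_kernel F' t x))"
          using True norm_triangle_ineq4 by (simp add: linear_part_def ennreal_leI flip: ennreal_plus)
        also have "\<dots> \<le> E x"
          unfolding E_def E1_def E2_def c_def K_def
          using True \<Phi> by (intro add_mono heat_convolution_bound heat.norm_duhamel_le) (auto intro!: ennreal_leI)
        finally show ?thesis .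
      qed (simp add: linear_part_def)
    qed
    have Gs: "small p \<mu> Gsup" "small (\<lambda>_. 3) \<mu> Gsup"
      by (rule small_Gsup[OF P.measurable_q p1(1) A3(1) _ A4(1) _ \<mu>(1) \<mu>(2)[unfolded K_def] \<mu>(3)[unfolded K_def] E];
          use A3(2) A4(2) in blast)+
    have G_fin: "modular (\<lambda>_. 3) Gsup < top"
      using Gs(2) \<mu>(1) by (intro modular_finite_of_small) auto
    obtain u where u [measurable]: "case_prod u \<in> borel_measurable borel" and u_le: "\<And>t x. ennreal (norm (u t x)) \<le> Gsup x"
      and u_eq: "\<And>t x. Gsup x < top \<Longrightarrow> u t x = ?a t x + duhamel oseen_kernel (\<lambda>s y. tensor (u s y) (u s y)) t x"
      using picard_solution by blast
    have \<Phi>_fin: "AE x in lborel. riesz (\<lambda>y. ennreal (\<Phi> y)) x < top"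
      using riesz_small A4(1) \<eta> by (intro AE_finite_of_modular[of _ 3] modular_finite_of_small[of _ "A4 * \<eta>"]) auto
    have \<Phi>': "ennreal (norm (F' s y)) \<le> ennreal (\<Phi> y)" for s y using \<Phi>(2) by (rule ennreal_leI)
    have rhs: "AE p in lborel. fst p \<in> time_interval T \<longrightarrow>
       heat_conv (fst p) u0 (snd p)
         + (LINT s:{0..fst p}|lebesgue. heat_conv_div (fst p - s) (F s) (snd p))
         - (LINT s:{0..fst p}|lebesgue. heat_conv_leray_div (fst p - s) (\<lambda>y. tensor (w s y) (w s y)) (snd p))
       = ?a (fst p) (snd p) + duhamel oseen_kernel (\<lambda>s y. tensor (w' s y) (w' s y)) (fst p) (snd p)"
      if "AE p in lborel. fst p \<in> time_interval T \<longrightarrow> w (fst p) (snd p) = w' (fst p) (snd p)"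
        "case_prod w' \<in> borel_measurable borel" "H \<in> borel_measurable borel"
        "\<And>s y. ennreal (norm (w' s y)) \<le> H y" "modular (\<lambda>_. 3) H < top" for w w' H
      using that by (intro mild_right_side_eq[OF u0_eq g F_eq F'(1) _ \<Phi>' \<Phi>_fin, where G=H] AE_riesz_square_finite) auto
    have u_eq': "AE p in lborel. fst p \<in> time_interval T \<longrightarrow>
        u (fst p) (snd p) = ?a (fst p) (snd p) + duhamel oseen_kernel (\<lambda>s y. tensor (u s y) (u s y)) (fst p) (snd p)"
      using AE_lborel_snd[OF AE_finite_of_modular[OF measurable_Gsup G_fin]]
      by eventually_elim (use u_eq in auto)
    show "\<exists>u. u \<in> mixed_time_space p 3 T \<and> mild_solution T u0 F u \<and>
          (\<forall>v. v \<in> mixed_time_space p 3 T \<and> mild_solution T u0 F v \<longrightarrow>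
             (AE (t, x) in space_time T. v t x = u t x))"
    proof (intro exI[of _ u] conjI allI impI)
      show "u \<in> mixed_time_space p 3 T"
        using u_le p1 \<mu>(1) Gs T by (intro mixed_time_spaceI[where G=Gsup and \<mu>=\<mu>]) auto
      show "mild_solution T u0 F u"
        unfolding mild_solution_def split_beta' space_time_AE_iff
        using u_eq' rhs[OF AE_I2[OF impI[OF refl]] u measurable_Gsup u_le G_fin] by eventually_elim auto
      fix v assume v: "v \<in> mixed_time_space p 3 T \<and> mild_solution T u0 F v"
      obtain v' \<Psi> where v' [measurable]: "case_prod v' \<in> borel_measurable borel" "\<Psi> \<in> borel_measurable borel"
        and \<Psi>: "\<And>x. 0 \<le> \<Psi> x" "\<And>t x. norm (v' t x) \<le> \<Psi> x"
        and v_eq: "AE p in lborel. fst p \<in> time_interval T \<longrightarrow> v (fst p) (snd p) = v' (fst p) (snd p)"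
        and \<Psi>_norm: "AE x in lborel. norm (real_of_ereal (time_sup_norm T v x)) = \<Psi> x"
        using v time_regularization[of v p 3 T] by blast
      have \<Psi>_fin: "modular (\<lambda>_. 3) (\<lambda>x. ennreal (\<Psi> x)) < top"
        using v by (intro modular_finite_of_Lq_norm[OF \<Psi>_norm]) (simp add: mixed_time_space_def mixed_space_def)
      have \<Psi>': "ennreal (norm (v' s y)) \<le> ennreal (\<Psi> y)" for s y using \<Psi>(2) by (rule ennreal_leI)
      have "AE p in lborel. fst p \<in> time_interval T \<longrightarrow> v (fst p) (snd p) = heat_conv (fst p) u0 (snd p)
         + (LINT s:{0..fst p}|lebesgue. heat_conv_div (fst p - s) (F s) (snd p))
         - (LINT s:{0..fst p}|lebesgue. heat_conv_leray_div (fst p - s) (\<lambda>y. tensor (v s y) (v s y)) (snd p))"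
        using v unfolding mild_solution_def split_beta' space_time_AE_iff by simp
      then have v'_eq: "AE p in lborel. fst p \<in> time_interval T \<longrightarrow>
          v' (fst p) (snd p) = ?a (fst p) (snd p) + duhamel oseen_kernel (\<lambda>s y. tensor (v' s y) (v' s y)) (fst p) (snd p)"
        using v_eq rhs[OF v_eq v'(1) measurable_compose[OF v'(2) measurable_ennreal] \<Psi>' \<Psi>_fin] by eventually_elim auto
      have "AE p in lborel. fst p \<in> time_interval T \<longrightarrow> u (fst p) (snd p) = v' (fst p) (snd p)"
      \<comment> \<open>The majorant of the competing solution enters only with finite L^3 modular;
        no smallness of it is available.\<close>
      proof (rule oseen.duhamel_unique[where S="\<lambda>x. Gsup x + ennreal (\<Psi> x)" and a="?a"])
        show "modular (\<lambda>_. 3) (\<lambda>x. Gsup x + ennreal (\<Psi> x)) < top"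
          using G_fin \<Psi>_fin by (intro modular_add_finite) auto
        show "ennreal (norm (u s y)) + ennreal (norm (v' s y)) \<le> Gsup y + ennreal (\<Psi> y)" for s y
          by (intro add_mono u_le \<Psi>')
      qed (use u_eq' v'_eq in auto)
      then show "AE (t, x) in space_time T. v t x = u t x"
        unfolding split_beta' space_time_AE_iff using v_eq by eventually_elim auto
    qed
  qed
qed

end
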